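(* For each $n\ge1$ let $(\Pi_n,X_n)$ be a Nash equilibrium of the reduced game $\overline{G}_n(\mu)$, let $(p^n_q)_{q=1,\dots,n}$ be the corresponding price process (pure strategy of player 2), and set $Z^n_t:=p^n_{\lfloor nt\rfloor}$ for $t\in\,]0,1]$. Let $\nu$ be the unique probability measure on $\mathbb{R}$ with $T_{\overline\lambda_\infty}(\nu)=\overline\lambda_\infty$, where $\overline\lambda_\infty=\mathcal{N}(0,1)$, and let $B$ be a standard Brownian motion. Then, under the equivalent martingale measure (i.e. when $(u_1,\dots,u_n)\sim\lambda_n$), as $n\to\infty$ the processes $(Z^n_t)_{t\in]0,1]}$ converge in finite dimensional distribution to the process $Z$ given by $Z_t:=E[\Psi_{\nu,\overline{\lambda}_{\infty}}'(B_1)\mid B_t]$, and $Z$ is a continuous martingale of maximal variation (CMMV).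
   Context: Standing assumptions. (A1) $\mu$ is a probability measure on $[0,1]$, absolutely continuous with respect to Lebesgue measure, with strictly positive $C^1$ density $f_\mu$ on $[0,1]$. (A2) $H:\mathbb{R}\to\mathbb{R}$ is strictly increasing, strictly convex and $C^2$, $H'$ is Lipschitz-continuous, and there are constants $\epsilon,K>0$ with $\epsilon<H'(x)<K$ for all $x\in\mathbb{R}$. Game. $\Omega_n=\{-1,+1\}^n$, $\omega=(u_1,\dots,u_n)$; $\lambda_n$ is the uniform probability on $\Omega_n$; $S_n(\omega)=\frac{1}{\sqrt n}\sum_{q=1}^n u_q$. In the reduced game $\overline{G}_n(\mu)$, a strategy of player 1 is a probability $\Pi$ on pairs $(\omega,L)\in\Omega_n\times\mathbb{R}$ whose marginal on $L$ is $\mu$. A strategy of player 2 is a sequence $(p_1,\dots,p_n)$ with $p_q:\{-1,+1\}^{q-1}\to\mathbb{R}$, identified with the function $X(\omega)=\frac{1}{\sqrt n}\sum_{q=1}^n u_q\,p_q(u_1,\dots,u_{q-1})$, which determines $(p_q)$ uniquely; $\mathbb{X}_n$ is the set of such functions. Payoffs: $g_1(\Pi,X)=E_\Pi[LS_n-X]$ (maximized by player 1), $g_2(\Pi,X)=E_\Pi[H(LS_n-X)]$ (minimized by player 2). A Nash equilibrium is a pair $(\Pi,X)$ such that $\Pi$ maximizes $g_1(\cdot,X)$ and $X$ minimizes $g_2(\Pi,\cdot)$. For $t<1/n$ the value $Z^n_t$ is irrelevant (take e.g. $p^n_0:=p^n_1$). Operator $T_\lambda$. $F_\mu,F_\nu$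 denote cumulative distribution functions, $F^{-1}(y)=\inf\{x\mid F(x)>y\}$ their right inverses, with $F_\mu^{-1}(1)=1$. For a probability $\nu$ on $\mathbb{R}$: $\phi_\nu(\ell)=F_\nu^{-1}(F_\mu(\ell))$, $\gamma_\nu(s)=F_\mu^{-1}(F_\nu(s))$, $\Gamma_\nu(s)=\int_0^s\gamma_\nu(t)\,dt$; $\overline\Pi_\nu$ is the law of $(L,\phi_\nu(L))$ when $L\sim\mu$. For a probability $\lambda$ on $\mathbb{R}$ with finite first moment, $\Psi_{\nu,\lambda}(s)=\Gamma_\nu(s)-E_\lambda[\Gamma_\nu]$. With $(L,S)\sim\overline\Pi_\nu$, let $Y_{\nu,\lambda}=E_{\overline\Pi_\nu}[H'(LS-\Psi_{\nu,\lambda}(S))\mid S]$ (a function of $S$), $\alpha_{\nu,\lambda}=1/E_\nu[Y_{\nu,\lambda}]$, and let $T_\lambda(\nu)$ be the probability measure with density $\alpha_{\nu,\lambda}Y_{\nu,\lambda}$ with respect to $\nu$. There is a unique $\nu$ with $T_{\overline\lambda_\infty}(\nu)=\overline\lambda_\infty$, and for it $\Psi_{\nu,\overline\lambda_\infty}$ is $C^2$. Convergence in finite dimensional distribution of $Z^n$ to $Z$: for every finite set $J$ of times in $]0,1]$, the random vectors $(Z^n_t)_{t\in J}$ converge in law to $(Z_t)_{t\in J}$. A CMMV is a martingale of the form $f(B_t,t)$, $t\in[0,1]$, with $B$ a standard Brownian motion and $f:\mathbb{R}\times[0,1]\to\mathbb{R}$ increasing in its first variable. *)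

theory Defs
  imports "HOL-Probability.Probability"
begin

section \<open>Standing assumptions\<close>

definition admissible_prior :: "real measure \<Rightarrow> bool" where
  "admissible_prior \<mu> \<longleftrightarrow> prob_space \<mu> \<and>
     (\<exists>f f'. (\<forall>x\<in>{0..1}. 0 < f x \<and> (f has_real_derivative f' x) (at x within {0..1}))
        \<and> continuous_on {0..1} f'
        \<and> \<mu> = density lborel (\<lambda>x. ennreal (f x * indicator {0..1} x)))"

definition strictly_convex :: "(real \<Rightarrow> real) \<Rightarrow> bool" where
  "strictly_convex H \<longleftrightarrow>
     (\<forall>x y t. x \<noteq> y \<longrightarrow> 0 < t \<longrightarrow> t < 1 \<longrightarrow>
        H ((1 - t) * x + t * y) < (1 - t) * H x + t * H y)"

definition admissible_risk :: "(real \<Rightarrow> real) \<Rightarrow> bool" where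
  "admissible_risk H \<longleftrightarrow> strict_mono H \<and> strictly_convex H
     \<and> (\<forall>x. (H has_real_derivative deriv H x) (at x))
     \<and> (\<forall>x. (deriv H has_real_derivative deriv (deriv H) x) (at x))
     \<and> continuous_on UNIV (deriv (deriv H))
     \<and> (\<exists>C. C-lipschitz_on UNIV (deriv H))
     \<and> (\<exists>\<epsilon>>0. \<exists>K>0. \<forall>x. \<epsilon> < deriv H x \<and> deriv H x < K)"


section \<open>The reduced game\<close>

text \<open>A state \<open>(u\<^sub>1, \<dots>, u\<^sub>n)\<close> is the list \<open>\<omega>\<close> with \<open>u\<^sub>q = \<omega> ! (q - 1)\<close>, so the history
  \<open>(u\<^sub>1, \<dots>, u\<^sub>q\<^sub>-\<^sub>1)\<close> is \<open>take (q - 1) \<omega>\<close>.\<close>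

definition states :: "nat \<Rightarrow> real list set" where
  "states n = {\<omega>. length \<omega> = n \<and> set \<omega> \<subseteq> {-1, 1}}"

definition S_sum :: "nat \<Rightarrow> real list \<Rightarrow> real" where
  "S_sum n \<omega> = (\<Sum>q=1..n. \<omega> ! (q - 1)) / sqrt (real n)"

definition strategies1 :: "nat \<Rightarrow> real measure \<Rightarrow> (real list \<times> real) measure set" where
  "strategies1 n \<mu> = {Q. prob_space Q
     \<and> sets Q = sets (count_space (states n) \<Otimes>\<^sub>M borel)
     \<and> distr Q borel snd = \<mu>}"

definition payoff_of_prices :: "nat \<Rightarrow> (nat \<Rightarrow> real list \<Rightarrow> real) \<Rightarrow> real list \<Rightarrow> real" where
  "payoff_of_prices n p =
     (\<lambda>\<omega>\<in>states n. (\<Sum>q=1..n. \<omega> ! (q - 1) * p q (take (q - 1) \<omega>)) / sqrt (real n))"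

definition strategies2 :: "nat \<Rightarrow> (real list \<Rightarrow> real) set" where
  "strategies2 n = range (payoff_of_prices n)"

definition g1 :: "nat \<Rightarrow> (real list \<times> real) measure \<Rightarrow> (real list \<Rightarrow> real) \<Rightarrow> real" where
  "g1 n Q X = (\<integral>(\<omega>, l). l * S_sum n \<omega> - X \<omega> \<partial>Q)"

definition g2 ::
  "nat \<Rightarrow> (real \<Rightarrow> real) \<Rightarrow> (real list \<times> real) measure \<Rightarrow> (real list \<Rightarrow> real) \<Rightarrow> real" where
  "g2 n H Q X = (\<integral>(\<omega>, l). H (l * S_sum n \<omega> - X \<omega>) \<partial>Q)"

definition nash_equilibrium ::
  "nat \<Rightarrow> real measure \<Rightarrow> (real \<Rightarrow> real) \<Rightarrow> (real list \<times> real) measure \<Rightarrow>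
     (real list \<Rightarrow> real) \<Rightarrow> bool" where
  "nash_equilibrium n \<mu> H Q X \<longleftrightarrow>
     Q \<in> strategies1 n \<mu> \<and> X \<in> strategies2 n
     \<and> (\<forall>Q'\<in>strategies1 n \<mu>. g1 n Q' X \<le> g1 n Q X)
     \<and> (\<forall>X'\<in>strategies2 n. g2 n H Q X \<le> g2 n H Q X')"

text \<open>For \<open>t < 1/n\<close> the index \<open>\<lfloor>nt\<rfloor> = 0\<close> is replaced by \<open>1\<close>.\<close>

definition price_path ::
  "nat \<Rightarrow> (nat \<Rightarrow> real list \<Rightarrow> real) \<Rightarrow> real \<Rightarrow> real list \<Rightarrow> real" where
  "price_path n p t \<omega> = (let q = max 1 (nat \<lfloor>real n * t\<rfloor>) in p q (take (q - 1) \<omega>))"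


section \<open>The operator T\<close>

definition right_inverse :: "(real \<Rightarrow> real) \<Rightarrow> real \<Rightarrow> real" where
  "right_inverse F y = Inf {x. F x > y}"

text \<open>At \<open>y = 1\<close> the set \<open>{x. F x > y}\<close> is empty; for \<open>F\<^sub>\<mu>\<close> the value there is fixed to be \<open>1\<close>.
  The values of \<open>right_inverse (cdf \<nu>)\<close> at \<open>0\<close> and \<open>1\<close>, which may stand for an infinite infimum,
  enter \<open>phi\<close> only on a \<open>\<mu>\<close>-null set.\<close>

definition quantile_mu :: "real measure \<Rightarrow> real \<Rightarrow> real" where
  "quantile_mu \<mu> y = (if y = 1 then 1 else right_inverse (cdf \<mu>) y)"

definition phi :: "real measure \<Rightarrow> real measure \<Rightarrow> real \<Rightarrow> real" where
  "phi \<mu> \<nu> l = right_inverse (cdf \<nu>) (cdf \<mu> l)"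

definition gam :: "real measure \<Rightarrow> real measure \<Rightarrow> real \<Rightarrow> real" where
  "gam \<mu> \<nu> s = quantile_mu \<mu> (cdf \<nu> s)"

definition Gam :: "real measure \<Rightarrow> real measure \<Rightarrow> real \<Rightarrow> real" where
  "Gam \<mu> \<nu> s = (LBINT t=ereal 0..ereal s. gam \<mu> \<nu> t)"

definition Pi_bar :: "real measure \<Rightarrow> real measure \<Rightarrow> (real \<times> real) measure" where
  "Pi_bar \<mu> \<nu> = distr \<mu> (borel \<Otimes>\<^sub>M borel) (\<lambda>l. (l, phi \<mu> \<nu> l))"

definition Psi :: "real measure \<Rightarrow> real measure \<Rightarrow> real measure \<Rightarrow> real \<Rightarrow> real" where
  "Psi \<mu> \<nu> \<Lambda> s = Gam \<mu> \<nu> s - (\<integral>x. Gam \<mu> \<nu> x \<partial>\<Lambda>)"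

definition cond_exp_on ::
  "'a measure \<Rightarrow> ('a \<Rightarrow> real) \<Rightarrow> ('a \<Rightarrow> real) \<Rightarrow> 'a \<Rightarrow> real" where
  "cond_exp_on M S W = real_cond_exp M (vimage_algebra (space M) S borel) W"

text \<open>\<open>Y_fun\<close> is a Borel version of the conditional expectation as a function of \<open>S\<close>. It is unique
  up to \<open>\<nu>\<close>-null sets, so \<open>T_op\<close> does not depend on the version.\<close>

definition Y_fun ::
  "real measure \<Rightarrow> (real \<Rightarrow> real) \<Rightarrow> real measure \<Rightarrow> real measure \<Rightarrow> real \<Rightarrow> real" where
  "Y_fun \<mu> H \<Lambda> \<nu> =
     (SOME Y. Y \<in> borel_measurable borel \<and>
        (AE z in Pi_bar \<mu> \<nu>.
           Y (snd z) = cond_exp_on (Pi_bar \<mu> \<nu>) snd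
                         (\<lambda>(l, s). deriv H (l * s - Psi \<mu> \<nu> \<Lambda> s)) z))"

definition T_op ::
  "real measure \<Rightarrow> (real \<Rightarrow> real) \<Rightarrow> real measure \<Rightarrow> real measure \<Rightarrow> real measure" where
  "T_op \<mu> H \<Lambda> \<nu> =
     (let Y = Y_fun \<mu> H \<Lambda> \<nu>; \<alpha> = 1 / (\<integral>s. Y s \<partial>\<nu>)
      in density \<nu> (\<lambda>s. ennreal (\<alpha> * Y s)))"

definition std_normal :: "real measure" where
  "std_normal = density lborel (\<lambda>x. ennreal (std_normal_density x))"


section \<open>Brownian motion, CMMV, convergence of finite-dimensional distributions\<close>

definition brownian_motion :: "'w measure \<Rightarrow> (real \<Rightarrow> 'w \<Rightarrow> real) \<Rightarrow> bool" where
  "brownian_motion M B \<longleftrightarrow> prob_space M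
     \<and> (\<forall>t\<ge>0. B t \<in> borel_measurable M)
     \<and> (AE \<omega> in M. B 0 \<omega> = 0)
     \<and> (AE \<omega> in M. continuous_on {0..} (\<lambda>t. B t \<omega>))
     \<and> (\<forall>s t. 0 \<le> s \<longrightarrow> s < t \<longrightarrow>
          distributed M lborel (\<lambda>\<omega>. B t \<omega> - B s \<omega>)
            (\<lambda>x. ennreal (normal_density 0 (sqrt (t - s)) x)))
     \<and> (\<forall>\<tau>. mono \<tau> \<longrightarrow> 0 \<le> \<tau> 0 \<longrightarrow>
          (\<forall>k::nat. prob_space.indep_vars M (\<lambda>_. borel)
             (\<lambda>i \<omega>. B (\<tau> (Suc i)) \<omega> - B (\<tau> i) \<omega>) {..<k}))"

definition natural_filtration ::
  "'w measure \<Rightarrow> (real \<Rightarrow> 'w \<Rightarrow> real) \<Rightarrow> real \<Rightarrow> 'w measure" where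
  "natural_filtration M B t =
     sigma (space M) (\<Union>r\<in>{0..t}. sets (vimage_algebra (space M) (B r) borel))"

definition martingale_on ::
  "real set \<Rightarrow> 'w measure \<Rightarrow> (real \<Rightarrow> 'w measure) \<Rightarrow> (real \<Rightarrow> 'w \<Rightarrow> real) \<Rightarrow> bool" where
  "martingale_on T M F Z \<longleftrightarrow>
     (\<forall>t\<in>T. Z t \<in> borel_measurable (F t) \<and> integrable M (Z t))
     \<and> (\<forall>s\<in>T. \<forall>t\<in>T. s \<le> t \<longrightarrow> (AE \<omega> in M. real_cond_exp M (F s) (Z t) \<omega> = Z s \<omega>))"

text \<open>A process built from conditional expectations is determined only up to modification, hence
  the almost sure identity at each time.\<close>

definition cmmv :: "'w measure \<Rightarrow> (real \<Rightarrow> 'w \<Rightarrow> real) \<Rightarrow> bool" where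
  "cmmv M Z \<longleftrightarrow> (\<exists>B f. brownian_motion M B
     \<and> (\<forall>t\<in>{0..1}. mono (\<lambda>x::real. f x t))
     \<and> martingale_on {0..1} M (natural_filtration M B) (\<lambda>t \<omega>. f (B t \<omega>) t)
     \<and> (\<forall>t\<in>{0..1}. AE \<omega> in M. Z t \<omega> = f (B t \<omega>) t))"

text \<open>Convergence in law of \<open>(Z\<^sup>n\<^sub>t)\<^sub>t\<^sub>\<in>\<^sub>J\<close>, tested on bounded continuous functions on \<open>\<real>\<^sup>J\<close>.\<close>

definition converges_fdd ::
  "real set \<Rightarrow> (nat \<Rightarrow> 'a measure) \<Rightarrow> (nat \<Rightarrow> real \<Rightarrow> 'a \<Rightarrow> real) \<Rightarrow>
     'w measure \<Rightarrow> (real \<Rightarrow> 'w \<Rightarrow> real) \<Rightarrow> bool" where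
  "converges_fdd T P Zn M Z \<longleftrightarrow>
     (\<forall>J \<theta>. finite J \<longrightarrow> J \<subseteq> T \<longrightarrow>
        continuous_map (product_topology (\<lambda>_. euclideanreal) J) euclideanreal \<theta> \<longrightarrow>
        bounded (\<theta> ` (J \<rightarrow>\<^sub>E UNIV)) \<longrightarrow>
        (\<lambda>n. \<integral>\<omega>. \<theta> (\<lambda>t\<in>J. Zn n t \<omega>) \<partial>P n) \<longlonglongrightarrow> (\<integral>\<omega>. \<theta> (\<lambda>t\<in>J. Z t \<omega>) \<partial>M))"

definition limit_process ::
  "real measure \<Rightarrow> real measure \<Rightarrow> 'w measure \<Rightarrow> (real \<Rightarrow> 'w \<Rightarrow> real) \<Rightarrow> real \<Rightarrow> 'w \<Rightarrow> real" where
  "limit_process \<mu> \<nu> M B t =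
     cond_exp_on M (B t) (\<lambda>\<omega>. deriv (Psi \<mu> \<nu> std_normal) (B 1 \<omega>))"

end

theory Submission
  imports Defs
begin

text \<open> The game is secretly zero-sum. Against \<open>X\<close>, player 1 concentrates on
  pairs where \<open>L S\<^sub>n - X\<close> equals the conjugate \<open>X\<^sup>* L = max (L
  S\<^sub>n - X)\<close>; as \<open>H\<close> is increasing, the same strategy also maximises the
  expectation of \<open>H (L S\<^sub>n - X)\<close>, which player 2 minimises. So an equilibrium
  \<open>X\<close> minimises the convex functional \<open>X \<mapsto> E\<^sub>\<mu>[H (X\<^sup>*
  L)]\<close> over functions with mean zero under \<open>\<lambda>\<^sub>n\<close> (lemma
  \<open>value_le\<close>), and all functions with mean zero are available to player 2
  (\<open>mean_zero_is_strategy\<close>). The equation \<open>T(\<nu>) = N(0,1)\<close> is the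
  first-order condition for the same minimisation with \<open>S\<^sub>n\<close> replaced by a
  standard normal variable, and \<open>\<psi> = \<Psi>\<^sub>\<nu>\<close> is its solution.

  In equilibrium every state has positive probability (\<open>full_support\<close>), hence is a
  best reply for some type \<open>l \<in> [0,1]\<close>; therefore \<open>X\<^sub>n\<close> is a
  convex function \<open>xh\<^sub>n\<close> of \<open>S\<^sub>n\<close> with slopes in
  \<open>[0,1]\<close> (\<open>xh_S\<close>).

  The Skorohod representation of the central limit theorem puts \<open>W\<^sub>n\<close>,
  distributed like \<open>S\<^sub>n\<close>, and its normal limit \<open>W\<close> on one space
  with \<open>E|W\<^sub>n - W| \<longrightarrow> 0\<close>. All potentials are 1-Lipschitz, so
  trying \<open>\<psi>\<close> in the finite game and \<open>xh\<^sub>n\<close> in the limiting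
  one costs at most a multiple of \<open>E|W\<^sub>n - W|\<close> in expected \<open>H\<close>. By
  the first-order condition this excess cost is the mean of a Bregman distance of \<open>H\<close>
  (\<open>breg_integral_le\<close>), and strict convexity turns its vanishing into
  \<open>xh\<^sub>n \<longrightarrow> \<psi>\<close> pointwise (\<open>xh_tendsto\<close>). The
  argument is a quantitative form of uniqueness of the minimiser, so no subsequences are
  extracted. By convexity, difference quotients of \<open>xh\<^sub>n\<close> converge to
  \<open>\<gamma> = \<psi>'\<close> (\<open>slope_tendsto\<close>).

  A price is the expectation, over the tosses still to come, of such a difference quotient
  (\<open>price_eq_kernel\<close>). It is therefore a function of the current position of the
  walk, and this function converges to \<open>G\<^sub>t x = E[\<gamma> (x + \<surd>(1-t)
  N)]\<close> (\<open>kernel_tendsto\<close>). Independence of the increments of the walk carries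
  the coupling over to finitely many times (\<open>avg_blocks\<close>,
  \<open>fdd_convergence\<close>). Finally \<open>Z\<^sub>t = G\<^sub>t (B\<^sub>t)\<close> almost
  surely by the Markov property of \<open>B\<close> (\<open>cond_exp_given_B\<close>), and
  \<open>G\<^sub>t\<close> is increasing because \<open>\<gamma>\<close> is, which makes
  \<open>Z\<close> a CMMV. \<close>

section \<open>Uniform averages and martingale representation\<close>

definition avg :: "nat \<Rightarrow> (real list \<Rightarrow> real) \<Rightarrow> real" where
  "avg n F = (\<Sum>\<omega>\<in>states n. F \<omega>) / 2 ^ n"

lemma states_0: "states 0 = {[]}"
  by (auto simp: states_def)

lemma states_append: "states (a + b) = (\<lambda>(\<alpha>, \<beta>). \<alpha> @ \<beta>) ` (states a \<times> states b)"
proof (intro equalityI subsetI)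
  fix \<omega> assume w: "\<omega> \<in> states (a + b)"
  then have "\<omega> = (\<lambda>(\<alpha>, \<beta>). \<alpha> @ \<beta>) (take a \<omega>, drop a \<omega>)" "take a \<omega> \<in> states a" "drop a \<omega> \<in> states b"
    using set_take_subset[of a \<omega>] set_drop_subset[of a \<omega>] by (auto simp: states_def)
  then show "\<omega> \<in> (\<lambda>(\<alpha>, \<beta>). \<alpha> @ \<beta>) ` (states a \<times> states b)" by blast
qed (auto simp: states_def)

lemma states_1: "states (Suc 0) = {[1], [-1]}"
  by (auto simp: states_def length_Suc_conv)

lemma finite_states: "finite (states n)" and card_states: "card (states n) = 2 ^ n"
proof -
  have eq: "states n = {xs. set xs \<subseteq> {-1, 1} \<and> length xs = n}" by (auto simp: states_def)
  show "finite (states n)" "card (states n) = 2 ^ n"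
    unfolding eq by (simp_all add: finite_lists_length_eq card_lists_length_eq numeral_2_eq_2)
qed

lemma avg_append: "avg (a + b) F = avg a (\<lambda>\<alpha>. avg b (\<lambda>\<beta>. F (\<alpha> @ \<beta>)))"
proof -
  have inj: "inj_on (\<lambda>(\<alpha>, \<beta>). \<alpha> @ \<beta>) (states a \<times> states b)"
    by (auto simp: inj_on_def states_def)
  have "(\<Sum>\<omega>\<in>states (a + b). F \<omega>) = (\<Sum>\<alpha>\<in>states a. \<Sum>\<beta>\<in>states b. F (\<alpha> @ \<beta>))"
    unfolding states_append sum.reindex[OF inj]
    by (simp add: sum.cartesian_product case_prod_unfold)
  then show ?thesis
    by (simp add: avg_def power_add sum_divide_distrib[symmetric] field_simps)
qed

lemma avg_Suc_left: "avg (Suc n) F = (avg n (\<lambda>\<beta>. F (1 # \<beta>)) + avg n (\<lambda>\<beta>. F ((-1) # \<beta>))) / 2"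
  using avg_append[of "Suc 0" n F] by (simp add: avg_def[of "Suc 0"] states_1)

lemma avg_Suc_right: "avg (Suc n) F = avg n (\<lambda>\<alpha>. (F (\<alpha> @ [1]) + F (\<alpha> @ [-1])) / 2)"
  using avg_append[of n "Suc 0" F] by (simp add: avg_def[of "Suc 0"] states_1)

lemma avg_0: "avg 0 F = F []"
  by (simp add: avg_def states_0)

lemma avg_cong: "(\<And>\<omega>. \<omega> \<in> states n \<Longrightarrow> F \<omega> = G \<omega>) \<Longrightarrow> avg n F = avg n G"
  by (simp add: avg_def)

lemma avg_const [simp]: "avg n (\<lambda>_. c) = c"
  by (simp add: avg_def card_states)

lemma avg_diff: "avg n (\<lambda>\<omega>. F \<omega> - G \<omega>) = avg n F - avg n G"
  by (simp add: avg_def sum_subtractf diff_divide_distrib)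

lemma avg_cmult: "avg n (\<lambda>\<omega>. c * F \<omega>) = c * avg n F"
  by (simp add: avg_def sum_distrib_left)

lemma avg_divide: "avg n (\<lambda>\<omega>. F \<omega> / c) = avg n F / c"
  by (simp add: avg_def sum_divide_distrib[symmetric] mult.commute)

lemma integral_uniform_states: "(\<integral>\<omega>. F \<omega> \<partial>uniform_count_measure (states n)) = avg n F"
  by (simp add: integral_uniform_count_measure[OF finite_states] card_states avg_def)

text \<open>The numerator of \<open>payoff_of_prices\<close>, but defined on histories of every
  length: as a process in the number of tosses it is the martingale transform of the walk by the
  prices.\<close>

definition gain :: "(nat \<Rightarrow> real list \<Rightarrow> real) \<Rightarrow> real list \<Rightarrow> real" where
  "gain p \<omega> = (\<Sum>q=1..length \<omega>. \<omega> ! (q - 1) * p q (take (q - 1) \<omega>))"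

lemma gain_Nil [simp]: "gain p [] = 0"
  by (simp add: gain_def)

lemma gain_snoc: "gain p (\<omega> @ [u]) = gain p \<omega> + u * p (Suc (length \<omega>)) \<omega>"
proof -
  have "(\<Sum>q=1..length \<omega>. (\<omega> @ [u]) ! (q - 1) * p q (take (q - 1) (\<omega> @ [u]))) = gain p \<omega>"
    unfolding gain_def by (intro sum.cong refl) (auto simp: nth_append)
  then show ?thesis
    by (simp add: gain_def nth_append)
qed

lemma states_snoc: "\<omega> \<in> states (Suc n) \<Longrightarrow> \<exists>\<alpha> u. \<omega> = \<alpha> @ [u] \<and> \<alpha> \<in> states n \<and> u \<in> {-1, 1}"
  by (cases \<omega> rule: rev_cases) (auto simp: states_def)

lemma length_states: "\<omega> \<in> states n \<Longrightarrow> length \<omega> = n"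
  by (simp add: states_def)

text \<open>The martingale property: \<open>p q\<close> is fixed by the history, so the toss it
  multiplies averages out.\<close>

lemma avg_gain_append: "avg b (\<lambda>\<beta>. gain p (\<alpha> @ \<beta>)) = gain p \<alpha>"
proof (induction b)
  case (Suc b)
  have "avg (Suc b) (\<lambda>\<beta>. gain p (\<alpha> @ \<beta>)) = avg b (\<lambda>\<beta>. gain p (\<alpha> @ \<beta>))"
    unfolding avg_Suc_right using gain_snoc[of p "\<alpha> @ _"] by (intro avg_cong) simp
  then show ?case using Suc by simp
qed (simp add: avg_0)

lemma payoff_of_prices_eq: "\<omega> \<in> states n \<Longrightarrow> payoff_of_prices n p \<omega> = gain p \<omega> / sqrt (real n)"
  by (simp add: payoff_of_prices_def gain_def length_states)

lemma avg_payoff: "avg n (payoff_of_prices n p) = 0"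
proof -
  have "avg n (payoff_of_prices n p) = avg n (\<lambda>\<omega>. gain p \<omega> / sqrt (real n))"
    by (intro avg_cong) (simp add: payoff_of_prices_eq)
  then show ?thesis
    using avg_gain_append[of n p "[]"] by (simp add: avg_divide)
qed

text \<open>Conditioning on both values of the next toss and subtracting isolates the price. In
  particular the prices are determined by the payoff function.\<close>

lemma price_eq_difference:
  assumes "h \<in> states a" "n = Suc (a + b)"
  shows "p (Suc a) h = sqrt (real n) / 2 *
    (avg b (\<lambda>\<beta>. payoff_of_prices n p (h @ 1 # \<beta>)) - avg b (\<lambda>\<beta>. payoff_of_prices n p (h @ (-1) # \<beta>)))"
proof -
  have "avg b (\<lambda>\<beta>. payoff_of_prices n p (h @ u # \<beta>)) = (gain p h + u * p (Suc a) h) / sqrt (real n)"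
    if "u \<in> {-1, 1}" for u
  proof -
    have "avg b (\<lambda>\<beta>. payoff_of_prices n p (h @ u # \<beta>)) = avg b (\<lambda>\<beta>. gain p ((h @ [u]) @ \<beta>) / sqrt (real n))"
    proof (intro avg_cong)
      fix \<beta> assume "\<beta> \<in> states b"
      then have "h @ u # \<beta> \<in> states n" using assms that by (auto simp: states_def)
      then show "payoff_of_prices n p (h @ u # \<beta>) = gain p ((h @ [u]) @ \<beta>) / sqrt (real n)"
        by (simp add: payoff_of_prices_eq)
    qed
    then show ?thesis using length_states[OF assms(1)]
      by (simp only: avg_divide avg_gain_append gain_snoc)
  qed
  from this[of 1] this[of "-1"] show ?thesis using assms(2)
    by (simp add: field_simps)
qed

text \<open>On the binary tree every martingale is a transform of the walk: the value at a node is
  the mean of the two children, so the step taken is the toss times half the difference of the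
  children.\<close>

lemma mean_zero_is_strategy:
  assumes "n \<ge> 1" "avg n X = 0"
  obtains p where "\<And>\<omega>. \<omega> \<in> states n \<Longrightarrow> payoff_of_prices n p \<omega> = X \<omega>"
proof -
  define E where "E \<alpha> = avg (n - length \<alpha>) (\<lambda>\<beta>. X (\<alpha> @ \<beta>))" for \<alpha>
  define p where "p q h = sqrt (real n) / 2 * (E (h @ [1]) - E (h @ [-1]))" for q :: nat and h
  have step: "E \<alpha> = (E (\<alpha> @ [1]) + E (\<alpha> @ [-1])) / 2" if "length \<alpha> < n" for \<alpha>
    using that avg_Suc_left[of "n - Suc (length \<alpha>)" "\<lambda>\<beta>. X (\<alpha> @ \<beta>)"] by (simp add: E_def Suc_diff_Suc)
  have g: "gain p \<alpha> = sqrt (real n) * (E \<alpha> - E [])" if "\<alpha> \<in> states a" "a \<le> n" for a \<alpha>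
    using that
  proof (induction a arbitrary: \<alpha>)
    case 0
    then show ?case by (simp add: states_0)
  next
    case (Suc a)
    obtain \<beta> u where b: "\<alpha> = \<beta> @ [u]" "\<beta> \<in> states a" "u \<in> {-1, 1}" using states_snoc[OF Suc.prems(1)] by blast
    have "E \<beta> = (E (\<beta> @ [1]) + E (\<beta> @ [-1])) / 2" using step[of \<beta>] Suc.prems(2) length_states[OF b(2)] by simp
    then have "u * p (Suc a) \<beta> = sqrt (real n) * (E (\<beta> @ [u]) - E \<beta>)"
      using b(3) by (auto simp: p_def)
    then show ?case using Suc.IH[OF b(2)] Suc.prems(2) length_states[OF b(2)]
      by (simp add: b(1) gain_snoc algebra_simps)
  qed
  have "payoff_of_prices n p \<omega> = X \<omega>" if "\<omega> \<in> states n" for \<omega>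
  proof -
    have "E [] = 0" using assms(2) by (simp add: E_def)
    moreover have "E \<omega> = X \<omega>" using length_states[OF that] by (simp add: E_def avg_0)
    ultimately show ?thesis using g[OF that] assms(1) by (simp add: payoff_of_prices_eq[OF that])
  qed
  then show ?thesis using that by blast
qed

lemma S_sum_eq: "\<omega> \<in> states n \<Longrightarrow> S_sum n \<omega> = sum_list \<omega> / sqrt (real n)"
proof -
  assume w: "\<omega> \<in> states n"
  have "(\<Sum>q=1..n. \<omega> ! (q - 1)) = (\<Sum>i<n. \<omega> ! i)"
    by (rule sum.reindex_bij_witness[of _ Suc "\<lambda>q. q - 1"]) auto
  also have "\<dots> = sum_list \<omega>"
    using length_states[OF w] by (simp add: sum_list_sum_nth atLeast0LessThan)
  finally show ?thesis by (simp add: S_sum_def)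
qed

section \<open>Coupling the random walk with its normal limit\<close>

lemma indep_vars_PiM_coords:
  assumes "\<And>i. i \<in> I \<Longrightarrow> prob_space (N i)"
  shows "prob_space.indep_vars (PiM I N) N (\<lambda>i x. x i) I"
proof (cases "I = {}")
  case True
  interpret prob_space "PiM {} N" by (rule prob_space_PiM) auto
  show ?thesis unfolding True by (auto simp: indep_vars_def indep_sets_def)
next
  case False
  interpret prob_space "PiM I N" by (rule prob_space_PiM[OF assms])
  have "distr (PiM I N) (PiM I N) (\<lambda>x. \<lambda>i\<in>I. x i) = distr (PiM I N) (PiM I N) (\<lambda>x. x)"
    by (intro distr_cong refl) (auto simp: space_PiM PiE_def extensional_def)
  also have "\<dots> = (\<Pi>\<^sub>M i\<in>I. distr (PiM I N) (N i) (\<lambda>x. x i))"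
    by (subst PiM_cong[OF refl distr_PiM_component[OF assms]]) auto
  finally show ?thesis
    by (subst indep_vars_iff_distr_eq_PiM'[OF False]) auto
qed

text \<open>An independent family is determined in law by its marginals. The increments of the
  walk and those of Brownian motion are both moved to one and the same product space by this
  lemma.\<close>

lemma integral_indep_vars_cong:
  fixes F :: "('i \<Rightarrow> real) \<Rightarrow> real"
  assumes P: "prob_space P" "prob_space P'"
    and ind: "prob_space.indep_vars P (\<lambda>_. borel) X I" "prob_space.indep_vars P' (\<lambda>_. borel) X' I"
    and eq: "\<And>i. i \<in> I \<Longrightarrow> distr P borel (X i) = distr P' borel (X' i)"
    and F: "F \<in> borel_measurable (\<Pi>\<^sub>M i\<in>I. borel)"
  shows "(\<integral>x. F (\<lambda>i\<in>I. X i x) \<partial>P) = (\<integral>x. F (\<lambda>i\<in>I. X' i x) \<partial>P')"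
proof (cases "I = {}")
  interpret P: prob_space P by fact
  interpret P': prob_space P' by fact
  case True
  then have e: "(\<lambda>i\<in>I. X i x) = (\<lambda>_. undefined)" "(\<lambda>i\<in>I. X' i y) = (\<lambda>_. undefined)" for x y
    by (auto simp: restrict_def fun_eq_iff)
  show ?thesis
    unfolding e lebesgue_integral_const P.prob_space P'.prob_space ..
next
  interpret P: prob_space P by fact
  interpret P': prob_space P' by fact
  case False
  have [measurable]: "i \<in> I \<Longrightarrow> X i \<in> borel_measurable P" "i \<in> I \<Longrightarrow> X' i \<in> borel_measurable P'" for i
    using ind by (auto simp: P.indep_vars_def P'.indep_vars_def)
  have "distr P (\<Pi>\<^sub>M i\<in>I. borel) (\<lambda>x. \<lambda>i\<in>I. X i x) = (\<Pi>\<^sub>M i\<in>I. distr P borel (X i))"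
    using ind(1) by (subst (asm) P.indep_vars_iff_distr_eq_PiM'[OF False]) auto
  also have "\<dots> = (\<Pi>\<^sub>M i\<in>I. distr P' borel (X' i))"
    by (intro PiM_cong eq refl)
  also have "\<dots> = distr P' (\<Pi>\<^sub>M i\<in>I. borel) (\<lambda>x. \<lambda>i\<in>I. X' i x)"
    using ind(2) by (subst (asm) P'.indep_vars_iff_distr_eq_PiM'[OF False]) auto
  finally have "integral\<^sup>L (distr P (\<Pi>\<^sub>M i\<in>I. borel) (\<lambda>x. \<lambda>i\<in>I. X i x)) F
    = integral\<^sup>L (distr P' (\<Pi>\<^sub>M i\<in>I. borel) (\<lambda>x. \<lambda>i\<in>I. X' i x)) F" by simp
  then show ?thesis
    using F by (simp add: integral_distr)
qed

text \<open>The measure lives on \<open>{-1, 1}\<close> itself, so that paths of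
  \<open>coins\<close> take values in \<open>{-1, 1}\<close> everywhere and not only almost
  everywhere.\<close>

definition coin :: "real measure" where
  "coin = uniform_count_measure {-1, 1}"

abbreviation coins :: "(nat \<Rightarrow> real) measure" where
  "coins \<equiv> \<Pi>\<^sub>M i\<in>UNIV. coin"

lemma sets_coin [measurable_cong]: "sets coin = sets (count_space {-1, 1})"
  by (simp add: coin_def sets_uniform_count_measure_count_space)

lemma space_coin [simp]: "space coin = {-1, 1}"
  by (simp add: coin_def space_uniform_count_measure)

lemma prob_space_coin: "prob_space coin"
  unfolding coin_def by (rule prob_space_uniform_count_measure) auto

interpretation coins: product_prob_space "\<lambda>_::nat. coin" UNIV
  by (intro product_prob_spaceI prob_space_coin)

lemma measurable_coin_borel [measurable]: "(\<lambda>x. x) \<in> borel_measurable coin"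
  using sets_coin by (simp cong: measurable_cong_sets)

lemma coord_measurable [measurable]: "(\<lambda>x. x i) \<in> borel_measurable coins"
  using measurable_compose[OF measurable_component_singleton[of i UNIV "\<lambda>_. coin"] measurable_coin_borel] by simp

lemma indep_coords: "coins.indep_vars (\<lambda>_. borel) (\<lambda>i x. x i) UNIV"
  using coins.indep_vars_compose2[OF indep_vars_PiM_coords[of UNIV "\<lambda>_. coin"], of "\<lambda>_ x. x" "\<lambda>_. borel"]
  by (simp add: prob_space_coin)

lemma integral_coin: "(\<integral>x. f x \<partial>coin) = (f 1 + f (-1)) / 2" for f :: "real \<Rightarrow> real"
  by (simp add: coin_def integral_uniform_count_measure)

lemma distr_coord: "distr coins borel (\<lambda>x. x i) = distr coin borel (\<lambda>x. x)"
proof -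
  have "distr coins borel (\<lambda>x. x i) = distr (distr coins coin (\<lambda>x. x i)) borel (\<lambda>x. x)"
    by (subst distr_distr) (auto simp: comp_def)
  then show ?thesis
    using distr_PiM_component[of UNIV "\<lambda>_. coin" i] by (simp add: prob_space_coin)
qed

lemma integral_coord: "(\<integral>x. f (x i) \<partial>coins) = (f 1 + f (-1)) / 2" for f :: "real \<Rightarrow> real"
proof -
  have "(\<integral>x. f (x i) \<partial>coins) = (\<integral>x. f x \<partial>distr coins coin (\<lambda>x. x i))"
    by (subst integral_distr) (auto simp: measurable_cong_sets[OF sets_coin refl])
  then show ?thesis
    using distr_PiM_component[of UNIV "\<lambda>_. coin" i] by (simp add: prob_space_coin integral_coin)
qed

lemma states_nth: "\<omega> \<in> states n \<Longrightarrow> i < n \<Longrightarrow> \<omega> ! i \<in> {-1, 1}"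
  by (metis (mono_tags, lifting) length_states mem_Collect_eq nth_mem states_def subsetD)

lemma cylinder_eq:
  assumes "\<omega> \<in> states n"
  shows "{x \<in> space coins. map x [0..<n] = \<omega>} = prod_emb UNIV (\<lambda>_. coin) {..<n} (Pi\<^sub>E {..<n} (\<lambda>i. {\<omega> ! i}))"
  using length_states[OF assms] by (auto simp: prod_emb_def space_PiM list_eq_iff_nth_eq PiE_iff)

lemma coins_prefix_prob:
  assumes "\<omega> \<in> states n"
  shows "measure coins {x \<in> space coins. map x [0..<n] = \<omega>} = 1 / 2 ^ n"
proof -
  have "measure coins {x \<in> space coins. map x [0..<n] = \<omega>} = (\<Prod>i<n. measure coin {\<omega> ! i})"
    unfolding cylinder_eq[OF assms]
    by (rule coins.measure_PiM_emb) (use states_nth[OF assms] in \<open>auto simp: coin_def\<close>)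
  also have "\<dots> = (\<Prod>i<n. 1 / 2)"
    using states_nth[OF assms] by (intro prod.cong) (auto simp: coin_def measure_uniform_count_measure)
  finally show ?thesis by (simp add: power_divide)
qed

lemma cylinder_sets:
  assumes "\<omega> \<in> states n"
  shows "{x \<in> space coins. map x [0..<n] = \<omega>} \<in> sets coins"
  unfolding cylinder_eq[OF assms]
  by (rule sets_PiM_I) (use states_nth[OF assms] in \<open>auto simp: coin_def\<close>)

text \<open>The central limit theorem needs one infinite sequence of tosses; its prefixes carry
  the uniform laws.\<close>

lemma integral_coins_prefix: "(\<integral>x. F (map x [0..<n]) \<partial>coins) = avg n F"
proof -
  have st: "map x [0..<n] \<in> states n" if "x \<in> space coins" for x
    using that by (auto simp: states_def space_PiM)
  define A where "A \<omega> = {x \<in> space coins. map x [0..<n] = \<omega>}" for \<omega>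
  have A: "A \<omega> \<in> sets coins" if "\<omega> \<in> states n" for \<omega>
    using cylinder_sets[OF that] by (simp add: A_def)
  have "(\<integral>x. F (map x [0..<n]) \<partial>coins) = (\<integral>x. (\<Sum>\<omega>\<in>states n. F \<omega> * indicator (A \<omega>) x) \<partial>coins)"
  proof (intro Bochner_Integration.integral_cong refl)
    fix x assume x: "x \<in> space coins"
    have "(\<Sum>\<omega>\<in>states n. F \<omega> * indicator (A \<omega>) x) = (\<Sum>\<omega>\<in>states n. if \<omega> = map x [0..<n] then F \<omega> else 0)"
      using x by (intro sum.cong refl) (auto simp: A_def)
    then show "F (map x [0..<n]) = (\<Sum>\<omega>\<in>states n. F \<omega> * indicator (A \<omega>) x)"
      using st[OF x] sum.delta[OF finite_states[of n], of "map x [0..<n]" F] by simp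
  qed
  also have "\<dots> = (\<Sum>\<omega>\<in>states n. F \<omega> * measure coins (A \<omega>))"
  proof (subst Bochner_Integration.integral_sum)
    fix \<omega> assume "\<omega> \<in> states n"
    then show "integrable coins (\<lambda>x. F \<omega> * indicator (A \<omega>) x)"
      using A by (intro integrable_mult_right integrable_real_indicator) (auto simp: coins.emeasure_eq_measure)
  next
    show "(\<Sum>\<omega>\<in>states n. \<integral>x. F \<omega> * indicator (A \<omega>) x \<partial>coins) = (\<Sum>\<omega>\<in>states n. F \<omega> * measure coins (A \<omega>))"
      using A sets.sets_into_space by (intro sum.cong refl) (auto simp: Int_absorb2)
  qed
  also have "\<dots> = avg n F"
    using coins_prefix_prob[of _ n] by (simp add: avg_def sum_divide_distrib A_def)
  finally show ?thesis .
qed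

lemma sum_coins_eq: "(\<Sum>i<n. x i) = sum_list (map x [0..<n])" for x :: "nat \<Rightarrow> real"
  by (simp add: interv_sum_list_conv_sum_set_nat atLeast0LessThan)

lemma distr_block:
  "distr coins borel (\<lambda>x. \<Sum>i\<in>{c..<c + m}. x i) = distr coins borel (\<lambda>x. \<Sum>i<m. x i)"
proof -
  have sh: "distr coins coins (\<lambda>x. \<lambda>i\<in>UNIV. x (c + i)) = coins"
    using distr_PiM_reindex[of UNIV "\<lambda>_. coin" "\<lambda>i. c + i" UNIV] by (simp add: prob_space_coin)
  have "distr coins borel (\<lambda>x. \<Sum>i<m. x i) = distr (distr coins coins (\<lambda>x. \<lambda>i\<in>UNIV. x (c + i))) borel (\<lambda>x. \<Sum>i<m. x i)"
    by (simp only: sh)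
  also have "\<dots> = distr coins borel (\<lambda>x. \<Sum>i<m. x (c + i))"
    by (subst distr_distr) (measurable, simp add: comp_def)
  also have "(\<lambda>x::nat\<Rightarrow>real. \<Sum>i<m. x (c + i)) = (\<lambda>x. \<Sum>i\<in>{c..<c + m}. x i)"
    by (intro ext sum.reindex_bij_witness[of _ "\<lambda>i. i - c" "\<lambda>i. c + i"]) auto
  finally show ?thesis ..
qed

lemma indep_blocks:
  assumes "mono c"
  shows "coins.indep_vars (\<lambda>_. borel) (\<lambda>j x. \<Sum>i\<in>{c j..<c (Suc j)}. x i) {..<k}"
proof -
  have dis: "disjoint_family_on (\<lambda>j. {c j..<c (Suc j)}) {..<k}"
    unfolding disjoint_family_on_def
  proof safe
    fix a b x assume "a \<noteq> b" "x \<in> {c a..<c (Suc a)}" "x \<in> {c b..<c (Suc b)}"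
    moreover have "a < b \<Longrightarrow> c (Suc a) \<le> c b" "b < a \<Longrightarrow> c (Suc b) \<le> c a"
      using monoD[OF assms] by auto
    ultimately show "x \<in> {}" by (cases "a < b") auto
  qed
  have "coins.indep_vars (\<lambda>_. borel) (\<lambda>j x. (\<lambda>f. \<Sum>i\<in>{c j..<c (Suc j)}. f i) (restrict (\<lambda>i. x i) {c j..<c (Suc j)})) {..<k}"
    by (intro coins.indep_vars_compose2[OF coins.indep_vars_restrict[OF indep_coords _ dis]]) auto
  then show ?thesis by simp
qed

text \<open>The variance of the walk, by induction on the last toss.\<close>

lemma avg_square_sum: "avg n (\<lambda>\<omega>. (sum_list \<omega>)\<^sup>2) = real n"
proof (induction n)
  case (Suc n)
  have "avg (Suc n) (\<lambda>\<omega>. (sum_list \<omega>)\<^sup>2) = avg n (\<lambda>\<omega>. 1 - (- (sum_list \<omega>)\<^sup>2))"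
    unfolding avg_Suc_right by (intro avg_cong) (simp add: power2_eq_square field_simps)
  also have "\<dots> = 1 - (-1) * avg n (\<lambda>\<omega>. (sum_list \<omega>)\<^sup>2)"
    unfolding avg_cmult[symmetric] avg_diff by simp
  finally show ?case using Suc by simp
qed (simp add: avg_0)

text \<open>The almost sure representation of the central limit theorem: pointwise convergence
  lets dominated convergence replace all arguments about weak convergence.\<close>

locale walk_coupling = prob_space \<Omega> for \<Omega> :: "real measure" +
  fixes W :: "nat \<Rightarrow> real \<Rightarrow> real" and Wlim :: "real \<Rightarrow> real"
  assumes W_meas [measurable]: "W m \<in> borel_measurable \<Omega>" and Wlim_meas [measurable]: "Wlim \<in> borel_measurable \<Omega>"
    and distr_W: "distr \<Omega> borel (W m) = distr coins borel (\<lambda>x. (\<Sum>i<m. x i) / sqrt (real m))"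
    and distr_Wlim: "distr \<Omega> borel Wlim = std_normal"
    and W_conv: "x \<in> space \<Omega> \<Longrightarrow> (\<lambda>m. W m x) \<longlonglongrightarrow> Wlim x"

lemma walk_coupling_exists: "\<exists>\<Omega> W Wlim. walk_coupling \<Omega> W Wlim"
proof -
  let ?D = "\<lambda>n. distr coins borel (\<lambda>x. (\<Sum>i<n. x i) / sqrt (real n))"
  have sq: "coins.expectation (\<lambda>x. (x i)\<^sup>2) = 1" "coins.expectation (\<lambda>x. x i) = 0" for i
    using integral_coord[of "\<lambda>x. x\<^sup>2" i] integral_coord[of "\<lambda>x. x" i] by auto
  have "weak_conv_m (\<lambda>n. distr coins borel (\<lambda>x. (\<Sum>i<n. x i) / sqrt (real n * 1\<^sup>2))) std_normal_distribution"
  proof (rule coins.central_limit_theorem_zero_mean[OF indep_coords])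
    fix n
    show "integrable coins (\<lambda>x. (x n)\<^sup>2)"
    proof (rule coins.integrable_const_bound[of _ 1])
      show "AE x in coins. norm ((x n)\<^sup>2) \<le> 1"
      proof (intro AE_I2)
        fix x assume "x \<in> space coins"
        then have "x n = -1 \<or> x n = 1" by (auto simp: space_PiM)
        then show "norm ((x n)\<^sup>2) \<le> 1" by auto
      qed
    qed measurable
    show "coins.variance (\<lambda>x. x n) = 1\<^sup>2" using sq by simp
  qed (use sq distr_coord in auto)
  then have wc: "weak_conv_m ?D std_normal"
    by (simp add: std_normal_def)
  have rd: "real_distribution (?D n)" "real_distribution std_normal" for n
    using real_dist_normal_dist by (auto simp: std_normal_def)
  from Skorohod[OF rd wc] obtain \<Omega> :: "real measure" and Y and Y' where
    "prob_space \<Omega>" "\<And>n. Y n \<in> measurable \<Omega> borel" "\<And>n. distr \<Omega> borel (Y n) = ?D n"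
    "Y' \<in> measurable \<Omega> lborel" "distr \<Omega> borel Y' = std_normal"
    "\<And>x. x \<in> space \<Omega> \<Longrightarrow> (\<lambda>n. Y n x) \<longlonglongrightarrow> Y' x"
    by blast
  then have "walk_coupling \<Omega> Y Y'"
    unfolding walk_coupling_def walk_coupling_axioms_def by simp
  then show ?thesis by blast
qed

context walk_coupling
begin

lemma integral_W: "(\<integral>x. f (W m x) \<partial>\<Omega>) = avg m (\<lambda>\<omega>. f (sum_list \<omega> / sqrt (real m)))"
  if [measurable]: "f \<in> borel_measurable borel" for f :: "real \<Rightarrow> real"
proof -
  have "(\<integral>x. f (W m x) \<partial>\<Omega>) = (\<integral>x. f x \<partial>distr \<Omega> borel (W m))"
    by (subst integral_distr) auto
  also have "\<dots> = (\<integral>x. f (sum_list (map x [0..<m]) / sqrt (real m)) \<partial>coins)"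
    unfolding distr_W by (subst integral_distr) (measurable, simp add: sum_coins_eq)
  finally show ?thesis
    by (simp only: integral_coins_prefix[of "\<lambda>\<omega>. f (sum_list \<omega> / sqrt (real m))"])
qed

lemma avg_suffix:
  assumes [measurable]: "f \<in> borel_measurable borel"
  shows "avg m (\<lambda>\<omega>. f (sum_list \<omega> / sqrt (real n))) = (\<integral>x. f (sqrt (real m / real n) * W m x) \<partial>\<Omega>)"
proof -
  have "(\<integral>x. f (sqrt (real m / real n) * W m x) \<partial>\<Omega>) =
    avg m (\<lambda>\<omega>. f (sqrt (real m / real n) * (sum_list \<omega> / sqrt (real m))))"
    by (rule integral_W) measurable
  also have "\<dots> = avg m (\<lambda>\<omega>. f (sum_list \<omega> / sqrt (real n)))"
    by (intro avg_cong) (cases "m = 0"; auto simp: real_sqrt_divide states_0)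
  finally show ?thesis ..
qed

lemma integral_Wlim: "(\<integral>x. f (Wlim x) \<partial>\<Omega>) = (\<integral>x. f x \<partial>std_normal)"
  if [measurable]: "f \<in> borel_measurable borel" for f :: "real \<Rightarrow> real"
proof -
  have "(\<integral>x. f x \<partial>distr \<Omega> borel Wlim) = (\<integral>x. f (Wlim x) \<partial>\<Omega>)"
    by (rule integral_distr) measurable
  then show ?thesis by (simp only: distr_Wlim)
qed

lemma integrable_W_AE: "AE x in \<Omega>. \<bar>W m x\<bar> \<le> sqrt (real m)"
proof -
  have "AE x in coins. \<bar>(\<Sum>i<m. x i) / sqrt (real m)\<bar> \<le> sqrt (real m)"
  proof (intro AE_I2)
    fix x assume "x \<in> space coins"
    then have "x i = 1 \<or> x i = -1" for i by (auto simp: space_PiM)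
    then have "\<bar>x i\<bar> \<le> 1" for i by (metis abs_1 abs_minus order_refl)
    then have "\<bar>\<Sum>i<m. x i\<bar> \<le> (\<Sum>i<m. 1)" by (intro order_trans[OF sum_abs] sum_mono)
    then show "\<bar>(\<Sum>i<m. x i) / sqrt (real m)\<bar> \<le> sqrt (real m)"
      by (cases "m = 0") (auto simp: abs_divide divide_le_eq)
  qed
  then have "AE x in distr coins borel (\<lambda>x. (\<Sum>i<m. x i) / sqrt (real m)). \<bar>x\<bar> \<le> sqrt (real m)"
    by (intro AE_distr_iff[THEN iffD2]) measurable
  then have "AE x in distr \<Omega> borel (W m). \<bar>x\<bar> \<le> sqrt (real m)"
    by (simp only: distr_W)
  then show ?thesis
    by (intro AE_distr_iff[THEN iffD1, of "W m" \<Omega> borel]) measurable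
qed

lemma square_integrable_W: "integrable \<Omega> (\<lambda>x. (W m x)\<^sup>2)" "(\<integral>x. (W m x)\<^sup>2 \<partial>\<Omega>) \<le> 1"
proof -
  show "integrable \<Omega> (\<lambda>x. (W m x)\<^sup>2)"
  proof (rule integrable_const_bound[of _ "real m"])
    show "AE x in \<Omega>. norm ((W m x)\<^sup>2) \<le> real m"
      using integrable_W_AE[of m]
    proof eventually_elim
      case (elim x)
      then have "sqrt ((W m x)\<^sup>2) \<le> sqrt (real m)" by simp
      then show ?case by (simp only: real_sqrt_le_iff real_norm_def abs_power2)
    qed
  qed measurable
  have "(\<integral>x. (W m x)\<^sup>2 \<partial>\<Omega>) = avg m (\<lambda>\<omega>. (sum_list \<omega>)\<^sup>2 / real m)"
    using integral_W[of "\<lambda>x. x\<^sup>2" m] by (simp add: power_divide)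
  then show "(\<integral>x. (W m x)\<^sup>2 \<partial>\<Omega>) \<le> 1"
    by (simp add: avg_divide avg_square_sum)
qed

lemma square_integrable_Wlim: "integrable \<Omega> (\<lambda>x. (Wlim x)\<^sup>2)" "(\<integral>x. (Wlim x)\<^sup>2 \<partial>\<Omega>) = 1"
proof -
  show "integrable \<Omega> (\<lambda>x. (Wlim x)\<^sup>2)"
    using std_normal_distribution_even_moments(2)[of 1] unfolding std_normal_def[symmetric] distr_Wlim[symmetric]
    by (subst (asm) integrable_distr_eq) auto
  show "(\<integral>x. (Wlim x)\<^sup>2 \<partial>\<Omega>) = 1"
    using std_normal_distribution_even_moments(1)[of 1] integral_Wlim[of "\<lambda>x. x\<^sup>2"] by (simp add: std_normal_def)
qed

lemma integrable_W: "integrable \<Omega> (W m)" and integrable_Wlim: "integrable \<Omega> Wlim"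
  using square_integrable_W square_integrable_Wlim by (auto intro: square_integrable_imp_integrable)

text \<open>Second moments are bounded, hence \<open>W m - Wlim\<close> is uniformly integrable: a
  nonnegative \<open>x\<close> satisfies \<open>x \<le> min x R + x\<^sup>2 / R\<close>. The
  truncated part vanishes by dominated convergence and the rest is at most \<open>4 /
  R\<close>.\<close>

lemma W_L1_conv: "(\<lambda>m. \<integral>x. \<bar>W m x - Wlim x\<bar> \<partial>\<Omega>) \<longlonglongrightarrow> 0"
proof (rule tendstoI)
  fix e :: real assume e: "0 < e"
  define R where "R = 8 / e"
  have R: "R > 0" using e by (simp add: R_def)
  define d where "d m x = \<bar>W m x - Wlim x\<bar>" for m x
  have [measurable]: "d m \<in> borel_measurable \<Omega>" for m by (simp add: d_def[abs_def])
  have imin: "integrable \<Omega> (\<lambda>x. min (d m x) R)" for m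
    by (rule integrable_const_bound[of _ R]) (use R in \<open>auto simp: d_def\<close>)
  have isum: "integrable \<Omega> (\<lambda>x. 2 * (W m x)\<^sup>2 + 2 * (Wlim x)\<^sup>2)" for m
    using square_integrable_W(1) square_integrable_Wlim(1) by auto
  have dsq: "(d m x)\<^sup>2 \<le> 2 * (W m x)\<^sup>2 + 2 * (Wlim x)\<^sup>2" for m x
    using sum_squares_ge_zero[of "W m x + Wlim x" 0] by (simp add: d_def power2_eq_square algebra_simps)
  have pt: "d m x \<le> min (d m x) R + (2 * (W m x)\<^sup>2 + 2 * (Wlim x)\<^sup>2) / R" for m x
  proof -
    have d0: "d m x \<ge> 0" by (simp add: d_def)
    have "d m x \<le> min (d m x) R + (d m x)\<^sup>2 / R"
    proof (cases "d m x \<le> R")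
      case False
      then have "d m x * R \<le> (d m x)\<^sup>2" using d0 by (simp add: power2_eq_square mult_left_mono)
      then have "d m x \<le> (d m x)\<^sup>2 / R" using R by (simp add: le_divide_eq)
      then show ?thesis using R d0 by (simp add: min_def)
    qed (use R in simp)
    also have "\<dots> \<le> min (d m x) R + (2 * (W m x)\<^sup>2 + 2 * (Wlim x)\<^sup>2) / R"
      using dsq[of m x] R by (intro add_left_mono divide_right_mono) auto
    finally show ?thesis .
  qed
  have "(\<lambda>m. \<integral>x. min (d m x) R \<partial>\<Omega>) \<longlonglongrightarrow> (\<integral>x. 0 \<partial>\<Omega>)"
  proof (rule integral_dominated_convergence[where w = "\<lambda>_. R"])
    show "AE x in \<Omega>. (\<lambda>m. min (d m x) R) \<longlonglongrightarrow> 0"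
    proof (intro AE_I2)
      fix x assume "x \<in> space \<Omega>"
      then have "(\<lambda>m. d m x) \<longlonglongrightarrow> 0"
        using W_conv[of x] unfolding d_def by (intro tendsto_rabs_zero LIM_zero)
      then have "(\<lambda>m. min (d m x) R) \<longlonglongrightarrow> min 0 R" by (intro tendsto_min) auto
      then show "(\<lambda>m. min (d m x) R) \<longlonglongrightarrow> 0" using R by simp
    qed
  qed (use R in \<open>auto simp: d_def\<close>)
  then have "eventually (\<lambda>m. (\<integral>x. min (d m x) R \<partial>\<Omega>) < e / 2) sequentially"
    using e by (intro order_tendstoD(2)[where y = 0]) auto
  then show "eventually (\<lambda>m. dist (\<integral>x. \<bar>W m x - Wlim x\<bar> \<partial>\<Omega>) 0 < e) sequentially"
  proof eventually_elim
    case (elim m)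
    have "(\<integral>x. d m x \<partial>\<Omega>) \<le> (\<integral>x. min (d m x) R + (2 * (W m x)\<^sup>2 + 2 * (Wlim x)\<^sup>2) / R \<partial>\<Omega>)"
      by (rule integral_mono) (use imin isum pt integrable_W integrable_Wlim in \<open>auto simp: d_def simp del: power2_eq_square\<close>)
    also have "\<dots> = (\<integral>x. min (d m x) R \<partial>\<Omega>) + (2 * (\<integral>x. (W m x)\<^sup>2 \<partial>\<Omega>) + 2 * (\<integral>x. (Wlim x)\<^sup>2 \<partial>\<Omega>)) / R"
      by (simp add: imin isum square_integrable_W(1) square_integrable_Wlim(1))
    also have "\<dots> < e / 2 + 4 / R"
      using elim square_integrable_W(2)[of m] square_integrable_Wlim(2) R
      by (intro add_less_le_mono divide_right_mono) auto
    finally have "(\<integral>x. d m x \<partial>\<Omega>) < e" using e by (simp add: R_def)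
    moreover have "0 \<le> (\<integral>x. d m x \<partial>\<Omega>)" by (simp add: d_def)
    ultimately show ?case by (simp add: d_def)
  qed
qed

text \<open>A block of \<open>m\<close> tosses divided by \<open>sqrt n\<close> has the law of
  \<open>sqrt (m / n) * W m\<close>, and disjoint blocks are independent, so the blocks are
  realised by independent copies of the single coupling space.\<close>

lemma avg_blocks:
  assumes c: "mono c" "c k \<le> n" and F: "F \<in> borel_measurable (\<Pi>\<^sub>M i\<in>{..<k}. borel)"
  shows "avg n (\<lambda>\<omega>. F (\<lambda>j\<in>{..<k}. (\<Sum>i\<in>{c j..<c (Suc j)}. \<omega> ! i) / sqrt (real n))) =
    (\<integral>x. F (\<lambda>j\<in>{..<k}. sqrt (real (c (Suc j) - c j) / real n) * W (c (Suc j) - c j) (x j)) \<partial>(\<Pi>\<^sub>M i\<in>{..<k}. \<Omega>))"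
proof -
  let ?m = "\<lambda>j. c (Suc j) - c j"
  have "avg n (\<lambda>\<omega>. F (\<lambda>j\<in>{..<k}. (\<Sum>i\<in>{c j..<c (Suc j)}. \<omega> ! i) / sqrt (real n)))
    = (\<integral>x. F (\<lambda>j\<in>{..<k}. (\<Sum>i\<in>{c j..<c (Suc j)}. map x [0..<n] ! i) / sqrt (real n)) \<partial>coins)"
    by (rule integral_coins_prefix[symmetric])
  also have "\<dots> = (\<integral>x. F (\<lambda>j\<in>{..<k}. (\<Sum>i\<in>{c j..<c (Suc j)}. x i) / sqrt (real n)) \<partial>coins)"
  proof (intro Bochner_Integration.integral_cong refl arg_cong[where f=F] restrict_ext)
    fix x :: "nat \<Rightarrow> real" and j assume "j \<in> {..<k}"
    then have "c (Suc j) \<le> n" using monoD[OF c(1), of "Suc j" k] c(2) by auto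
    then show "(\<Sum>i\<in>{c j..<c (Suc j)}. map x [0..<n] ! i) / sqrt (real n) = (\<Sum>i\<in>{c j..<c (Suc j)}. x i) / sqrt (real n)"
      by (intro arg_cong2[where f = "(/)"] sum.cong refl) auto
  qed
  also have "\<dots> = (\<integral>x. F (\<lambda>j\<in>{..<k}. sqrt (real (?m j) / real n) * W (?m j) (x j)) \<partial>(\<Pi>\<^sub>M i\<in>{..<k}. \<Omega>))"
  proof (rule integral_indep_vars_cong[OF coins.prob_space_axioms _ _ _ _ F])
    show "prob_space (\<Pi>\<^sub>M i\<in>{..<k}. \<Omega>)" by (intro prob_space_PiM prob_space_axioms)
    show "coins.indep_vars (\<lambda>_. borel) (\<lambda>j x. (\<Sum>i\<in>{c j..<c (Suc j)}. x i) / sqrt (real n)) {..<k}"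
      by (intro coins.indep_vars_compose2[OF indep_blocks[OF c(1)]]) auto
    show "prob_space.indep_vars (\<Pi>\<^sub>M i\<in>{..<k}. \<Omega>) (\<lambda>_. borel) (\<lambda>j x. sqrt (real (?m j) / real n) * W (?m j) (x j)) {..<k}"
      by (rule prob_space.indep_vars_compose2[OF prob_space_PiM indep_vars_PiM_coords]) (auto intro: prob_space_axioms)
    fix j assume j: "j \<in> {..<k}"
    have cj: "c (Suc j) = c j + ?m j" using monoD[OF c(1), of j "Suc j"] by simp
    have "distr (\<Pi>\<^sub>M i\<in>{..<k}. \<Omega>) borel (\<lambda>x. sqrt (real (?m j) / real n) * W (?m j) (x j))
      = distr (distr (distr (\<Pi>\<^sub>M i\<in>{..<k}. \<Omega>) \<Omega> (\<lambda>x. x j)) borel (W (?m j))) borel (\<lambda>y. sqrt (real (?m j) / real n) * y)"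
      using j by (simp add: distr_distr comp_def)
    also have "distr (\<Pi>\<^sub>M i\<in>{..<k}. \<Omega>) \<Omega> (\<lambda>x. x j) = \<Omega>"
      using j by (intro distr_PiM_component prob_space_axioms)
    also have "distr (distr \<Omega> borel (W (?m j))) borel (\<lambda>y. sqrt (real (?m j) / real n) * y)
      = distr coins borel (\<lambda>x. sqrt (real (?m j) / real n) * ((\<Sum>i<?m j. x i) / sqrt (real (?m j))))"
      unfolding distr_W by (subst distr_distr) (auto simp: comp_def)
    also have "\<dots> = distr coins borel (\<lambda>x. (\<Sum>i<?m j. x i) / sqrt (real n))"
      by (rule arg_cong[where f = "distr coins borel"], rule ext, cases "?m j = 0") (auto simp: real_sqrt_divide)
    also have "\<dots> = distr (distr coins borel (\<lambda>x. \<Sum>i\<in>{c j..<c j + ?m j}. x i)) borel (\<lambda>y. y / sqrt (real n))"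
      unfolding distr_block by (subst distr_distr) (auto simp: comp_def)
    also have "\<dots> = distr coins borel (\<lambda>x. (\<Sum>i\<in>{c j..<c (Suc j)}. x i) / sqrt (real n))"
      by (subst distr_distr) (auto simp: comp_def cj[symmetric])
    finally show "distr coins borel (\<lambda>x. (\<Sum>i\<in>{c j..<c (Suc j)}. x i) / sqrt (real n)) =
      distr (\<Pi>\<^sub>M i\<in>{..<k}. \<Omega>) borel (\<lambda>x. sqrt (real (?m j) / real n) * W (?m j) (x j))" ..
  qed
  finally show ?thesis .
qed

end

text \<open>As default rules these would be tried on every projection and every identity map
  below.\<close>

declare measurable_coin_borel [measurable del] coord_measurable [measurable del]

section \<open>Quantile maps and the limiting potential\<close>

lemma prob_std_normal: "prob_space std_normal"
  using real_dist_normal_dist by (simp add: std_normal_def real_distribution_def)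

lemma sets_std_normal [measurable_cong, simp]: "sets std_normal = sets borel"
  by (simp add: std_normal_def)

lemma space_std_normal [simp]: "space std_normal = UNIV"
  by (simp add: std_normal_def)

lemma std_normal_scale:
  assumes "0 < \<sigma>"
  shows "density lborel (\<lambda>x. ennreal (normal_density 0 \<sigma> x)) = distr std_normal borel (\<lambda>z. \<sigma> * z)"
proof -
  interpret prob_space std_normal by (rule prob_std_normal)
  have "distributed std_normal lborel (\<lambda>z. z) (\<lambda>x. ennreal (normal_density 0 1 x))"
    unfolding distributed_def
  proof (intro conjI)
    have "distr std_normal lborel (\<lambda>z. z) = distr std_normal std_normal (\<lambda>z. z)"
      by (rule distr_cong) simp_all
    then show "distr std_normal lborel (\<lambda>z. z) = density lborel (\<lambda>x. ennreal (normal_density 0 1 x))"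
      by (simp add: std_normal_def)
  qed auto
  from normal_density_affine[OF this, of \<sigma> 0] assms
  have "distr std_normal lborel (\<lambda>z. \<sigma> * z) = density lborel (\<lambda>x. ennreal (normal_density 0 \<sigma> x))"
    by (simp add: distributed_def)
  moreover have "distr std_normal lborel (\<lambda>z. \<sigma> * z) = distr std_normal borel (\<lambda>z. \<sigma> * z)"
    by (rule distr_cong) simp_all
  ultimately show ?thesis by simp
qed


locale prior =
  fixes \<mu> :: "real measure"
  assumes prior: "admissible_prior \<mu>"
begin

lemma prior_density:
  obtains f where "continuous_on {0..1} f" "\<And>x. x \<in> {0..1} \<Longrightarrow> 0 < f x"
    "\<mu> = density lborel (\<lambda>x. ennreal (f x * indicator {0..1} x))"
proof -
  from prior obtain f f' where f: "\<forall>x\<in>{0..1}. 0 < f x \<and> (f has_real_derivative f' x) (at x within {0..1})"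
    "\<mu> = density lborel (\<lambda>x. ennreal (f x * indicator {0..1} x))"
    unfolding admissible_prior_def by blast
  then have "continuous_on {0..1} f" by (intro DERIV_continuous_on) blast
  with f show ?thesis using that by blast
qed

sublocale prob_space \<mu> using prior by (simp add: admissible_prior_def)

lemma sets_mu [measurable_cong, simp]: "sets \<mu> = sets borel"
  using prior_density by (metis sets_density sets_lborel)

lemma space_mu [simp]: "space \<mu> = UNIV"
  using sets_eq_imp_space_eq[OF sets_mu] by simp

sublocale real_distribution \<mu>
  by unfold_locales simp_all

text \<open>Null sets of \<open>\<mu>\<close> are Lebesgue null sets, because its density is
  positive on \<open>[0,1]\<close>, and conversely. So \<open>\<mu>\<close> has no atoms and
  charges every subinterval, and its distribution function is a homeomorphism of
  \<open>[0,1]\<close> with inverse \<open>quantile_mu\<close>.\<close>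

lemma null_set_iff:
  assumes "A \<in> sets borel"
  shows "A \<in> null_sets \<mu> \<longleftrightarrow> A \<inter> {0..1} \<in> null_sets lborel"
proof -
  obtain f where f: "continuous_on {0..1} f" "\<And>x. x \<in> {0..1} \<Longrightarrow> 0 < f x"
    "\<mu> = density lborel (\<lambda>x. ennreal (f x * indicator {0..1} x))" using prior_density by blast
  have [measurable]: "(\<lambda>x. f x * indicator {0..1} x) \<in> borel_measurable lborel"
    using borel_measurable_continuous_on_indicator[OF _ f(1)] by (simp add: mult.commute)
  have "A \<in> null_sets \<mu> \<longleftrightarrow> (AE x in lborel. x \<in> A \<longrightarrow> ennreal (f x * indicator {0..1} x) = 0)"
    unfolding f(3) using assms by (subst null_sets_density_iff) auto
  also have "\<dots> \<longleftrightarrow> (AE x in lborel. x \<notin> A \<inter> {0..1})"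
    by (intro AE_cong) (use f(2) in \<open>force simp: indicator_def ennreal_eq_0_iff not_le\<close>)
  also have "\<dots> \<longleftrightarrow> A \<inter> {0..1} \<in> null_sets lborel"
    using assms by (subst AE_iff_null_sets) auto
  finally show ?thesis .
qed

lemma AE_unit: "AE l in \<mu>. 0 < l \<and> l < 1"
proof -
  have "- {0<..<1} \<inter> {0..1} = {0, 1::real}" by auto
  then have "- {0<..<1} \<in> null_sets \<mu>" by (simp add: null_set_iff finite_imp_null_set_lborel)
  then show ?thesis by (rule AE_I') auto
qed

lemma mu_singleton: "measure \<mu> {x} = 0"
proof -
  have "{x} \<inter> {0..1} \<in> null_sets lborel" by (simp add: finite_imp_null_set_lborel)
  then have "{x} \<in> null_sets \<mu>" by (subst null_set_iff) auto
  then show ?thesis by (rule measure_eq_0_null_sets)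
qed

lemma cdf_mu_0: "x \<le> 0 \<Longrightarrow> cdf \<mu> x = 0"
proof -
  assume "x \<le> 0"
  then have "finite ({..x} \<inter> {0..1})" by (auto intro: finite_subset[of _ "{0}"])
  then have "{..x} \<in> null_sets \<mu>" by (subst null_set_iff) (auto simp: finite_imp_null_set_lborel)
  then show ?thesis unfolding cdf_def by (rule measure_eq_0_null_sets)
qed

lemma cdf_mu_1: "1 \<le> x \<Longrightarrow> cdf \<mu> x = 1"
proof -
  assume "1 \<le> x"
  have "AE l in \<mu>. l \<in> {..x}" by (rule AE_mp[OF AE_unit], rule AE_I2) (use \<open>1 \<le> x\<close> in auto)
  then show ?thesis unfolding cdf_def by (subst prob_eq_1) auto
qed

lemma continuous_cdf_mu: "continuous_on A (cdf \<mu>)"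
  by (intro continuous_at_imp_continuous_on ballI) (simp add: isCont_cdf mu_singleton)

lemma cdf_mu_strict: "0 \<le> x \<Longrightarrow> x < y \<Longrightarrow> x < 1 \<Longrightarrow> cdf \<mu> x < cdf \<mu> y"
proof -
  assume xy: "0 \<le> x" "x < y" "x < 1"
  have "{x<..y} \<notin> null_sets \<mu>"
  proof
    assume "{x<..y} \<in> null_sets \<mu>"
    then have "{x<..y} \<inter> {0..1} \<in> null_sets lborel" by (simp add: null_set_iff)
    moreover have "{x<..<min y 1} \<subseteq> {x<..y} \<inter> {0..1}" using xy by auto
    ultimately have "{x<..<min y 1} \<in> null_sets lborel" using null_sets_subset[OF _ _ \<open>{x<..<min y 1} \<subseteq> _\<close>] by simp
    then show False using xy by (simp add: null_sets_def)
  qed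
  then have "measure \<mu> {x<..y} > 0"
    by (auto simp: null_sets_def emeasure_eq_measure zero_less_measure_iff)
  then show ?thesis using cdf_diff_eq[OF xy(2)] by simp
qed

abbreviation "q \<equiv> quantile_mu \<mu>"

lemma quantile_cdf: assumes "x \<in> {0..1}" shows "q (cdf \<mu> x) = x"
proof (cases "x = 1")
  case True
  then show ?thesis by (simp add: quantile_mu_def cdf_mu_1)
next
  case False
  then have x: "0 \<le> x" "x < 1" using assms by auto
  have "{x'. cdf \<mu> x' > cdf \<mu> x} = {x<..}"
    using cdf_mu_strict[OF x(1) _ x(2)] cdf_nondecreasing[of _ x] by (force simp: not_less[symmetric])
  moreover have "cdf \<mu> x < 1" using cdf_mu_strict[OF x x(2)] cdf_mu_1[of 1] by simp
  ultimately show ?thesis by (simp add: quantile_mu_def right_inverse_def)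
qed

lemma cdf_quantile: assumes "y \<in> {0..1}" shows "cdf \<mu> (q y) = y" and "q y \<in> {0..1}"
proof -
  obtain x where "x \<in> {0..1}" "cdf \<mu> x = y"
    using IVT'[of "cdf \<mu>" 0 y 1] assms cdf_mu_0[of 0] cdf_mu_1[of 1] continuous_cdf_mu by auto
  then show "cdf \<mu> (q y) = y" "q y \<in> {0..1}" using quantile_cdf by auto
qed

lemma quantile_mono: "y \<in> {0..1} \<Longrightarrow> z \<in> {0..1} \<Longrightarrow> y \<le> z \<Longrightarrow> q y \<le> q z"
proof (rule ccontr)
  assume yz: "y \<in> {0..1}" "z \<in> {0..1}" "y \<le> z" "\<not> q y \<le> q z"
  then have "cdf \<mu> (q z) < cdf \<mu> (q y)"
    using cdf_quantile(2)[of y] cdf_quantile(2)[of z] by (intro cdf_mu_strict) auto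
  then show False using yz by (simp add: cdf_quantile)
qed

lemma continuous_quantile: "continuous_on {0..1} q"
proof -
  have "cdf \<mu> ` {0..1} = {0..1}"
  proof
    show "cdf \<mu> ` {0..1} \<subseteq> {0..1}" using cdf_nonneg cdf_bounded_prob by auto
    show "{0..1} \<subseteq> cdf \<mu> ` {0..1}" using cdf_quantile by (metis image_eqI subsetI)
  qed
  moreover have "continuous_on (cdf \<mu> ` {0..1}) q"
    by (rule continuous_on_inv) (auto simp: continuous_cdf_mu quantile_cdf)
  ultimately show ?thesis by simp
qed

end

locale prior_pair = prior \<mu> + nu: real_distribution \<nu> for \<mu> \<nu> :: "real measure"
begin

abbreviation "\<gamma> \<equiv> gam \<mu> \<nu>"
abbreviation "\<phi> \<equiv> phi \<mu> \<nu>"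
abbreviation "\<psi> \<equiv> Psi \<mu> \<nu> std_normal"

lemma cdf_nu_unit: "cdf \<nu> s \<in> {0..1}"
  using nu.cdf_nonneg nu.cdf_bounded_prob by auto

lemma gam_unit: "\<gamma> s \<in> {0..1}" "0 \<le> \<gamma> s" "\<gamma> s \<le> 1"
  using cdf_quantile(2)[OF cdf_nu_unit] by (auto simp: gam_def)

lemma gam_mono: "mono \<gamma>"
  by (intro monoI) (auto simp: gam_def intro!: quantile_mono cdf_nu_unit nu.cdf_nondecreasing)

lemma gam_borel [measurable]: "\<gamma> \<in> borel_measurable borel"
  by (rule borel_measurable_mono[OF gam_mono])

lemma cdf_gam: "cdf \<mu> (\<gamma> s) = cdf \<nu> s"
  using cdf_quantile(1)[OF cdf_nu_unit] by (simp add: gam_def)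

text \<open>\<open>\<phi>\<close> and \<open>\<gamma>\<close> are inverse to each other. In the
  form of inequalities this holds for every \<open>\<nu>\<close>, even one with atoms and gaps,
  which matters because regularity of \<open>\<nu>\<close> comes out of the equation
  \<open>T(\<nu>) = N(0,1)\<close> only later.\<close>

lemma
  assumes l: "0 < l" "l < 1"
  shows phi_less_imp: "\<phi> l < s \<Longrightarrow> l \<le> \<gamma> s"
    and less_phi_imp: "s < \<phi> l \<Longrightarrow> \<gamma> s \<le> l"
    and phi_le_imp: "\<phi> l \<le> s \<Longrightarrow> l \<le> \<gamma> s"
proof -
  define y where "y = cdf \<mu> l"
  have y: "0 < y" "y < 1"
    using cdf_mu_strict[of 0 l] cdf_mu_0[of 0] cdf_mu_strict[of l 1] cdf_mu_1[of 1] l by (auto simp: y_def)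
  define A where "A = {x. cdf \<nu> x > y}"
  have "eventually (\<lambda>x. cdf \<nu> x > y) at_top" using nu.cdf_lim_at_top_prob y by (auto dest: order_tendstoD)
  then have A0: "A \<noteq> {}" by (auto simp: A_def eventually_at_top_linorder)
  have "eventually (\<lambda>x. cdf \<nu> x < y) at_bot" using nu.cdf_lim_at_bot y by (auto dest: order_tendstoD)
  then obtain b where b: "\<And>x. x \<le> b \<Longrightarrow> cdf \<nu> x < y" by (auto simp: eventually_at_bot_linorder)
  have Abdd: "bdd_below A"
  proof (rule bdd_belowI[of _ b])
    fix x assume "x \<in> A"
    then show "b \<le> x" using b[of x] by (cases "b \<le> x") (auto simp: A_def)
  qed
  have phi: "\<phi> l = Inf A" by (simp add: phi_def right_inverse_def A_def y_def)
  have ge: "l \<le> \<gamma> s" if "y \<le> cdf \<nu> s" for s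
  proof (rule ccontr)
    assume "\<not> l \<le> \<gamma> s"
    then have "cdf \<mu> (\<gamma> s) < cdf \<mu> l" using gam_unit[of s] l by (intro cdf_mu_strict) auto
    then show False using that by (simp add: cdf_gam y_def)
  qed
  show "l \<le> \<gamma> s" if h: "\<phi> l < s"
  proof -
    obtain x where "x \<in> A" "x < s" using cInf_lessD[OF A0, of s] h unfolding phi by blast
    then show ?thesis using nu.cdf_nondecreasing[of x s] by (intro ge) (auto simp: A_def)
  qed
  show "\<gamma> s \<le> l" if "s < \<phi> l"
  proof -
    have "s \<notin> A" using that Abdd unfolding phi by (meson cInf_lower not_le)
    then have "cdf \<nu> s \<le> y" by (auto simp: A_def)
    then have "q (cdf \<nu> s) \<le> q y" using y by (intro quantile_mono cdf_nu_unit) auto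
    then show ?thesis using l by (simp add: gam_def y_def quantile_cdf)
  qed
  show "l \<le> \<gamma> s" if h: "\<phi> l \<le> s"
  proof (rule ge)
    have ev: "eventually (\<lambda>x. y \<le> cdf \<nu> x) (at_right s)"
      unfolding eventually_at_right_field
    proof (intro exI[of _ "s + 1"] conjI allI impI)
      fix x assume "s < x"
      then obtain z where "z \<in> A" "z < x" using cInf_lessD[OF A0, of x] h unfolding phi by force
      then show "y \<le> cdf \<nu> x" using nu.cdf_nondecreasing[of z x] by (auto simp: A_def)
    qed simp
    have "(cdf \<nu> \<longlongrightarrow> cdf \<nu> s) (at_right s)"
      using nu.cdf_is_right_cont[of s] by (simp add: continuous_within)
    then show "y \<le> cdf \<nu> s" using ev by (rule tendsto_lowerbound) simp
  qed
qed

lemma phi_mono_on: "mono_on {0<..<1} \<phi>"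
proof (rule mono_onI)
  fix r s :: real assume rs: "r \<in> {0<..<1}" "s \<in> {0<..<1}" "r \<le> s"
  show "\<phi> r \<le> \<phi> s"
  proof (cases "r = s")
    case False
    show ?thesis
    proof (rule ccontr)
      assume "\<not> \<phi> r \<le> \<phi> s"
      then have "s \<le> \<gamma> ((\<phi> r + \<phi> s) / 2)" "\<gamma> ((\<phi> r + \<phi> s) / 2) \<le> r"
        using rs by (auto intro!: phi_less_imp less_phi_imp)
      then show False using rs False by simp
    qed
  qed simp
qed

lemma phi_borel [measurable]: "\<phi> \<in> borel_measurable borel"
proof -
  have "\<phi> \<in> borel_measurable (restrict_space borel {0<..<1})"
    by (rule borel_measurable_mono_on_fnc[OF phi_mono_on])
  then have [measurable]: "(\<lambda>x. \<phi> x * indicator {0<..<1} x) \<in> borel_measurable borel"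
    by (subst (asm) borel_measurable_restrict_space_iff) (auto simp: mult.commute)
  have "\<phi> = (\<lambda>x. if x \<le> 0 then \<phi> 0 else if 1 \<le> x then \<phi> 1 else \<phi> x * indicator {0<..<1} x)"
    using cdf_mu_0 cdf_mu_1 by (auto simp: fun_eq_iff phi_def indicator_def)
  also have "\<dots> \<in> borel_measurable borel" by measurable
  finally show ?thesis .
qed

text \<open>The events \<open>\<phi> l \<le> x\<close> and \<open>l \<le> \<gamma> x\<close>
  differ at most at the single point \<open>l = \<gamma> x\<close>.\<close>

lemma distr_phi: "distr \<mu> borel \<phi> = \<nu>"
proof (rule cdf_unique)
  show "real_distribution (distr \<mu> borel \<phi>)" by simp
  show "real_distribution \<nu>" by (rule nu.real_distribution_axioms)
  show "cdf (distr \<mu> borel \<phi>) = cdf \<nu>"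
  proof
    fix x
    have sing: "AE l in \<mu>. l \<noteq> \<gamma> x"
      using mu_singleton[of "\<gamma> x"] by (subst AE_iff_measurable[of "{\<gamma> x}"]) (auto simp: emeasure_eq_measure)
    have "AE l in \<mu>. l \<in> \<phi> -` {..x} \<longleftrightarrow> l \<in> {..\<gamma> x}"
      using AE_unit sing
    proof eventually_elim
      case (elim l)
      then show ?case using phi_le_imp[of l x] less_phi_imp[of l x] by (cases "\<phi> l \<le> x") auto
    qed
    then have "measure \<mu> (\<phi> -` {..x}) = measure \<mu> {..\<gamma> x}"
      using measurable_sets[OF phi_borel, of "{..x}"] by (intro finite_measure_eq_AE) auto
    then show "cdf (distr \<mu> borel \<phi>) x = cdf \<nu> x"
      using cdf_gam[of x] by (simp add: cdf_def measure_distr)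
  qed
qed

lemma gam_set_integrable: "set_integrable lborel {a<..<b} \<gamma>"
  unfolding set_integrable_def
  by (rule integrableI_bounded_set_indicator[where B = 1]) (use gam_unit in auto, cases "a \<le> b", auto)

lemma gam_interval_integrable: "interval_lebesgue_integrable lborel (ereal a) (ereal b) \<gamma>"
  using gam_set_integrable[of a b] gam_set_integrable[of b a]
  by (simp add: interval_lebesgue_integrable_def)

text \<open>For arbitrary \<open>\<nu>\<close> the integrand \<open>\<gamma>\<close> may jump, so
  \<open>Gam\<close> is handled through bounds on its increments instead of a derivative.\<close>

lemma Gam_diff: assumes "a \<le> b" shows "Gam \<mu> \<nu> b - Gam \<mu> \<nu> a = (\<integral>x\<in>{a<..<b}. \<gamma> x \<partial>lborel)"
proof -
  have "Gam \<mu> \<nu> a + (LBINT t=ereal a..ereal b. \<gamma> t) = Gam \<mu> \<nu> b"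
    unfolding Gam_def by (rule interval_integral_sum) (auto simp: gam_interval_integrable min_def max_def)
  then show ?thesis using assms by (simp add: interval_integral_Ioo)
qed

lemma
  assumes "a \<le> b"
  shows Gam_diff_ge: "(\<And>t. a < t \<Longrightarrow> t < b \<Longrightarrow> c \<le> \<gamma> t) \<Longrightarrow> c * (b - a) \<le> Gam \<mu> \<nu> b - Gam \<mu> \<nu> a"
    and Gam_diff_le: "(\<And>t. a < t \<Longrightarrow> t < b \<Longrightarrow> \<gamma> t \<le> c) \<Longrightarrow> Gam \<mu> \<nu> b - Gam \<mu> \<nu> a \<le> c * (b - a)"
proof -
  have c: "(\<integral>x\<in>{a<..<b}. c \<partial>lborel) = c * (b - a)" using assms by (simp add: set_lebesgue_integral_def mult.commute)
  have i: "set_integrable lborel {a<..<b} (\<lambda>_. c)"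
    unfolding set_integrable_def using assms by (intro integrableI_bounded_set_indicator[where B = "\<bar>c\<bar>"]) auto
  show "c * (b - a) \<le> Gam \<mu> \<nu> b - Gam \<mu> \<nu> a" if "\<And>t. a < t \<Longrightarrow> t < b \<Longrightarrow> c \<le> \<gamma> t"
    unfolding Gam_diff[OF assms] c[symmetric] by (rule set_integral_mono[OF i gam_set_integrable]) (use that in auto)
  show "Gam \<mu> \<nu> b - Gam \<mu> \<nu> a \<le> c * (b - a)" if "\<And>t. a < t \<Longrightarrow> t < b \<Longrightarrow> \<gamma> t \<le> c"
    unfolding Gam_diff[OF assms] c[symmetric] by (rule set_integral_mono[OF gam_set_integrable i]) (use that in auto)
qed

lemma psi_diff: "\<psi> b - \<psi> a = Gam \<mu> \<nu> b - Gam \<mu> \<nu> a"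
  by (simp add: Psi_def)

lemma psi_diff_gam:
  assumes "a \<le> b" shows "\<gamma> a * (b - a) \<le> \<psi> b - \<psi> a" "\<psi> b - \<psi> a \<le> \<gamma> b * (b - a)"
  unfolding psi_diff using monoD[OF gam_mono] assms by (intro Gam_diff_ge Gam_diff_le; force)+

lemma psi_slopes:
  assumes "a \<le> b" shows "0 \<le> \<psi> b - \<psi> a" "\<psi> b - \<psi> a \<le> b - a"
  using Gam_diff_ge[OF assms, of 0] Gam_diff_le[OF assms, of 1] gam_unit by (auto simp: psi_diff)

lemma psi_lipschitz: "\<bar>\<psi> b - \<psi> a\<bar> \<le> \<bar>b - a\<bar>"
  using psi_slopes[of a b] psi_slopes[of b a] by (cases "a \<le> b") auto

lemma psi_borel [measurable]: "\<psi> \<in> borel_measurable borel"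
  by (rule borel_measurable_mono) (use psi_slopes(1) in \<open>force simp: mono_def\<close>)

text \<open>The slope \<open>\<gamma>\<close> of \<open>\<psi>\<close> is at most \<open>l\<close>
  to the left of \<open>\<phi> l\<close> and at least \<open>l\<close> to the right, so
  \<open>\<phi> l\<close> is the best reply of type \<open>l\<close> in the limiting game.\<close>

lemma phi_optimal:
  assumes l: "0 < l" "l < 1"
  shows "l * s - \<psi> s \<le> l * \<phi> l - \<psi> (\<phi> l)"
proof (cases "\<phi> l \<le> s")
  case True
  then have "l * (s - \<phi> l) \<le> \<psi> s - \<psi> (\<phi> l)"
    unfolding psi_diff using phi_less_imp[OF l] by (intro Gam_diff_ge) auto
  then show ?thesis by (simp add: algebra_simps)
next
  case False
  then have "\<psi> (\<phi> l) - \<psi> s \<le> l * (\<phi> l - s)"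
    unfolding psi_diff using less_phi_imp[OF l] by (intro Gam_diff_le) auto
  then show ?thesis by (simp add: algebra_simps)
qed

end

section \<open>The risk function and its Bregman distance\<close>

locale risk =
  fixes H :: "real \<Rightarrow> real"
  assumes risk: "admissible_risk H"
begin

abbreviation "H' \<equiv> deriv H"

lemma H_deriv: "(H has_real_derivative H' x) (at x)"
  using risk by (simp add: admissible_risk_def)

lemma H_less: "x < y \<Longrightarrow> H x < H y" and H_le: "x \<le> y \<Longrightarrow> H x \<le> H y"
  using risk by (auto simp: admissible_risk_def strict_mono_less strict_mono_less_eq)

lemma continuous_H: "continuous_on A H" and continuous_H': "continuous_on A H'"
  using risk by (auto simp: admissible_risk_def intro: DERIV_continuous_on DERIV_subset)

lemma H_borel [measurable]: "H \<in> borel_measurable borel" and H'_borel [measurable]: "H' \<in> borel_measurable borel"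
  by (auto intro: borel_measurable_continuous_onI continuous_H continuous_H')

definition lo where "lo = (SOME \<epsilon>. 0 < \<epsilon> \<and> (\<forall>x. \<epsilon> < H' x))"
definition hi where "hi = (SOME K. 0 < K \<and> (\<forall>x. H' x < K))"

lemma lo: "0 < lo" "lo < H' x" and hi: "0 < hi" "H' x < hi"
proof -
  have "\<exists>\<epsilon>. 0 < \<epsilon> \<and> (\<forall>x. \<epsilon> < H' x)" "\<exists>K. 0 < K \<and> (\<forall>x. H' x < K)"
    using risk unfolding admissible_risk_def by metis+
  from someI_ex[OF this(1)] someI_ex[OF this(2)] show "0 < lo" "lo < H' x" "0 < hi" "H' x < hi"
    by (auto simp: lo_def hi_def)
qed

lemma H_lipschitz: "\<bar>H x - H y\<bar> \<le> hi * \<bar>x - y\<bar>"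
proof -
  have *: "\<bar>H b - H a\<bar> \<le> hi * \<bar>b - a\<bar>" if ab: "a < b" for a b
  proof -
    have "\<exists>z>a. z < b \<and> H b - H a = (b - a) * H' z"
      by (rule MVT2) (use ab H_deriv in auto)
    then obtain z where "H b - H a = (b - a) * H' z" by blast
    then show ?thesis using lo(1) lo(2)[of z] hi(2)[of z] ab by (simp add: abs_mult mult.commute)
  qed
  show ?thesis using *[of x y] *[of y x] by (cases x y rule: linorder_cases) (auto simp: abs_minus_commute)
qed

lemma H_convex: "0 \<le> t \<Longrightarrow> t \<le> 1 \<Longrightarrow> H ((1 - t) * x + t * y) \<le> (1 - t) * H x + t * H y"
proof (cases "x = y \<or> t = 0 \<or> t = 1")
  case False
  moreover assume "0 \<le> t" "t \<le> 1"
  ultimately show ?thesis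
    using risk unfolding admissible_risk_def strictly_convex_def by (simp add: less_imp_le)
next
  case True
  then show ?thesis by (auto simp: algebra_simps)
qed

text \<open>The Bregman distance of \<open>H\<close> from \<open>x\<close> to \<open>x +
  d\<close>.\<close>

definition breg where "breg x d = H (x + d) - H x - H' x * d"

lemma breg_nonneg: "0 \<le> breg x d"
proof -
  have "convex_on UNIV H"
    by (rule convex_onI) (use H_convex in auto)
  then have "H (x + d) - H x \<ge> H' x * ((x + d) - x)"
    by (rule convex_on_imp_above_tangent) (use H_deriv in auto)
  then show ?thesis by (simp add: breg_def)
qed

lemma breg_scale: "0 \<le> t \<Longrightarrow> t \<le> 1 \<Longrightarrow> breg x (t * d) \<le> t * breg x d"
  using H_convex[of t x "x + d"] by (simp add: breg_def algebra_simps)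

text \<open>Strict convexity at the midpoint, together with the tangent inequality there.\<close>

lemma breg_pos: assumes "d \<noteq> 0" shows "0 < breg x d"
proof -
  have "x \<noteq> y \<Longrightarrow> 0 < t \<Longrightarrow> t < 1 \<Longrightarrow> H ((1 - t) * x + t * y) < (1 - t) * H x + t * H y" for x y t
    using risk by (simp add: admissible_risk_def strictly_convex_def)
  from this[of x "x + d" "1/2"] have "H ((1 - 1/2) * x + 1/2 * (x + d)) < (1 - 1/2) * H x + 1/2 * H (x + d)"
    using assms by simp
  then have "breg x (d / 2) < breg x d / 2" by (simp add: breg_def field_simps)
  then show ?thesis using breg_nonneg[of x "d / 2"] by simp
qed

text \<open>Along rays from \<open>x\<close> the distance increases, so it is enough to bound it
  at displacement \<open>\<eta>\<close>, where compactness in \<open>x\<close> gives a positive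
  minimum.\<close>

lemma breg_lower:
  assumes "0 < \<eta>"
  obtains b where "0 < b" "\<And>x d. \<bar>x\<bar> \<le> R \<Longrightarrow> \<eta> \<le> \<bar>d\<bar> \<Longrightarrow> b \<le> breg x d"
proof (cases "0 \<le> R")
  case True
  let ?m = "\<lambda>x. min (breg x \<eta>) (breg x (- \<eta>))"
  have "continuous_on {-R..R} ?m"
    unfolding breg_def
    by (intro continuous_intros continuous_on_compose2[OF continuous_H[of UNIV]] continuous_H') auto
  then obtain x0 where x0: "x0 \<in> {-R..R}" "\<And>x. x \<in> {-R..R} \<Longrightarrow> ?m x0 \<le> ?m x"
    using continuous_attains_inf[of "{-R..R}" ?m] True by auto
  have "?m x0 \<le> breg x d" if "\<bar>x\<bar> \<le> R" "\<eta> \<le> \<bar>d\<bar>" for x d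
  proof -
    define t where "t = \<eta> / \<bar>d\<bar>"
    have t: "0 \<le> t" "t \<le> 1" "t * d = \<eta> \<or> t * d = - \<eta>" using that assms by (auto simp: t_def abs_if)
    have "x \<in> {-R..R}" using that(1) by (simp, arith)
    then have "?m x0 \<le> ?m x" by (rule x0(2))
    also have "\<dots> \<le> breg x (t * d)" using t(3) by auto
    also have "\<dots> \<le> t * breg x d" by (rule breg_scale[OF t(1,2)])
    also have "\<dots> \<le> breg x d" using mult_right_mono[OF t(2) breg_nonneg[of x d]] by simp
    finally show ?thesis .
  qed
  moreover have "0 < ?m x0" using breg_pos assms by simp
  ultimately show ?thesis using that by blast
next
  case False
  then show ?thesis using that[of 1] by auto
qed

end

section \<open>The first-order condition behind the operator T\<close>

text \<open>Doob--Dynkin factorisation. Each sublevel set of \<open>f\<close> at a rational level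
  is the preimage of a Borel set under \<open>S\<close>, and \<open>Y\<close> is the infimum of
  the levels whose Borel set contains the point.\<close>

lemma factor_through_vimage:
  fixes f :: "'a \<Rightarrow> real" and S :: "'a \<Rightarrow> real"
  assumes f: "f \<in> borel_measurable (vimage_algebra X S borel)"
  obtains Y where "Y \<in> borel_measurable borel" "\<And>x. x \<in> X \<Longrightarrow> Y (S x) = f x"
proof -
  have "\<exists>B\<in>sets borel. {x \<in> X. f x < real_of_rat r} = S -` B \<inter> X" for r
  proof -
    have "f -` {..<real_of_rat r} \<inter> space (vimage_algebra X S borel) \<in> sets (vimage_algebra X S borel)"
      by (intro measurable_sets[OF f]) auto
    moreover have "f -` {..<real_of_rat r} \<inter> X = {x \<in> X. f x < real_of_rat r}" by auto
    ultimately show ?thesis by (auto simp: sets_vimage_algebra2)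
  qed
  then obtain B where B: "\<And>r. B r \<in> sets borel" "\<And>r. {x \<in> X. f x < real_of_rat r} = S -` B r \<inter> X"
    by metis
  define Z where "Z s = (INF r. if s \<in> B r then ereal (real_of_rat r) else \<infinity>)" for s
  have [measurable]: "Z \<in> borel_measurable borel"
    unfolding Z_def[abs_def] using B(1) by measurable
  have "Z (S x) = ereal (f x)" if x: "x \<in> X" for x
  proof (rule antisym)
    have mem: "S x \<in> B r \<longleftrightarrow> f x < real_of_rat r" for r using B(2)[of r] x by auto
    show "ereal (f x) \<le> Z (S x)"
      unfolding Z_def by (intro INF_greatest) (auto simp: mem)
    show "Z (S x) \<le> ereal (f x)"
    proof (rule ereal_le_epsilon2)
      fix e :: real assume "0 < e"
      then obtain r where r: "f x < real_of_rat r" "real_of_rat r < f x + e"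
        using of_rat_dense[of "f x" "f x + e"] by auto
      have "Z (S x) \<le> ereal (real_of_rat r)"
        unfolding Z_def using r(1) by (intro INF_lower2[of r]) (auto simp: mem)
      also have "\<dots> \<le> ereal (f x) + ereal e" using r(2) by simp
      finally show "Z (S x) \<le> ereal (f x) + ereal e" .
    qed
  qed
  then show ?thesis using that[of "\<lambda>s. real_of_ereal (Z s)"] by simp
qed

locale limit_eq = prior_pair \<mu> \<nu> + risk H for \<mu> \<nu> H +
  assumes T_eq: "T_op \<mu> H std_normal \<nu> = std_normal"
begin

text \<open>By \<open>phi_optimal\<close> this is the conjugate of \<open>\<psi>\<close> at the
  types in \<open>]0,1[\<close>.\<close>

definition h where "h l = l * \<phi> l - \<psi> (\<phi> l)"

lemma h_borel [measurable]: "h \<in> borel_measurable borel"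
  unfolding h_def[abs_def] by measurable

abbreviation "Pi2 \<equiv> Pi_bar \<mu> \<nu>"

lemma Pi2_sets [measurable_cong, simp]: "sets Pi2 = sets (borel \<Otimes>\<^sub>M borel)"
  by (simp add: Pi_bar_def)

lemma Pi2_space [simp]: "space Pi2 = UNIV"
  by (simp add: Pi_bar_def space_pair_measure)

lemma prob_Pi2: "prob_space Pi2"
  unfolding Pi_bar_def by (rule prob_space_distr) measurable

lemma integral_Pi2: "F \<in> borel_measurable (borel \<Otimes>\<^sub>M borel) \<Longrightarrow> (\<integral>z. F z \<partial>Pi2) = (\<integral>l. F (l, \<phi> l) \<partial>\<mu>)"
  for F :: "real \<times> real \<Rightarrow> real"
  unfolding Pi_bar_def by (subst integral_distr) auto

text \<open>The equation \<open>T(\<nu>) = N(0,1)\<close> freed from conditional expectations: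
  integrated against functions of \<open>S\<close>, the version \<open>Y_fun\<close> can be
  replaced by the conditioned variable, and \<open>(L, S)\<close> by \<open>(l, \<phi> l)\<close>
  under \<open>\<mu>\<close>. The factorisation above ensures that the choice in
  \<open>Y_fun\<close> succeeds.\<close>

lemma std_normal_eq:
  obtains \<alpha> where "0 < \<alpha>" "std_normal = distr (density \<mu> (\<lambda>l. ennreal (\<alpha> * H' (h l)))) borel \<phi>"
proof -
  interpret P: prob_space Pi2 by (rule prob_Pi2)
  define G where "G = vimage_algebra (space Pi2) snd (borel :: real measure)"
  define w where "w = (\<lambda>(l, s). H' (l * s - \<psi> s))"
  define C where "C = real_cond_exp Pi2 G w"
  define Y where "Y = Y_fun \<mu> H std_normal \<nu>"
  have sub: "subalgebra Pi2 G"
  proof -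
    have "snd \<in> measurable Pi2 (borel :: real measure)" by measurable
    from measurable_sets[OF this] show ?thesis
      unfolding subalgebra_def G_def by (auto simp: sets_vimage_algebra2)
  qed
  interpret S: sigma_finite_subalgebra Pi2 G
    by (rule finite_measure_subalgebra_is_sigma_finite) (unfold_locales, rule sub)
  have w_borel [measurable]: "w \<in> borel_measurable (borel \<Otimes>\<^sub>M borel)"
    unfolding w_def by measurable
  have w_bd: "lo \<le> w z" "w z \<le> hi" "0 \<le> w z" "\<bar>w z\<bar> \<le> hi" for z
    using lo(1) lo(2)[of "fst z * snd z - \<psi> (snd z)"] hi(2)[of "fst z * snd z - \<psi> (snd z)"]
    by (auto simp: w_def split: prod.splits)
  have w_int: "integrable Pi2 w"
    by (rule P.integrable_const_bound[of _ hi]) (use w_bd in auto)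
  obtain Y0 where "Y0 \<in> borel_measurable borel" "\<And>z. z \<in> space Pi2 \<Longrightarrow> Y0 (snd z) = C z"
    using factor_through_vimage[where f = C and X = "space Pi2" and S = snd] by (auto simp: C_def G_def)
  then have ex: "\<exists>Y. Y \<in> borel_measurable borel \<and> (AE z in Pi2. Y (snd z) = C z)"
    by (intro exI[of _ Y0] conjI AE_I2) auto
  have "C = cond_exp_on Pi2 snd (\<lambda>(l, s). H' (l * s - \<psi> s))"
    by (simp only: C_def G_def w_def cond_exp_on_def)
  then have Y_eq: "Y = (SOME Y. Y \<in> borel_measurable borel \<and> (AE z in Pi2. Y (snd z) = C z))"
    by (simp only: Y_def Y_fun_def)
  have "Y \<in> borel_measurable borel \<and> (AE z in Pi2. Y (snd z) = C z)"
    unfolding Y_eq by (rule someI_ex[OF ex])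
  then have Y [measurable]: "Y \<in> borel_measurable borel" and YC: "AE z in Pi2. Y (snd z) = C z"
    by auto
  have C_bd: "AE z in Pi2. lo \<le> C z" "AE z in Pi2. C z \<le> hi"
    unfolding C_def using w_bd by (auto intro!: S.real_cond_exp_ge_c S.real_cond_exp_le_c w_int)
  have "AE z in Pi2. lo \<le> Y (snd z) \<and> Y (snd z) \<le> hi"
    using YC C_bd by eventually_elim simp
  then have Y_bd: "AE l in \<mu>. lo \<le> Y (\<phi> l) \<and> Y (\<phi> l) \<le> hi"
    unfolding Pi_bar_def by (subst (asm) AE_distr_iff) auto
  have Y_int: "integrable \<mu> (\<lambda>l. Y (\<phi> l) * indicator A (\<phi> l))" if [measurable]: "A \<in> sets borel" for A
  proof (rule integrable_const_bound[of _ hi])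
    show "AE l in \<mu>. norm (Y (\<phi> l) * indicator A (\<phi> l)) \<le> hi"
      using Y_bd by (rule AE_mp) (use lo(1) hi(1) in \<open>auto simp: indicator_def\<close>)
  qed measurable
  have swap: "(\<integral>l. Y (\<phi> l) * indicator A (\<phi> l) \<partial>\<mu>) = (\<integral>l. H' (h l) * indicator A (\<phi> l) \<partial>\<mu>)"
    if A [measurable]: "A \<in> sets borel" for A
  proof -
    have "(\<integral>l. Y (\<phi> l) * indicator A (\<phi> l) \<partial>\<mu>) = (\<integral>z. Y (snd z) * indicator A (snd z) \<partial>Pi2)"
      by (subst integral_Pi2) auto
    also have "\<dots> = (\<integral>z. indicator A (snd z) * C z \<partial>Pi2)"
    proof (rule integral_cong_AE)
      show "AE z in Pi2. Y (snd z) * indicator A (snd z) = indicator A (snd z) * C z"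
        using YC by eventually_elim simp
    qed (auto simp: C_def)
    also have "\<dots> = (\<integral>z. indicator A (snd z) * w z \<partial>Pi2)"
      unfolding C_def
    proof (rule S.real_cond_exp_intg(2))
      have [measurable]: "snd \<in> measurable G (borel :: real measure)"
        unfolding G_def by (rule measurable_vimage_algebra1) auto
      show "(\<lambda>z. indicator A (snd z) :: real) \<in> borel_measurable G" by measurable
      show "integrable Pi2 (\<lambda>z. indicator A (snd z) * w z)"
        by (rule P.integrable_const_bound[of _ hi]) (use w_bd lo hi in \<open>auto simp: indicator_def less_imp_le\<close>)
    qed simp
    also have "\<dots> = (\<integral>l. H' (h l) * indicator A (\<phi> l) \<partial>\<mu>)"
      by (subst integral_Pi2) (auto simp: w_def h_def mult.commute)
    finally show ?thesis .
  qed
  define \<alpha> where "\<alpha> = 1 / (\<integral>s. Y s \<partial>\<nu>)"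
  have "(\<integral>s. Y s \<partial>distr \<mu> borel \<phi>) = (\<integral>l. Y (\<phi> l) \<partial>\<mu>)"
    by (subst integral_distr) auto
  then have "(\<integral>s. Y s \<partial>\<nu>) = (\<integral>l. Y (\<phi> l) \<partial>\<mu>)"
    by (simp only: distr_phi)
  moreover have "lo \<le> (\<integral>l. Y (\<phi> l) \<partial>\<mu>)"
    using Y_int[of UNIV] Y_bd by (intro integral_ge_const) (auto elim: eventually_mono)
  ultimately have \<alpha>: "0 < \<alpha>" using lo(1) by (simp add: \<alpha>_def)
  have "std_normal = density \<nu> (\<lambda>s. ennreal (\<alpha> * Y s))"
    using T_eq by (simp add: T_op_def Y_def \<alpha>_def Let_def)
  also have "\<dots> = distr (density \<mu> (\<lambda>l. ennreal (\<alpha> * H' (h l)))) borel \<phi>"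
  proof (rule measure_eqI)
    fix A assume "A \<in> sets (density \<nu> (\<lambda>s. ennreal (\<alpha> * Y s)))"
    then have A [measurable]: "A \<in> sets borel" by simp
    have "emeasure (density \<nu> (\<lambda>s. ennreal (\<alpha> * Y s))) A = (\<integral>\<^sup>+ s. ennreal (\<alpha> * Y s) * indicator A s \<partial>\<nu>)"
      by (subst emeasure_density) auto
    also have "\<dots> = (\<integral>\<^sup>+ s. ennreal (\<alpha> * Y s) * indicator A s \<partial>distr \<mu> borel \<phi>)"
      by (simp only: distr_phi)
    also have "\<dots> = (\<integral>\<^sup>+ l. ennreal (\<alpha> * (Y (\<phi> l) * indicator A (\<phi> l))) \<partial>\<mu>)"
      by (subst nn_integral_distr) (auto intro!: nn_integral_cong simp: indicator_def)
    also have "\<dots> = ennreal (\<integral>l. \<alpha> * (Y (\<phi> l) * indicator A (\<phi> l)) \<partial>\<mu>)"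
      using Y_int[OF A] Y_bd \<alpha> lo(1)
      by (intro nn_integral_eq_integral) (auto elim!: eventually_mono simp: indicator_def)
    also have "\<dots> = ennreal (\<integral>l. \<alpha> * (H' (h l) * indicator A (\<phi> l)) \<partial>\<mu>)"
      by (simp add: swap[OF A])
    also have "\<dots> = (\<integral>\<^sup>+ l. ennreal (\<alpha> * (H' (h l) * indicator A (\<phi> l))) \<partial>\<mu>)"
    proof (rule nn_integral_eq_integral[symmetric])
      show "integrable \<mu> (\<lambda>l. \<alpha> * (H' (h l) * indicator A (\<phi> l)))"
      proof (intro integrable_mult_right integrable_const_bound[of _ hi] AE_I2)
        fix l show "norm (H' (h l) * indicator A (\<phi> l)) \<le> hi"
          using lo(1) lo(2)[of "h l"] hi(1) hi(2)[of "h l"] by (auto simp: indicator_def)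
      qed measurable
      show "AE l in \<mu>. 0 \<le> \<alpha> * (H' (h l) * indicator A (\<phi> l))"
      proof (rule AE_I2)
        fix l show "0 \<le> \<alpha> * (H' (h l) * indicator A (\<phi> l))"
          using \<alpha> lo(1) lo(2)[of "h l"] by (auto simp: indicator_def)
      qed
    qed
    also have "\<dots> = (\<integral>\<^sup>+ l. ennreal (\<alpha> * H' (h l)) * indicator (\<phi> -` A) l \<partial>\<mu>)"
      by (intro nn_integral_cong) (auto simp: indicator_def)
    also have "\<dots> = emeasure (distr (density \<mu> (\<lambda>l. ennreal (\<alpha> * H' (h l)))) borel \<phi>) A"
      using measurable_sets[OF phi_borel A] by (simp add: emeasure_distr emeasure_density)
    finally show "emeasure (density \<nu> (\<lambda>s. ennreal (\<alpha> * Y s))) A = emeasure (distr (density \<mu> (\<lambda>l. ennreal (\<alpha> * H' (h l)))) borel \<phi>) A" .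
  qed simp
  finally show ?thesis using that \<alpha> by blast
qed

definition alpha where "alpha = (SOME \<alpha>. 0 < \<alpha> \<and> std_normal = distr (density \<mu> (\<lambda>l. ennreal (\<alpha> * H' (h l)))) borel \<phi>)"

lemma alpha: "0 < alpha" "std_normal = distr (density \<mu> (\<lambda>l. ennreal (alpha * H' (h l)))) borel \<phi>"
proof -
  have "\<exists>\<alpha>. 0 < \<alpha> \<and> std_normal = distr (density \<mu> (\<lambda>l. ennreal (\<alpha> * H' (h l)))) borel \<phi>"
    using std_normal_eq by metis
  from someI_ex[OF this] show "0 < alpha" "std_normal = distr (density \<mu> (\<lambda>l. ennreal (alpha * H' (h l)))) borel \<phi>"
    by (auto simp: alpha_def)
qed

lemma weight_pos: "0 < alpha * H' (h l)"
  using alpha(1) lo(1) lo(2)[of "h l"] by (intro mult_pos_pos) auto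

lemma integral_std_normal:
  fixes f :: "real \<Rightarrow> real"
  assumes [measurable]: "f \<in> borel_measurable borel"
  shows "(\<integral>s. f s \<partial>std_normal) = alpha * (\<integral>l. H' (h l) * f (\<phi> l) \<partial>\<mu>)"
proof -
  have "(\<integral>s. f s \<partial>std_normal) = (\<integral>l. f (\<phi> l) \<partial>density \<mu> (\<lambda>l. ennreal (alpha * H' (h l))))"
    unfolding alpha(2) by (subst integral_distr) auto
  also have "\<dots> = (\<integral>l. (alpha * H' (h l)) *\<^sub>R f (\<phi> l) \<partial>\<mu>)"
    by (intro integral_density) (auto intro!: AE_I2 less_imp_le[OF weight_pos])
  finally show ?thesis by (simp add: mult.assoc)
qed

lemma integrable_std_normal:
  fixes f :: "real \<Rightarrow> real"
  assumes [measurable]: "f \<in> borel_measurable borel" and int: "integrable std_normal f"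
  shows "integrable \<mu> (\<lambda>l. f (\<phi> l))"
proof -
  have int': "integrable (distr (density \<mu> (\<lambda>l. ennreal (alpha * H' (h l)))) borel \<phi>) f"
    using int by (simp only: alpha(2)[symmetric])
  have "integrable (density \<mu> (\<lambda>l. ennreal (alpha * H' (h l)))) (\<lambda>l. f (\<phi> l))"
    by (rule integrable_distr[OF _ int']) measurable
  then have i: "integrable \<mu> (\<lambda>l. (alpha * H' (h l)) *\<^sub>R f (\<phi> l))"
    by (subst (asm) integrable_density) (auto intro!: AE_I2 less_imp_le[OF weight_pos])
  show ?thesis
  proof (rule Bochner_Integration.integrable_bound[OF integrable_mult_right[OF i, of "1 / (alpha * lo)"]])
    show "AE l in \<mu>. norm (f (\<phi> l)) \<le> norm (1 / (alpha * lo) * (alpha * H' (h l)) *\<^sub>R f (\<phi> l))"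
    proof (rule AE_I2)
      fix l
      have "1 \<le> H' (h l) / lo" using lo(1) lo(2)[of "h l"] by simp
      then have "1 * \<bar>f (\<phi> l)\<bar> \<le> H' (h l) / lo * \<bar>f (\<phi> l)\<bar>" by (intro mult_right_mono) auto
      then show "norm (f (\<phi> l)) \<le> norm (1 / (alpha * lo) * (alpha * H' (h l)) *\<^sub>R f (\<phi> l))"
        using alpha(1) lo(1) lo(2)[of "h l"] by (simp add: abs_mult)
    qed
  qed measurable
qed

text \<open>The weight \<open>alpha * H' (h l)\<close> is positive, so the law
  \<open>\<nu>\<close> of \<open>\<phi>\<close> has the null sets of the normal law. Hence
  \<open>\<nu>\<close> has no atoms, which makes \<open>\<gamma>\<close> continuous and
  \<open>\<psi>\<close> differentiable, and it charges every interval.\<close>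

lemma null_std_normal_iff:
  assumes A [measurable]: "A \<in> sets borel"
  shows "A \<in> null_sets std_normal \<longleftrightarrow> (AE l in \<mu>. \<phi> l \<notin> A)"
proof -
  have "A \<in> null_sets std_normal \<longleftrightarrow> emeasure (density \<mu> (\<lambda>l. ennreal (alpha * H' (h l)))) (\<phi> -` A) = 0"
    unfolding alpha(2) null_sets_def using A by (simp add: emeasure_distr)
  also have "\<dots> \<longleftrightarrow> \<phi> -` A \<in> null_sets (density \<mu> (\<lambda>l. ennreal (alpha * H' (h l))))"
    using measurable_sets[OF phi_borel A] by (simp add: null_sets_def)
  also have "\<dots> \<longleftrightarrow> (AE l in \<mu>. l \<in> \<phi> -` A \<longrightarrow> ennreal (alpha * H' (h l)) = 0)"
    using measurable_sets[OF phi_borel A] by (subst null_sets_density_iff) auto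
  also have "\<dots> \<longleftrightarrow> (AE l in \<mu>. \<phi> l \<notin> A)"
  proof (rule AE_cong)
    fix l
    show "(l \<in> \<phi> -` A \<longrightarrow> ennreal (alpha * H' (h l)) = 0) = (\<phi> l \<notin> A)" using weight_pos[of l] by (simp add: ennreal_eq_0_iff)
  qed
  finally show ?thesis .
qed

lemma null_sets_std_normal: "A \<in> sets borel \<Longrightarrow> A \<in> null_sets std_normal \<longleftrightarrow> A \<in> null_sets lborel"
proof -
  assume A: "A \<in> sets borel"
  have "A \<in> null_sets std_normal \<longleftrightarrow> (AE x in lborel. x \<in> A \<longrightarrow> ennreal (std_normal_density x) = 0)"
    unfolding std_normal_def using A by (subst null_sets_density_iff) auto
  also have "\<dots> \<longleftrightarrow> (AE x in lborel. x \<notin> A)"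
  proof (rule AE_cong)
    fix x show "(x \<in> A \<longrightarrow> ennreal (std_normal_density x) = 0) = (x \<notin> A)"
      using normal_density_pos[of 1 0 x] by (simp add: ennreal_eq_0_iff)
  qed
  finally show ?thesis using A by (simp add: AE_iff_null_sets)
qed

lemma nu_singleton: "measure \<nu> {x} = 0"
proof -
  have "{x} \<in> null_sets std_normal" by (simp add: null_sets_std_normal finite_imp_null_set_lborel)
  then have "AE l in \<mu>. \<phi> l \<notin> {x}" by (subst (asm) null_std_normal_iff) auto
  then have "measure \<mu> (\<phi> -` {x}) = measure \<mu> {}"
    using measurable_sets[OF phi_borel, of "{x}"] by (intro finite_measure_eq_AE) (auto elim: eventually_mono)
  then have "measure (distr \<mu> borel \<phi>) {x} = 0" by (simp add: measure_distr)
  then show ?thesis by (simp only: distr_phi)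
qed

lemma continuous_gam: "isCont \<gamma> s"
proof -
  have "continuous_on UNIV (cdf \<nu>)"
    by (intro continuous_at_imp_continuous_on ballI) (simp add: nu.isCont_cdf nu_singleton)
  then have "continuous_on UNIV (\<lambda>s. q (cdf \<nu> s))"
    by (rule continuous_on_compose2[OF continuous_quantile]) (use cdf_nu_unit in auto)
  then show ?thesis by (simp add: gam_def[abs_def] continuous_on_eq_continuous_at)
qed

lemma psi_deriv: "(\<psi> has_real_derivative \<gamma> s) (at s)"
  unfolding DERIV_def
proof (rule real_tendsto_sandwich)
  let ?Q = "\<lambda>d. (\<psi> (s + d) - \<psi> s) / d"
  show "eventually (\<lambda>d. min (\<gamma> s) (\<gamma> (s + d)) \<le> ?Q d) (at 0)" "eventually (\<lambda>d. ?Q d \<le> max (\<gamma> s) (\<gamma> (s + d))) (at 0)"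
  proof (safe intro!: eventually_at_topological[THEN iffD2] exI[of _ UNIV])
    fix d :: real assume d: "d \<noteq> 0"
    consider "0 < d" | "d < 0" using d by linarith
    then have "min (\<gamma> s) (\<gamma> (s + d)) \<le> ?Q d \<and> ?Q d \<le> max (\<gamma> s) (\<gamma> (s + d))"
    proof cases
      case 1
      then have "\<gamma> s \<le> ?Q d" "?Q d \<le> \<gamma> (s + d)"
        using psi_diff_gam[of s "s + d"] by (simp_all add: le_divide_eq divide_le_eq)
      then show ?thesis by auto
    next
      case 2
      then have "\<gamma> (s + d) \<le> ?Q d" "?Q d \<le> \<gamma> s"
        using psi_diff_gam[of "s + d" s] by (simp_all add: le_divide_eq divide_le_eq)
      then show ?thesis by auto
    qed
    then show "min (\<gamma> s) (\<gamma> (s + d)) \<le> ?Q d" "?Q d \<le> max (\<gamma> s) (\<gamma> (s + d))" by auto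
  qed auto
  have "((\<lambda>d. \<gamma> (s + d)) \<longlongrightarrow> \<gamma> s) (at 0)"
    using continuous_gam[of s] by (simp add: isCont_iff)
  from tendsto_min[OF tendsto_const[of "\<gamma> s"] this] tendsto_max[OF tendsto_const[of "\<gamma> s"] this]
  show "((\<lambda>d. min (\<gamma> s) (\<gamma> (s + d))) \<longlongrightarrow> \<gamma> s) (at 0)" "((\<lambda>d. max (\<gamma> s) (\<gamma> (s + d))) \<longlongrightarrow> \<gamma> s) (at 0)" by auto
qed

lemma deriv_psi: "deriv \<psi> = \<gamma>"
  using DERIV_imp_deriv[OF psi_deriv] by auto

lemma integrable_id_std_normal: "integrable std_normal (\<lambda>s. s)"
  using real_dist_normal_dist std_normal_distribution_even_moments(2)[of 1]
    integrable_normal_moment_nz_1[of 1 0]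
  unfolding std_normal_def by (subst integrable_density) auto

lemma integrable_lipschitz_std_normal:
  fixes f :: "real \<Rightarrow> real"
  assumes [measurable]: "f \<in> borel_measurable borel" and lip: "\<And>a b. \<bar>f b - f a\<bar> \<le> \<bar>b - a\<bar>"
  shows "integrable std_normal f"
proof -
  interpret N: prob_space std_normal by (rule prob_std_normal)
  have "integrable std_normal (\<lambda>s. \<bar>s\<bar> + \<bar>f 0\<bar>)" using integrable_id_std_normal by auto
  then show ?thesis
  proof (rule Bochner_Integration.integrable_bound)
    show "AE s in std_normal. norm (f s) \<le> norm (\<bar>s\<bar> + \<bar>f 0\<bar>)"
    proof (rule AE_I2)
      fix s
      have "\<bar>f s\<bar> \<le> \<bar>s\<bar> + \<bar>f 0\<bar>" using lip[of 0 s] lip[of s 0] by arith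
      then show "norm (f s) \<le> norm (\<bar>s\<bar> + \<bar>f 0\<bar>)" by simp
    qed
    show "f \<in> borel_measurable std_normal" by (simp add: std_normal_def)
  qed
qed

lemma integral_psi: "(\<integral>s. \<psi> s \<partial>std_normal) = 0"
proof -
  interpret N: prob_space std_normal by (rule prob_std_normal)
  have "Gam \<mu> \<nu> = (\<lambda>s. \<psi> s - (\<psi> 0 - Gam \<mu> \<nu> 0))" by (auto simp: Psi_def)
  moreover have "integrable std_normal (\<lambda>s. \<psi> s - (\<psi> 0 - Gam \<mu> \<nu> 0))"
    using integrable_lipschitz_std_normal[OF psi_borel psi_lipschitz] by (intro Bochner_Integration.integrable_diff) auto
  ultimately have "integrable std_normal (Gam \<mu> \<nu>)" by simp
  then show ?thesis using N.prob_space by (simp add: Psi_def)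
qed

end

section \<open>Conditional expectations along Brownian motion\<close>

text \<open>Once it is known that \<open>B 1 - B t\<close> is independent of the past, this is the
  value at \<open>x\<close> of \<open>E[g (B 1) | B t = x]\<close>.\<close>

definition gauss_mean :: "(real \<Rightarrow> real) \<Rightarrow> real \<Rightarrow> real \<Rightarrow> real" where
  "gauss_mean g t x = (\<integral>z. g (x + sqrt (1 - t) * z) \<partial>std_normal)"

lemma (in prob_space) indep_var_nn_integral:
  assumes ind: "indep_var S U T D" and F [measurable]: "F \<in> borel_measurable (S \<Otimes>\<^sub>M T)"
  shows "(\<integral>\<^sup>+x. F (U x, D x) \<partial>M) = (\<integral>\<^sup>+x. (\<integral>\<^sup>+y. F (U x, D y) \<partial>M) \<partial>M)"
proof -
  have [measurable]: "random_variable S U" "random_variable T D"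
    and eq: "distr M S U \<Otimes>\<^sub>M distr M T D = distr M (S \<Otimes>\<^sub>M T) (\<lambda>x. (U x, D x))"
    using ind by (auto simp: indep_var_distribution_eq)
  interpret D: prob_space "distr M T D" by (rule prob_space_distr) simp
  have "(\<integral>\<^sup>+x. F (U x, D x) \<partial>M) = (\<integral>\<^sup>+z. F z \<partial>(distr M S U \<Otimes>\<^sub>M distr M T D))"
    unfolding eq by (subst nn_integral_distr) auto
  also have "\<dots> = (\<integral>\<^sup>+u. (\<integral>\<^sup>+d. F (u, d) \<partial>distr M T D) \<partial>distr M S U)"
    by (subst D.nn_integral_fst[symmetric]) simp_all
  also have "\<dots> = (\<integral>\<^sup>+x. (\<integral>\<^sup>+d. F (U x, d) \<partial>distr M T D) \<partial>M)"
    by (subst nn_integral_distr) auto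
  also have "\<dots> = (\<integral>\<^sup>+x. (\<integral>\<^sup>+y. F (U x, D y) \<partial>M) \<partial>M)"
  proof (rule nn_integral_cong)
    fix x assume "x \<in> space M"
    then have "U x \<in> space S" by (rule measurable_space[rotated]) simp
    then show "(\<integral>\<^sup>+d. F (U x, d) \<partial>distr M T D) = (\<integral>\<^sup>+y. F (U x, D y) \<partial>M)"
      by (subst nn_integral_distr) auto
  qed
  finally show ?thesis .
qed

text \<open>The terminal value is \<open>g (B 1)\<close>; the bounds on \<open>g\<close> let
  conditional expectations be compared as finite measures.\<close>

locale bm_kernel =
  fixes M :: "'w measure" and B :: "real \<Rightarrow> 'w \<Rightarrow> real" and g :: "real \<Rightarrow> real"
  assumes bm: "brownian_motion M B" and g_mono: "mono g" and g_unit: "\<And>x. 0 \<le> g x" "\<And>x. g x \<le> 1"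
begin

sublocale prob_space M using bm by (simp add: brownian_motion_def)

lemma B_meas [measurable]: "0 \<le> t \<Longrightarrow> B t \<in> borel_measurable M"
  and B_0: "AE \<omega> in M. B 0 \<omega> = 0"
  using bm by (auto simp: brownian_motion_def)

lemma g_borel [measurable]: "g \<in> borel_measurable borel"
  by (rule borel_measurable_mono[OF g_mono])

lemma increment_law:
  assumes "0 \<le> s" "s < t"
  shows "distr M borel (\<lambda>\<omega>. B t \<omega> - B s \<omega>) = distr std_normal borel (\<lambda>z. sqrt (t - s) * z)"
proof -
  have "distributed M lborel (\<lambda>\<omega>. B t \<omega> - B s \<omega>) (\<lambda>x. ennreal (normal_density 0 (sqrt (t - s)) x))"
    using bm assms by (simp add: brownian_motion_def)
  then have "distr M lborel (\<lambda>\<omega>. B t \<omega> - B s \<omega>) = distr std_normal borel (\<lambda>z. sqrt (t - s) * z)"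
    using assms by (simp add: distributed_def std_normal_scale)
  moreover have "distr M lborel (\<lambda>\<omega>. B t \<omega> - B s \<omega>) = distr M borel (\<lambda>\<omega>. B t \<omega> - B s \<omega>)"
    by (rule distr_cong) simp_all
  ultimately show ?thesis by simp
qed

abbreviation "G \<equiv> gauss_mean g"

lemma g_integrable: "integrable std_normal (\<lambda>z. g (x + c * z))"
proof -
  interpret N: prob_space std_normal by (rule prob_std_normal)
  show ?thesis by (rule N.integrable_const_bound[of _ 1]) (use g_unit in \<open>auto simp: abs_le_iff intro: order_trans[of _ 0]\<close>)
qed

lemma G_mono: "mono (G s)"
  unfolding gauss_mean_def by (intro monoI integral_mono g_integrable) (auto intro: monoD[OF g_mono])

lemma G_borel [measurable]: "G s \<in> borel_measurable borel"
  by (rule borel_measurable_mono[OF G_mono])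

lemma G_unit: "0 \<le> G s x" "G s x \<le> 1"
proof -
  interpret N: prob_space std_normal by (rule prob_std_normal)
  show "0 \<le> G s x" unfolding gauss_mean_def by (intro Bochner_Integration.integral_nonneg) (simp add: g_unit)
  have "G s x \<le> (\<integral>z. 1 \<partial>std_normal)" unfolding gauss_mean_def using g_unit by (intro integral_mono g_integrable) auto
  then show "G s x \<le> 1" using N.prob_space by simp
qed

lemma G_1: "G 1 x = g x"
proof -
  interpret N: prob_space std_normal by (rule prob_std_normal)
  show ?thesis using N.prob_space by (simp add: gauss_mean_def)
qed

lemma G_nn: "(\<integral>\<^sup>+d. ennreal (g (x + d)) \<partial>distr std_normal borel (\<lambda>z. sqrt (1 - s) * z)) = ennreal (G s x)"
  unfolding gauss_mean_def using g_unit
  by (subst nn_integral_distr) (auto intro!: nn_integral_eq_integral g_integrable)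

text \<open>The Markov property on cylinder sets. With the times sorted, \<open>B\<close> at these
  times is a sum of increments, and the last increment \<open>B 1 - B s\<close> is independent of
  them; integrating it out turns \<open>g (B 1)\<close> into \<open>G s (B s)\<close>.\<close>

lemma cylinder_identity:
  assumes s: "0 \<le> s" "s < 1" and R: "finite R" "R \<subseteq> {0..s}" and A: "\<And>r. r \<in> R \<Longrightarrow> A r \<in> sets borel"
  defines "C \<equiv> {\<omega> \<in> space M. \<forall>r\<in>R. B r \<omega> \<in> A r}"
  shows "(\<integral>\<^sup>+\<omega>. ennreal (g (B 1 \<omega>)) * indicator C \<omega> \<partial>M) = (\<integral>\<^sup>+\<omega>. ennreal (G s (B s \<omega>)) * indicator C \<omega> \<partial>M)"
proof -
  define rs where "rs = sorted_list_of_set (insert s R)"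
  define k where "k = length rs"
  \<comment> \<open>The final time 1 follows the sorted times, so that increment number \<open>k\<close> is \<open>B 1 - B s\<close>.\<close>
  define \<tau> where "\<tau> i = (if i = 0 then 0 else if i \<le> k then rs ! (i - 1) else 1)" for i :: nat
  define \<Delta> where "\<Delta> i \<omega> = B (\<tau> (Suc i)) \<omega> - B (\<tau> i) \<omega>" for i \<omega>
  have srt: "sorted rs" and set_rs: "set rs = insert s R"
    using R by (simp_all only: rs_def sorted_sorted_list_of_set set_sorted_list_of_set finite_insert)
  have k: "0 < k" using set_rs by (auto simp: k_def)
  have rs_bd: "0 \<le> rs ! i" "rs ! i \<le> s" if "i < k" for i
  proof -
    have "rs ! i \<in> insert s R" using that set_rs nth_mem by (force simp: k_def)
    then show "0 \<le> rs ! i" "rs ! i \<le> s" using R s by auto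
  qed
  have last: "rs ! (k - 1) = s"
  proof -
    obtain j where j: "j < k" "rs ! j = s" using set_rs by (metis in_set_conv_nth insertI1 k_def)
    have "rs ! j \<le> rs ! (k - 1)" using srt j k by (intro sorted_nth_mono) (auto simp: k_def)
    then show ?thesis using rs_bd[of "k - 1"] k j by simp
  qed
  have \<tau>_nonneg: "0 \<le> \<tau> i" for i using rs_bd[of "i - 1"] k by (auto simp: \<tau>_def)
  have mono: "mono \<tau>"
  proof (rule monoI)
    fix i j :: nat assume ij: "i \<le> j"
    consider "i = 0" | "0 < i" "j \<le> k" | "0 < i" "k < j" by linarith
    then show "\<tau> i \<le> \<tau> j"
    proof cases
      case 1
      then show ?thesis using \<tau>_nonneg by (simp add: \<tau>_def)
    next
      case 2
      then show ?thesis using ij srt by (auto simp: \<tau>_def k_def intro!: sorted_nth_mono)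
    next
      case 3
      have "rs ! (i - 1) \<le> s" if "i \<le> k" using that 3 by (intro rs_bd) auto
      then show ?thesis using 3 s by (auto simp: \<tau>_def)
    qed
  qed
  have [measurable]: "\<Delta> i \<in> borel_measurable M" for i
    unfolding \<Delta>_def using \<tau>_nonneg by measurable
  have ind: "indep_vars (\<lambda>_. borel) \<Delta> {..<Suc k}"
    using bm mono \<tau>_nonneg unfolding brownian_motion_def \<Delta>_def[abs_def] by blast
  define U where "U \<omega> = restrict (\<lambda>i. \<Delta> i \<omega>) {..<k}" for \<omega>
  define pos where "pos j u = (\<Sum>i<Suc j. u i)" for j and u :: "nat \<Rightarrow> real"
  define E where "E = {u \<in> space (\<Pi>\<^sub>M i\<in>{..<k}. (borel :: real measure)). \<forall>j\<in>{j. j < k \<and> rs ! j \<in> R}. pos j u \<in> A (rs ! j)}"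
  define F where "F = (\<lambda>(u, v :: nat \<Rightarrow> real). ennreal (g (pos (k - 1) u + v k)) * indicator E u)"
  define D where "D \<omega> = restrict (\<lambda>i. \<Delta> i \<omega>) {k}" for \<omega>
  have pos_meas [measurable]: "j < k \<Longrightarrow> pos j \<in> borel_measurable (\<Pi>\<^sub>M i\<in>{..<k}. borel)" for j
    unfolding pos_def by (intro borel_measurable_sum measurable_component_singleton) auto
  have E_meas [measurable]: "E \<in> sets (\<Pi>\<^sub>M i\<in>{..<k}. borel)"
    unfolding E_def
  proof (rule sets.sets_Collect_finite_All)
    fix j assume j: "j \<in> {j. j < k \<and> rs ! j \<in> R}"
    then have [measurable]: "A (rs ! j) \<in> sets borel" "pos j \<in> borel_measurable (\<Pi>\<^sub>M i\<in>{..<k}. borel)"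
      using A pos_meas by auto
    show "{u \<in> space (\<Pi>\<^sub>M i\<in>{..<k}. borel). pos j u \<in> A (rs ! j)} \<in> sets (\<Pi>\<^sub>M i\<in>{..<k}. borel)"
      by measurable
  qed simp
  have km: "k - 1 < k" using k by simp
  note [measurable] = pos_meas[OF km]
  have vk: "(\<lambda>v. v k) \<in> borel_measurable (\<Pi>\<^sub>M i\<in>{k}. (borel :: real measure))"
    by (rule measurable_component_singleton) simp
  have F_meas [measurable]: "F \<in> borel_measurable ((\<Pi>\<^sub>M i\<in>{..<k}. borel) \<Otimes>\<^sub>M (\<Pi>\<^sub>M i\<in>{k}. borel))"
  proof -
    note [measurable] = vk
    show ?thesis unfolding F_def by measurable
  qed
  have indUD: "indep_var (\<Pi>\<^sub>M i\<in>{..<k}. borel) U (\<Pi>\<^sub>M i\<in>{k}. borel) D"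
    unfolding U_def[abs_def] D_def[abs_def] by (rule indep_var_restrict[OF ind]) auto
  have tele: "AE \<omega> in M. \<forall>j<k. pos j (U \<omega>) = B (rs ! j) \<omega>"
    using B_0
  proof eventually_elim
    case (elim \<omega>)
    show ?case
    proof (intro allI impI)
      fix j assume j: "j < k"
      have "pos j (U \<omega>) = (\<Sum>i<Suc j. B (\<tau> (Suc i)) \<omega> - B (\<tau> i) \<omega>)"
        unfolding pos_def U_def using j by (intro sum.cong) (auto simp: \<Delta>_def)
      also have "\<dots> = B (\<tau> (Suc j)) \<omega> - B (\<tau> 0) \<omega>" by (rule sum_lessThan_telescope)
      also have "\<dots> = B (rs ! j) \<omega>" using j elim by (simp add: \<tau>_def)
      finally show "pos j (U \<omega>) = B (rs ! j) \<omega>" .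
    qed
  qed
  have EC: "indicator E (U \<omega>) = (indicator C \<omega> :: ennreal)"
    if "\<omega> \<in> space M" "\<forall>j<k. pos j (U \<omega>) = B (rs ! j) \<omega>" for \<omega>
  proof -
    have "U \<omega> \<in> space (\<Pi>\<^sub>M i\<in>{..<k}. borel)" by (auto simp: U_def space_PiM)
    then have "U \<omega> \<in> E \<longleftrightarrow> (\<forall>j<k. rs ! j \<in> R \<longrightarrow> B (rs ! j) \<omega> \<in> A (rs ! j))"
      using that by (auto simp: E_def)
    also have "\<dots> \<longleftrightarrow> (\<forall>r\<in>R. B r \<omega> \<in> A r)"
      using set_rs by (metis in_set_conv_nth insertCI k_def)
    finally show ?thesis using that by (simp add: C_def indicator_def)
  qed
  have \<Delta>k: "\<Delta> k \<omega> = B 1 \<omega> - B s \<omega>" for \<omega>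
    using k last by (simp add: \<Delta>_def \<tau>_def)
  have "(\<integral>\<^sup>+\<omega>. ennreal (g (B 1 \<omega>)) * indicator C \<omega> \<partial>M) = (\<integral>\<^sup>+\<omega>. F (U \<omega>, D \<omega>) \<partial>M)"
  proof (rule nn_integral_cong_AE)
    show "AE \<omega> in M. ennreal (g (B 1 \<omega>)) * indicator C \<omega> = F (U \<omega>, D \<omega>)"
      using tele AE_space by eventually_elim (use last k in \<open>simp add: F_def D_def EC \<Delta>k\<close>)
  qed
  also have "\<dots> = (\<integral>\<^sup>+\<omega>. (\<integral>\<^sup>+\<omega>'. F (U \<omega>, D \<omega>') \<partial>M) \<partial>M)"
    by (rule indep_var_nn_integral[OF indUD F_meas])
  also have "\<dots> = (\<integral>\<^sup>+\<omega>. ennreal (G s (pos (k - 1) (U \<omega>))) * indicator E (U \<omega>) \<partial>M)"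
  proof (rule nn_integral_cong)
    fix \<omega>
    have law_int: "(\<integral>\<^sup>+d. ennreal (g (c + d)) \<partial>distr M borel (\<Delta> k)) = (\<integral>\<^sup>+\<omega>'. ennreal (g (c + \<Delta> k \<omega>')) \<partial>M)" for c
      by (rule nn_integral_distr) measurable
    have multc: "(\<integral>\<^sup>+\<omega>'. ennreal (g (c + \<Delta> k \<omega>')) * i \<partial>M) = (\<integral>\<^sup>+\<omega>'. ennreal (g (c + \<Delta> k \<omega>')) \<partial>M) * i" for c i
      by (rule nn_integral_multc) measurable
    have F_eq: "F (U \<omega>, D \<omega>') = ennreal (g (pos (k - 1) (U \<omega>) + \<Delta> k \<omega>')) * indicator E (U \<omega>)" for \<omega>'
      by (simp add: F_def D_def)
    have "distr M borel (\<Delta> k) = distr std_normal borel (\<lambda>z. sqrt (1 - s) * z)"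
      using increment_law[OF s] by (simp add: \<Delta>k[abs_def])
    then have "(\<integral>\<^sup>+\<omega>'. ennreal (g (pos (k - 1) (U \<omega>) + \<Delta> k \<omega>')) \<partial>M) = ennreal (G s (pos (k - 1) (U \<omega>)))"
      using G_nn[where x = "pos (k - 1) (U \<omega>)" and s = s] law_int[of "pos (k - 1) (U \<omega>)"] by simp
    then show "(\<integral>\<^sup>+\<omega>'. F (U \<omega>, D \<omega>') \<partial>M) = ennreal (G s (pos (k - 1) (U \<omega>))) * indicator E (U \<omega>)"
      by (simp only: F_eq multc)
  qed
  also have "\<dots> = (\<integral>\<^sup>+\<omega>. ennreal (G s (B s \<omega>)) * indicator C \<omega> \<partial>M)"
  proof (rule nn_integral_cong_AE)
    show "AE \<omega> in M. ennreal (G s (pos (k - 1) (U \<omega>))) * indicator E (U \<omega>) = ennreal (G s (B s \<omega>)) * indicator C \<omega>"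
      using tele AE_space by eventually_elim (use last k in \<open>simp add: EC\<close>)
  qed
  finally show ?thesis .
qed

abbreviation "\<F> \<equiv> natural_filtration M B"

lemma space_F [simp]: "space (\<F> t) = space M"
  by (simp add: natural_filtration_def space_measure_of_conv)

lemma vimage_sets: "sets (vimage_algebra (space M) (B r) borel) = {B r -` A \<inter> space M | A. A \<in> sets borel}"
  by (simp add: sets_vimage_algebra2)

lemma sets_F: "sets (\<F> t) = sigma_sets (space M) (\<Union>r\<in>{0..t}. sets (vimage_algebra (space M) (B r) borel))"
  unfolding natural_filtration_def by (rule sets_measure_of) (auto simp: vimage_sets)

lemma subalgebra_F: "subalgebra M (\<F> t)"
  unfolding subalgebra_def
proof
  show "sets (\<F> t) \<subseteq> sets M"
    unfolding sets_F
    by (rule sets.sigma_sets_subset) (auto simp: vimage_sets intro!: measurable_sets[OF B_meas])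
qed simp

lemma B_F_meas: "0 \<le> t \<Longrightarrow> B t \<in> borel_measurable (\<F> t)"
  by (rule measurableI) (auto simp: sets_F vimage_sets intro!: sigma_sets.Basic bexI[of _ t] exI)

text \<open>Cylinder sets are stable under intersection and generate the filtration.\<close>

lemma filtration_identity_nn:
  assumes s: "0 \<le> s" "s \<le> 1" and A: "A \<in> sets (\<F> s)"
  shows "(\<integral>\<^sup>+\<omega>. ennreal (g (B 1 \<omega>)) * indicator A \<omega> \<partial>M) = (\<integral>\<^sup>+\<omega>. ennreal (G s (B s \<omega>)) * indicator A \<omega> \<partial>M)"
proof (cases "s = 1")
  case True
  then show ?thesis by (simp add: G_1)
next
  case False
  then have s: "0 \<le> s" "s < 1" using s by auto
  define P where "P = {{\<omega> \<in> space M. \<forall>r\<in>R. B r \<omega> \<in> A r} | R A. finite R \<and> R \<subseteq> {0..s} \<and> (\<forall>r\<in>R. A r \<in> sets (borel :: real measure))}"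
  define \<mu>1 where "\<mu>1 = density M (\<lambda>\<omega>. ennreal (g (B 1 \<omega>)))"
  define \<mu>2 where "\<mu>2 = density M (\<lambda>\<omega>. ennreal (G s (B s \<omega>)))"
  have [measurable]: "B 1 \<in> borel_measurable M" "B s \<in> borel_measurable M" using s by auto
  have em: "emeasure \<mu>1 X = (\<integral>\<^sup>+\<omega>. ennreal (g (B 1 \<omega>)) * indicator X \<omega> \<partial>M)"
    "emeasure \<mu>2 X = (\<integral>\<^sup>+\<omega>. ennreal (G s (B s \<omega>)) * indicator X \<omega> \<partial>M)" if "X \<in> sets M" for X
    using that by (auto simp: \<mu>1_def \<mu>2_def emeasure_density)
  have P_sub: "P \<subseteq> Pow (space M)" by (auto simp: P_def)
  have P_eq: "emeasure \<mu>1 C = emeasure \<mu>2 C" "C \<in> sets M" if "C \<in> P" for C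
  proof -
    obtain R A where C: "C = {\<omega> \<in> space M. \<forall>r\<in>R. B r \<omega> \<in> A r}" "finite R" "R \<subseteq> {0..s}" "\<And>r. r \<in> R \<Longrightarrow> A r \<in> sets borel"
      using \<open>C \<in> P\<close> by (auto simp: P_def)
    show CM: "C \<in> sets M"
      unfolding C(1)
    proof (rule sets.sets_Collect_finite_All)
      fix r assume r: "r \<in> R"
      then have [measurable]: "A r \<in> sets borel" "B r \<in> borel_measurable M" using C(3,4) by auto
      show "{\<omega> \<in> space M. B r \<omega> \<in> A r} \<in> sets M" by measurable
    qed (rule C(2))
    show "emeasure \<mu>1 C = emeasure \<mu>2 C"
      using cylinder_identity[OF s C(2,3), of A, OF C(4)] unfolding em[OF CM] by (simp only: C(1)[symmetric])
  qed
  have Int: "Int_stable P"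
  proof (rule Int_stableI)
    fix C1 C2 assume "C1 \<in> P" "C2 \<in> P"
    then obtain R1 A1 R2 A2 where
      1: "C1 = {\<omega> \<in> space M. \<forall>r\<in>R1. B r \<omega> \<in> A1 r}" "finite R1" "R1 \<subseteq> {0..s}" "\<And>r. r \<in> R1 \<Longrightarrow> A1 r \<in> sets borel" and
      2: "C2 = {\<omega> \<in> space M. \<forall>r\<in>R2. B r \<omega> \<in> A2 r}" "finite R2" "R2 \<subseteq> {0..s}" "\<And>r. r \<in> R2 \<Longrightarrow> A2 r \<in> sets borel"
      unfolding P_def by blast
    define A where "A r = (if r \<in> R1 then A1 r else UNIV) \<inter> (if r \<in> R2 then A2 r else UNIV)" for r
    have "C1 \<inter> C2 = {\<omega> \<in> space M. \<forall>r\<in>R1 \<union> R2. B r \<omega> \<in> A r}"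
      unfolding 1(1) 2(1) A_def by auto
    moreover have "\<forall>r\<in>R1 \<union> R2. A r \<in> sets borel" using 1(4) 2(4) by (auto simp: A_def)
    ultimately show "C1 \<inter> C2 \<in> P"
      unfolding P_def using 1(2,3) 2(2,3) by (intro CollectI exI[of _ "R1 \<union> R2"] exI[of _ A]) simp
  qed
  have gen: "A \<in> sigma_sets (space M) P"
  proof -
    have "(\<Union>r\<in>{0..s}. sets (vimage_algebra (space M) (B r) borel)) \<subseteq> P"
    proof (safe)
      fix r X assume r: "r \<in> {0..s}" "X \<in> sets (vimage_algebra (space M) (B r) borel)"
      then obtain D where "X = B r -` D \<inter> space M" "D \<in> sets borel" by (auto simp: vimage_sets)
      then show "X \<in> P" using r unfolding P_def
        by (intro CollectI exI[of _ "{r}"] exI[of _ "\<lambda>_. D"]) auto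
    qed
    then show ?thesis using A unfolding sets_F by (meson sigma_sets_mono' subsetD)
  qed
  have fin: "emeasure \<mu>1 (space M) = emeasure \<mu>2 (space M)" "emeasure \<mu>1 (space M) \<noteq> \<infinity>"
  proof -
    have "space M \<in> P" unfolding P_def by (intro CollectI exI[of _ "{}"]) auto
    then show "emeasure \<mu>1 (space M) = emeasure \<mu>2 (space M)" by (rule P_eq)
    have "emeasure \<mu>1 (space M) \<le> (\<integral>\<^sup>+\<omega>. 1 \<partial>M)"
      unfolding em(1)[OF sets.top] using g_unit
      by (intro nn_integral_mono) (auto simp: indicator_def ennreal_le_1)
    then show "emeasure \<mu>1 (space M) \<noteq> \<infinity>" by (auto simp: emeasure_space_1 top_unique)
  qed
  have sub: "sigma_sets (space M) P \<subseteq> sets M"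
    by (rule sets.sigma_sets_subset) (use P_eq in auto)
  have "emeasure \<mu>1 A = emeasure \<mu>2 A"
    using Int P_sub gen
  proof (induction rule: sigma_sets_induct_disjoint)
    case (basic A)
    then show ?case by (rule P_eq)
  next
    case empty
    then show ?case by simp
  next
    case (compl A)
    have Am: "A \<in> sets M" using compl sub by auto
    have "emeasure \<mu>1 A \<le> emeasure \<mu>1 (space M)" using sets.sets_into_space[OF Am]
      by (intro emeasure_mono) (auto simp: \<mu>1_def)
    then have f: "emeasure \<mu>1 A \<noteq> \<infinity>" "emeasure \<mu>2 A \<noteq> \<infinity>" using fin compl by (auto simp: top_unique)
    have "emeasure \<mu>1 (space \<mu>1 - A) = emeasure \<mu>2 (space \<mu>2 - A)"
      using f Am fin compl by (subst (1 2) emeasure_compl) (auto simp: \<mu>1_def \<mu>2_def)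
    then show ?case by (simp add: \<mu>1_def \<mu>2_def)
  next
    case (union A)
    then have "range A \<subseteq> sets M" using sub by auto
    then show ?case using union(3) suminf_emeasure[OF _ union(1), of \<mu>1] suminf_emeasure[OF _ union(1), of \<mu>2]
      by (simp add: \<mu>1_def \<mu>2_def)
  qed
  moreover have "A \<in> sets M" using gen sub by auto
  ultimately show ?thesis by (simp add: em)
qed

lemma integrable_gB: "0 \<le> t \<Longrightarrow> integrable M (\<lambda>\<omega>. g (B t \<omega>))"
  by (rule integrable_const_bound[of _ 1]) (use g_unit in auto)

lemma integrable_GB: "0 \<le> t \<Longrightarrow> integrable M (\<lambda>\<omega>. G s (B t \<omega>))"
  by (rule integrable_const_bound[of _ 1]) (use G_unit in auto)

lemma filtration_identity:
  assumes s: "0 \<le> s" "s \<le> 1" and A: "A \<in> sets (\<F> s)"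
  shows "(\<integral>\<omega>\<in>A. g (B 1 \<omega>) \<partial>M) = (\<integral>\<omega>\<in>A. G s (B s \<omega>) \<partial>M)"
proof -
  have [measurable]: "B 1 \<in> borel_measurable M" "B s \<in> borel_measurable M" using s by auto
  have [measurable]: "A \<in> sets M" using A subalgebra_F by (auto simp: subalgebra_def)
  have "(\<integral>\<omega>\<in>A. g (B 1 \<omega>) \<partial>M) = enn2real (\<integral>\<^sup>+\<omega>. ennreal (g (B 1 \<omega>)) * indicator A \<omega> \<partial>M)"
    unfolding set_lebesgue_integral_def using g_unit
    by (subst integral_eq_nn_integral) (auto intro!: arg_cong[where f=enn2real] nn_integral_cong simp: indicator_def)
  also have "\<dots> = enn2real (\<integral>\<^sup>+\<omega>. ennreal (G s (B s \<omega>)) * indicator A \<omega> \<partial>M)"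
    by (simp only: filtration_identity_nn[OF s A])
  also have "\<dots> = (\<integral>\<omega>\<in>A. G s (B s \<omega>) \<partial>M)"
    unfolding set_lebesgue_integral_def using G_unit
    by (subst integral_eq_nn_integral) (auto intro!: arg_cong[where f=enn2real] nn_integral_cong simp: indicator_def)
  finally show ?thesis .
qed

lemma sigma_finite_sub: "subalgebra M N \<Longrightarrow> sigma_finite_subalgebra M N"
  by (intro finite_measure_subalgebra_is_sigma_finite finite_measure_subalgebra.intro finite_measure_axioms
    finite_measure_subalgebra_axioms.intro)

lemma vimage_sub_F: "0 \<le> t \<Longrightarrow> sets (vimage_algebra (space M) (B t) borel) \<subseteq> sets (\<F> t)"
  unfolding sets_F by (auto intro!: sigma_sets.Basic)

lemma cond_exp_given_B:
  assumes "0 \<le> t" "t \<le> 1"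
  shows "AE \<omega> in M. cond_exp_on M (B t) (\<lambda>\<omega>. g (B 1 \<omega>)) \<omega> = G t (B t \<omega>)"
  unfolding cond_exp_on_def
proof -
  let ?V = "vimage_algebra (space M) (B t) borel"
  have sub: "subalgebra M ?V"
    using vimage_sub_F[OF assms(1)] subalgebra_F[of t] by (auto simp: subalgebra_def)
  interpret S: sigma_finite_subalgebra M ?V by (rule sigma_finite_sub[OF sub])
  have "B t \<in> measurable ?V borel" by (rule measurable_vimage_algebra1) auto
  then have "(\<lambda>\<omega>. G t (B t \<omega>)) \<in> borel_measurable ?V" by measurable
  then show "AE \<omega> in M. real_cond_exp M ?V (\<lambda>\<omega>. g (B 1 \<omega>)) \<omega> = G t (B t \<omega>)"
    using vimage_sub_F[OF assms(1)] assms
    by (intro S.real_cond_exp_charact filtration_identity integrable_gB integrable_GB) auto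
qed

text \<open>Over an event of time \<open>s\<close>, both \<open>G t (B t)\<close> and \<open>G s
  (B s)\<close> integrate like \<open>g (B 1)\<close>.\<close>

lemma martingale_G: "martingale_on {0..1} M \<F> (\<lambda>t \<omega>. G t (B t \<omega>))"
  unfolding martingale_on_def
proof (intro conjI ballI impI)
  fix t :: real assume t: "t \<in> {0..1}"
  have [measurable]: "B t \<in> borel_measurable (\<F> t)" using t by (intro B_F_meas) auto
  show "(\<lambda>\<omega>. G t (B t \<omega>)) \<in> borel_measurable (\<F> t)" by measurable
  show "integrable M (\<lambda>\<omega>. G t (B t \<omega>))" using t by (intro integrable_GB) auto
next
  fix s t :: real assume st: "s \<in> {0..1}" "t \<in> {0..1}" "s \<le> t"
  interpret S: sigma_finite_subalgebra M "\<F> s" by (rule sigma_finite_sub[OF subalgebra_F])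
  have [measurable]: "B s \<in> borel_measurable (\<F> s)" using st by (intro B_F_meas) auto
  show "AE \<omega> in M. real_cond_exp M (\<F> s) (\<lambda>\<omega>. G t (B t \<omega>)) \<omega> = G s (B s \<omega>)"
  proof (rule S.real_cond_exp_charact)
    fix A assume A: "A \<in> sets (\<F> s)"
    have "sets (\<F> s) \<subseteq> sets (\<F> t)"
      unfolding sets_F using st by (intro sigma_sets_mono' UN_mono) auto
    then have "(\<integral>\<omega>\<in>A. G t (B t \<omega>) \<partial>M) = (\<integral>\<omega>\<in>A. g (B 1 \<omega>) \<partial>M)"
      using A st by (intro filtration_identity[symmetric]) auto
    also have "\<dots> = (\<integral>\<omega>\<in>A. G s (B s \<omega>) \<partial>M)" using A st by (intro filtration_identity) auto
    finally show "(\<integral>\<omega>\<in>A. G t (B t \<omega>) \<partial>M) = (\<integral>\<omega>\<in>A. G s (B s \<omega>) \<partial>M)" .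
  qed (use st in \<open>auto intro: integrable_GB\<close>)
qed

lemma cmmv_cond_exp: "cmmv M (\<lambda>t. cond_exp_on M (B t) (\<lambda>\<omega>. g (B 1 \<omega>)))"
  unfolding cmmv_def
  by (intro exI[of _ B] exI[of _ "\<lambda>x t. G t x"] conjI ballI bm G_mono martingale_G cond_exp_given_B) auto

end

section \<open>Structure of the equilibria of the finite game\<close>

locale game = prior \<mu> + risk H for \<mu> :: "real measure" and H :: "real \<Rightarrow> real" +
  fixes n :: nat and Q :: "(real list \<times> real) measure" and X :: "real list \<Rightarrow> real"
  assumes n: "1 \<le> n" and nash: "nash_equilibrium n \<mu> H Q X"
begin

abbreviation "S \<equiv> S_sum n"

lemma Q_prob: "prob_space Q" and sets_Q [measurable_cong]: "sets Q = sets (count_space (states n) \<Otimes>\<^sub>M borel)"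
  and distr_Q: "distr Q borel snd = \<mu>"
  using nash by (auto simp: nash_equilibrium_def strategies1_def)

interpretation Q: prob_space Q by (rule Q_prob)

lemma space_Q: "space Q = states n \<times> UNIV"
  using sets_eq_imp_space_eq[OF sets_Q] by (simp add: space_pair_measure)

lemma X_mean: "avg n X = 0"
  using nash avg_payoff by (auto simp: nash_equilibrium_def strategies2_def)

lemma AE_Q_unit: "AE z in Q. 0 < snd z \<and> snd z < 1"
proof -
  have "AE l in distr Q borel snd. 0 < l \<and> l < 1" using AE_unit by (simp only: distr_Q)
  then show ?thesis by (subst (asm) AE_distr_iff) auto
qed

lemma integral_Q_snd: "f \<in> borel_measurable borel \<Longrightarrow> (\<integral>z. f (snd z) \<partial>Q) = (\<integral>l. f l \<partial>\<mu>)" for f :: "real \<Rightarrow> real"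
proof -
  assume [measurable]: "f \<in> borel_measurable borel"
  have "(\<integral>l. f l \<partial>distr Q borel snd) = (\<integral>z. f (snd z) \<partial>Q)" by (rule integral_distr) measurable
  then show ?thesis by (simp only: distr_Q)
qed

lemma integrable_Q_snd: "integrable \<mu> f \<Longrightarrow> integrable Q (\<lambda>z. f (snd z))" for f :: "real \<Rightarrow> real"
proof -
  assume "integrable \<mu> f"
  then have "integrable (distr Q borel snd) f" by (simp only: distr_Q)
  then show ?thesis by (rule integrable_distr[rotated]) measurable
qed

lemma fst_fun_meas [measurable]: "(\<lambda>z. F (fst z)) \<in> borel_measurable Q" for F :: "real list \<Rightarrow> real"
  by (rule measurable_compose[of fst Q "count_space (states n)"]) measurable

lemma states_ne: "states n \<noteq> {}"
  using card_states[of n] by auto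

definition bound where "bound F = Max ((\<lambda>\<omega>. \<bar>F \<omega>\<bar>) ` states n)" for F :: "real list \<Rightarrow> real"

lemma bound: "\<omega> \<in> states n \<Longrightarrow> \<bar>F \<omega>\<bar> \<le> bound F"
  by (simp add: bound_def finite_states)

lemma payoff_bound:
  assumes "\<omega> \<in> states n" "0 \<le> l" "l \<le> 1"
  shows "\<bar>l * S \<omega> - Y \<omega>\<bar> \<le> bound S + bound Y"
proof -
  have "\<bar>l * S \<omega>\<bar> \<le> 1 * bound S"
    unfolding abs_mult using assms bound[OF assms(1), of S] by (intro mult_mono) auto
  then show ?thesis using bound[OF assms(1), of Y] by linarith
qed

text \<open>States are finitely many and types lie in \<open>[0,1]\<close>, so payoffs are
  bounded; the hypothesis on \<open>F\<close> holds for monotone functions.\<close>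

lemma integrable_payoff:
  fixes F :: "real \<Rightarrow> real"
  assumes F: "\<And>c x. \<bar>x\<bar> \<le> c \<Longrightarrow> \<bar>F x\<bar> \<le> max \<bar>F c\<bar> \<bar>F (- c)\<bar>" and [measurable]: "F \<in> borel_measurable borel"
  shows "integrable Q (\<lambda>z. F (snd z * S (fst z) - Y (fst z)))"
proof (rule Q.integrable_const_bound)
  let ?c = "bound S + bound Y"
  show "AE z in Q. norm (F (snd z * S (fst z) - Y (fst z))) \<le> max \<bar>F ?c\<bar> \<bar>F (- ?c)\<bar>"
    using AE_Q_unit AE_space
  proof eventually_elim
    case (elim z)
    then have "\<bar>snd z * S (fst z) - Y (fst z)\<bar> \<le> ?c"
      by (intro payoff_bound) (auto simp: space_Q)
    then have "\<bar>F (snd z * S (fst z) - Y (fst z))\<bar> \<le> max \<bar>F ?c\<bar> \<bar>F (- ?c)\<bar>" by (rule F)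
    then show ?case by simp
  qed
qed measurable

lemma H_bounded: "\<bar>x\<bar> \<le> c \<Longrightarrow> \<bar>H x\<bar> \<le> max \<bar>H c\<bar> \<bar>H (- c)\<bar>"
  using H_le[of x c] H_le[of "- c" x] by (simp add: abs_le_iff) linarith

lemmas integrable_H_payoff = integrable_payoff[OF H_bounded H_borel]

lemma integrable_lin_payoff: "integrable Q (\<lambda>z. snd z * S (fst z) - Y (fst z))"
  by (rule integrable_payoff[of "\<lambda>x. x"]) auto

text \<open>The conjugate of \<open>X\<close>: what type \<open>l\<close> obtains from a best
  reply.\<close>

definition hn where "hn l = Max ((\<lambda>\<omega>. l * S \<omega> - X \<omega>) ` states n)"

lemma le_hn: "\<omega> \<in> states n \<Longrightarrow> l * S \<omega> - X \<omega> \<le> hn l"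
  by (simp add: hn_def finite_states)

lemma hn_attained: "\<exists>\<omega>\<in>states n. l * S \<omega> - X \<omega> = hn l"
proof -
  have "hn l \<in> (\<lambda>\<omega>. l * S \<omega> - X \<omega>) ` states n"
    unfolding hn_def by (rule Max_in) (use finite_states states_ne in auto)
  then show ?thesis by force
qed

lemma hn_borel [measurable]: "hn \<in> borel_measurable borel"
  unfolding hn_def[abs_def] by (rule borel_measurable_Max) (auto simp: finite_states)

lemma hn_bound: "0 \<le> l \<Longrightarrow> l \<le> 1 \<Longrightarrow> \<bar>hn l\<bar> \<le> bound S + bound X"
  using hn_attained[of l] payoff_bound[of _ l X] by force

lemma integrable_hn: "integrable \<mu> hn"
  by (rule integrable_const_bound[of _ "bound S + bound X"], rule AE_mp[OF AE_unit])
    (auto intro!: AE_I2 hn_bound)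

lemma integrable_H_hn: "integrable \<mu> (\<lambda>l. H (hn l + c))"
proof (rule integrable_const_bound)
  let ?c = "bound S + bound X + \<bar>c\<bar>"
  show "AE l in \<mu>. norm (H (hn l + c)) \<le> max \<bar>H ?c\<bar> \<bar>H (- ?c)\<bar>"
    using AE_unit
  proof eventually_elim
    case (elim l)
    then have "\<bar>hn l + c\<bar> \<le> ?c" using hn_bound[of l] by linarith
    then show ?case using H_bounded[of "hn l + c" ?c] by simp
  qed
qed measurable

text \<open>A measurable selection of best replies is a strategy with the prescribed marginal, so
  an optimal \<open>Q\<close> cannot fall short of the conjugate on a set of positive
  measure.\<close>

lemma best_reply_1: "AE z in Q. snd z * S (fst z) - X (fst z) = hn (snd z)"
proof -
  obtain xs where xs: "set xs = states n" using finite_list[OF finite_states] by blast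
  define e where "e i = xs ! (i mod length xs)" for i
  have len: "0 < length xs" using xs states_ne by auto
  have e: "e i \<in> states n" for i using len xs nth_mem[of "i mod length xs" xs] by (simp add: e_def)
  have e_surj: "\<exists>i. e i = \<omega>" if "\<omega> \<in> states n" for \<omega>
    using that xs by (metis e_def in_set_conv_nth mod_less)
  define sel where "sel l = e (LEAST i. l * S (e i) - X (e i) = hn l)" for l
  have sel: "l * S (sel l) - X (sel l) = hn l" for l
  proof -
    have "\<exists>i. l * S (e i) - X (e i) = hn l" using hn_attained[of l] e_surj by metis
    then show ?thesis unfolding sel_def by (rule LeastI_ex)
  qed
  have sel_meas [measurable]: "sel \<in> measurable borel (count_space (states n))"
    unfolding sel_def[abs_def]
  proof (rule measurable_compose[of "\<lambda>l. LEAST i. l * S (e i) - X (e i) = hn l" borel "count_space UNIV" e])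
    show "e \<in> measurable (count_space UNIV) (count_space (states n))" using e by auto
    show "(\<lambda>l. LEAST i. l * S (e i) - X (e i) = hn l) \<in> measurable borel (count_space UNIV)"
    proof (rule measurable_Least)
      fix i
      have "{l \<in> space borel. l * S (e i) - X (e i) = hn l} \<in> sets borel"
        by (rule borel_measurable_eq) measurable
      then show "Measurable.pred borel (\<lambda>l. l * S (e i) - X (e i) = hn l)" by (rule pred_def[THEN iffD2])
    qed
  qed
  define Q' where "Q' = distr \<mu> (count_space (states n) \<Otimes>\<^sub>M borel) (\<lambda>l. (sel l, l))"
  have m [measurable]: "(\<lambda>l. (sel l, l)) \<in> measurable \<mu> (count_space (states n) \<Otimes>\<^sub>M borel)" by measurable
  have "Q' \<in> strategies1 n \<mu>"
    unfolding strategies1_def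
  proof (intro CollectI conjI)
    show "prob_space Q'" unfolding Q'_def by (rule prob_space_distr) simp
    show "distr Q' borel snd = \<mu>"
      unfolding Q'_def by (subst distr_distr) (auto simp: comp_def distr_id2)
  qed (simp add: Q'_def)
  then have "g1 n Q' X \<le> g1 n Q X" using nash by (simp add: nash_equilibrium_def)
  moreover have "g1 n Q' X = (\<integral>l. hn l \<partial>\<mu>)"
  proof -
    have [measurable]: "(\<lambda>z. F (fst z)) \<in> borel_measurable (count_space (states n) \<Otimes>\<^sub>M borel)" for F :: "real list \<Rightarrow> real"
      by (rule measurable_compose[of fst _ "count_space (states n)"]) measurable
    show ?thesis
      unfolding g1_def Q'_def case_prod_unfold by (subst integral_distr) (auto simp: sel)
  qed
  ultimately have "(\<integral>z. hn (snd z) \<partial>Q) \<le> (\<integral>z. snd z * S (fst z) - X (fst z) \<partial>Q)"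
    by (simp add: integral_Q_snd g1_def case_prod_unfold)
  then have "(\<integral>z. hn (snd z) - (snd z * S (fst z) - X (fst z)) \<partial>Q) \<le> 0"
    using integrable_Q_snd[OF integrable_hn] integrable_lin_payoff by simp
  moreover have nn: "AE z in Q. 0 \<le> hn (snd z) - (snd z * S (fst z) - X (fst z))"
    using le_hn by (intro AE_I2) (auto simp: space_Q)
  ultimately have "(\<integral>z. hn (snd z) - (snd z * S (fst z) - X (fst z)) \<partial>Q) = 0"
    using integral_nonneg_AE[OF nn] by linarith
  then have "AE z in Q. hn (snd z) - (snd z * S (fst z) - X (fst z)) = 0"
    using nn integrable_Q_snd[OF integrable_hn] integrable_lin_payoff
    by (subst (asm) integral_nonneg_eq_0_iff_AE) auto
  then show ?thesis by eventually_elim simp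
qed

lemma best_reply_2:
  assumes "avg n Y = 0"
  shows "(\<integral>z. H (snd z * S (fst z) - X (fst z)) \<partial>Q) \<le> (\<integral>z. H (snd z * S (fst z) - Y (fst z)) \<partial>Q)"
proof -
  obtain p where p: "\<And>\<omega>. \<omega> \<in> states n \<Longrightarrow> payoff_of_prices n p \<omega> = Y \<omega>"
    using mean_zero_is_strategy[OF n assms] by blast
  have "g2 n H Q X \<le> g2 n H Q (payoff_of_prices n p)"
    using nash by (simp add: nash_equilibrium_def strategies2_def)
  also have "\<dots> = (\<integral>z. H (snd z * S (fst z) - Y (fst z)) \<partial>Q)"
    unfolding g2_def case_prod_unfold by (intro Bochner_Integration.integral_cong refl) (auto simp: space_Q p)
  finally show ?thesis by (simp add: g2_def case_prod_unfold)
qed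

text \<open>A state of probability zero could be used to finance an improvement: \<open>Y\<close>
  lowers \<open>X\<close> there and raises it by \<open>1\<close> everywhere else, which keeps the
  mean and makes \<open>L S - Y\<close> smaller almost surely.\<close>

lemma full_support:
  assumes w: "\<omega> \<in> states n"
  shows "\<not> (AE z in Q. fst z \<noteq> \<omega>)"
proof
  assume ae: "AE z in Q. fst z \<noteq> \<omega>"
  define Y where "Y \<omega>' = X \<omega>' - (2 ^ n * (if \<omega>' = \<omega> then 1 else 0) - 1)" for \<omega>'
  have "avg n (\<lambda>\<omega>'. if \<omega>' = \<omega> then 1 else 0) = 1 / 2 ^ n"
    using w finite_states by (simp add: avg_def)
  then have "avg n Y = 0"
    unfolding Y_def[abs_def] avg_diff avg_cmult X_mean by simp
  then have "(\<integral>z. H (snd z * S (fst z) - X (fst z)) \<partial>Q) \<le> (\<integral>z. H (snd z * S (fst z) - Y (fst z)) \<partial>Q)"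
    by (rule best_reply_2)
  moreover have "(\<integral>z. H (snd z * S (fst z) - Y (fst z)) \<partial>Q) < (\<integral>z. H (snd z * S (fst z) - X (fst z)) \<partial>Q)"
  proof (rule Q.integral_less_AE_space[OF integrable_H_payoff integrable_H_payoff])
    show "AE z in Q. H (snd z * S (fst z) - Y (fst z)) < H (snd z * S (fst z) - X (fst z))"
      using ae by eventually_elim (auto simp: Y_def intro!: H_less)
    show "emeasure Q (space Q) \<noteq> 0" by (simp add: Q.emeasure_space_1)
  qed
  ultimately show False by simp
qed

lemma every_state_optimal:
  assumes "\<omega> \<in> states n"
  obtains l where "0 < l" "l < 1" "l * S \<omega> - X \<omega> = hn l"
proof -
  have "\<exists>l. 0 < l \<and> l < 1 \<and> l * S \<omega> - X \<omega> = hn l"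
  proof (rule ccontr)
    assume no: "\<not> ?thesis"
    have "AE z in Q. fst z \<noteq> \<omega>"
      using AE_Q_unit best_reply_1 by eventually_elim (use no in auto)
    then show False using full_support[OF assms] by simp
  qed
  then show ?thesis using that by blast
qed

text \<open>The biconjugate of \<open>X\<close>. As a supremum of affine functions with slopes in
  \<open>[0,1]\<close> it is convex and has such slopes itself; it agrees with \<open>X\<close>
  since every state is a best reply for some type.\<close>

definition xh where "xh s = (SUP l\<in>{0..1}. l * s - hn l)"

lemma xh_bdd: "bdd_above ((\<lambda>l. l * s - hn l) ` {0..1})"
proof (rule bdd_aboveI2)
  fix l :: real assume l: "l \<in> {0..1}"
  then have "l * s \<le> l * \<bar>s\<bar>" "l * \<bar>s\<bar> \<le> 1 * \<bar>s\<bar>" by (auto intro!: mult_left_mono mult_left_le_one_le)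
  moreover have "\<bar>hn l\<bar> \<le> bound S + bound X" using l by (intro hn_bound) auto
  ultimately show "l * s - hn l \<le> \<bar>s\<bar> + (bound S + bound X)" by linarith
qed

lemma xh_ge: "0 \<le> l \<Longrightarrow> l \<le> 1 \<Longrightarrow> l * s - hn l \<le> xh s"
  unfolding xh_def by (rule cSUP_upper2[OF xh_bdd]) auto

lemma xh_le: "(\<And>l. 0 \<le> l \<Longrightarrow> l \<le> 1 \<Longrightarrow> l * s - hn l \<le> c) \<Longrightarrow> xh s \<le> c"
  unfolding xh_def by (rule cSUP_least) auto

lemma xh_S: assumes "\<omega> \<in> states n" shows "xh (S \<omega>) = X \<omega>"
proof (rule antisym)
  show "xh (S \<omega>) \<le> X \<omega>" 
  proof (rule xh_le)
    fix l show "l * S \<omega> - hn l \<le> X \<omega>" using le_hn[OF assms, of l] by linarith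
  qed
  obtain l where "0 < l" "l < 1" "l * S \<omega> - X \<omega> = hn l" by (rule every_state_optimal[OF assms])
  then show "X \<omega> \<le> xh (S \<omega>)" using xh_ge[of l "S \<omega>"] by simp
qed

lemma xh_slopes: assumes "a \<le> b" shows "0 \<le> xh b - xh a" "xh b - xh a \<le> b - a"
proof -
  have "xh a \<le> xh b"
  proof (rule xh_le)
    fix l :: real assume l: "0 \<le> l" "l \<le> 1"
    have "l * a \<le> l * b" using assms l by (intro mult_left_mono)
    then show "l * a - hn l \<le> xh b" using xh_ge[OF l, of b] by linarith
  qed
  then show "0 \<le> xh b - xh a" by simp
  have "xh b \<le> xh a + (b - a)"
  proof (rule xh_le)
    fix l :: real assume l: "0 \<le> l" "l \<le> 1"
    have "l * (b - a) \<le> 1 * (b - a)" using assms l by (intro mult_right_mono) auto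
    then show "l * b - hn l \<le> xh a + (b - a)" using xh_ge[OF l, of a] by (simp add: algebra_simps)
  qed
  then show "xh b - xh a \<le> b - a" by simp
qed

lemma xh_convex: "convex_on UNIV xh"
proof (rule convex_onI)
  fix t x y :: real assume t: "0 < t" "t < 1"
  show "xh ((1 - t) *\<^sub>R x + t *\<^sub>R y) \<le> (1 - t) * xh x + t * xh y"
  proof (rule xh_le)
    fix l :: real assume l: "0 \<le> l" "l \<le> 1"
    have "(1 - t) * (l * x - hn l) + t * (l * y - hn l) \<le> (1 - t) * xh x + t * xh y"
      using t xh_ge[OF l] by (intro add_mono mult_left_mono) auto
    then show "l * ((1 - t) *\<^sub>R x + t *\<^sub>R y) - hn l \<le> (1 - t) * xh x + t * xh y"
      by (simp add: algebra_simps)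
  qed
qed simp

lemma xh_mean: "avg n (\<lambda>\<omega>. xh (S \<omega>)) = 0"
  using X_mean xh_S avg_cong[of n "\<lambda>\<omega>. xh (S \<omega>)" X] by simp

text \<open>The zero-sum property. Player 2 cannot gain by switching to \<open>Y\<close>, and
  \<open>H\<close> is increasing, so the cost of \<open>Y\<close> is at most that of any majorant
  \<open>k\<close> of its conjugate.\<close>

lemma value_le:
  assumes "avg n Y = 0" and [measurable]: "k \<in> borel_measurable borel" and int: "integrable \<mu> (\<lambda>l. H (k l))"
    and le: "\<And>l \<omega>. 0 < l \<Longrightarrow> l < 1 \<Longrightarrow> \<omega> \<in> states n \<Longrightarrow> l * S \<omega> - Y \<omega> \<le> k l"
  shows "(\<integral>l. H (hn l) \<partial>\<mu>) \<le> (\<integral>l. H (k l) \<partial>\<mu>)"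
proof -
  have "(\<integral>l. H (hn l) \<partial>\<mu>) = (\<integral>z. H (hn (snd z)) \<partial>Q)"
    by (rule integral_Q_snd[symmetric]) measurable
  also have "\<dots> = (\<integral>z. H (snd z * S (fst z) - X (fst z)) \<partial>Q)"
    by (rule integral_cong_AE) (use best_reply_1 in \<open>auto elim!: eventually_mono\<close>)
  also have "\<dots> \<le> (\<integral>z. H (snd z * S (fst z) - Y (fst z)) \<partial>Q)"
    by (rule best_reply_2) fact
  also have "\<dots> \<le> (\<integral>z. H (k (snd z)) \<partial>Q)"
  proof (rule integral_mono_AE[OF integrable_H_payoff integrable_Q_snd[OF int]])
    show "AE z in Q. H (snd z * S (fst z) - Y (fst z)) \<le> H (k (snd z))"
      using AE_Q_unit AE_space by eventually_elim (auto simp: space_Q intro!: H_le le)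
  qed
  also have "\<dots> = (\<integral>l. H (k l) \<partial>\<mu>)" by (rule integral_Q_snd) measurable
  finally show ?thesis .
qed

end

section \<open>Convergence of the equilibrium potentials\<close>

lemma convex_slopes_mono:
  fixes f :: "real \<Rightarrow> real"
  assumes f: "convex_on UNIV f" and "a < b" "c < d" "a \<le> c" "b \<le> d"
  shows "(f b - f a) / (b - a) \<le> (f d - f c) / (d - c)"
proof -
  have chord: "f y \<le> f x + (f z - f x) / (z - x) * (y - x)" if "x < z" "x \<le> y" "y \<le> z" for x y z
  proof -
    define t where "t = (y - x) / (z - x)"
    have t: "0 \<le> t" "t \<le> 1" using that by (auto simp: t_def divide_le_eq)
    have "t * (z - x) = y - x" using that by (simp add: t_def)
    then have y: "y = (1 - t) * x + t * z" by (simp add: algebra_simps)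
    have "f ((1 - t) *\<^sub>R x + t *\<^sub>R z) \<le> (1 - t) * f x + t * f z"
      by (rule convex_onD[OF f t]) auto
    moreover have "(1 - t) *\<^sub>R x + t *\<^sub>R z = y" using y by simp
    moreover have "(1 - t) * f x + t * f z = f x + t * (f z - f x)" by (simp add: algebra_simps)
    ultimately have "f y \<le> f x + t * (f z - f x)" by simp
    then show ?thesis by (simp add: t_def mult.commute)
  qed
  have "(f b - f a) / (b - a) \<le> (f d - f a) / (d - a)"
    using chord[of a d b] assms by (simp add: divide_le_eq)
  also have "\<dots> \<le> (f d - f c) / (d - c)"
  proof -
    have "(f d - f a) * (d - c) \<le> (f d - f c) * (d - a)"
      using chord[of a d c] assms by (simp add: field_simps)
    then show ?thesis using assms by (simp add: field_simps)
  qed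
  finally show ?thesis .
qed

definition nonexp :: "(real \<Rightarrow> real) \<Rightarrow> bool" where
  "nonexp f \<longleftrightarrow> (\<forall>a b. \<bar>f b - f a\<bar> \<le> \<bar>b - a\<bar>)"

lemma nonexpD: "nonexp f \<Longrightarrow> \<bar>f b - f a\<bar> \<le> \<bar>b - a\<bar>"
  by (auto simp: nonexp_def)

lemma nonexp_borel: assumes "nonexp f" shows "f \<in> borel_measurable borel"
proof (rule borel_measurable_continuous_onI)
  have "1-lipschitz_on UNIV f"
    by (rule lipschitz_onI) (use nonexpD[OF assms] in \<open>auto simp: dist_real_def\<close>)
  then show "continuous_on UNIV f" by (rule lipschitz_on_continuous_on)
qed

context walk_coupling
begin

definition err where "err n = (\<integral>x. \<bar>W n x - Wlim x\<bar> \<partial>\<Omega>)"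

lemma err_tendsto: "err \<longlonglongrightarrow> 0"
  unfolding err_def[abs_def] by (rule W_L1_conv)

lemma nonexp_integrable:
  assumes f: "nonexp f" and V: "integrable \<Omega> V"
  shows "integrable \<Omega> (\<lambda>x. f (V x))"
proof (rule Bochner_Integration.integrable_bound)
  show "integrable \<Omega> (\<lambda>x. \<bar>V x\<bar> + \<bar>f 0\<bar>)" using V by auto
  show "AE x in \<Omega>. norm (f (V x)) \<le> norm (\<bar>V x\<bar> + \<bar>f 0\<bar>)"
  proof (rule AE_I2)
    fix x
    have "\<bar>f (V x)\<bar> \<le> \<bar>V x\<bar> + \<bar>f 0\<bar>" using nonexpD[OF f, of "V x" 0] by arith
    then show "norm (f (V x)) \<le> norm (\<bar>V x\<bar> + \<bar>f 0\<bar>)" by simp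
  qed
  have [measurable]: "V \<in> borel_measurable \<Omega>" using V by auto
  show "(\<lambda>x. f (V x)) \<in> borel_measurable \<Omega>" by (rule measurable_compose[OF _ nonexp_borel[OF f]]) measurable
qed

text \<open>Under the coupling this is the mean of \<open>f (W n) - f Wlim\<close>.\<close>

lemma avg_normal_error:
  assumes f: "nonexp f"
  shows "\<bar>avg n (\<lambda>\<omega>. f (S_sum n \<omega>)) - (\<integral>s. f s \<partial>std_normal)\<bar> \<le> err n"
proof -
  note [measurable] = nonexp_borel[OF f]
  have "avg n (\<lambda>\<omega>. f (S_sum n \<omega>)) = (\<integral>x. f (W n x) \<partial>\<Omega>)"
    by (subst integral_W) (auto intro!: avg_cong simp: S_sum_eq)
  moreover have "(\<integral>s. f s \<partial>std_normal) = (\<integral>x. f (Wlim x) \<partial>\<Omega>)"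
    by (rule integral_Wlim[symmetric]) simp
  ultimately have "\<bar>avg n (\<lambda>\<omega>. f (S_sum n \<omega>)) - (\<integral>s. f s \<partial>std_normal)\<bar> = \<bar>\<integral>x. f (W n x) - f (Wlim x) \<partial>\<Omega>\<bar>"
    using nonexp_integrable[OF f] integrable_W integrable_Wlim by simp
  also have "\<dots> \<le> (\<integral>x. \<bar>f (W n x) - f (Wlim x)\<bar> \<partial>\<Omega>)"
    by (rule integral_abs_bound)
  also have "\<dots> \<le> err n"
    unfolding err_def
    using nonexp_integrable[OF f] integrable_W integrable_Wlim nonexpD[OF f]
    by (intro integral_mono integrable_abs Bochner_Integration.integrable_diff) auto
  finally show ?thesis .
qed

end

locale game_sequence = limit_eq \<mu> \<nu> H + C: walk_coupling \<Omega> W Wlim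
  for \<mu> \<nu> :: "real measure" and H and \<Omega> :: "real measure" and W Wlim +
  fixes Q :: "nat \<Rightarrow> (real list \<times> real) measure" and X :: "nat \<Rightarrow> real list \<Rightarrow> real"
  assumes nash: "\<And>n. 1 \<le> n \<Longrightarrow> nash_equilibrium n \<mu> H (Q n) (X n)"
begin

lemma game: "1 \<le> n \<Longrightarrow> game \<mu> H n (Q n) (X n)"
  by (intro game.intro game_axioms.intro prior_axioms risk_axioms nash)

definition xh where "xh n = game.xh n (X n)"

lemma psi_nonexp: "nonexp \<psi>"
  using psi_lipschitz by (simp add: nonexp_def)

lemma xh_slopes: "1 \<le> n \<Longrightarrow> a \<le> b \<Longrightarrow> 0 \<le> xh n b - xh n a" "1 \<le> n \<Longrightarrow> a \<le> b \<Longrightarrow> xh n b - xh n a \<le> b - a"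
  using game.xh_slopes[OF game] by (auto simp: xh_def)

lemma xh_nonexp: "1 \<le> n \<Longrightarrow> nonexp (xh n)"
  unfolding nonexp_def
proof (intro allI)
  fix a b assume "1 \<le> n"
  then show "\<bar>xh n b - xh n a\<bar> \<le> \<bar>b - a\<bar>"
    using xh_slopes[of n a b] xh_slopes[of n b a] by (cases "a \<le> b") auto
qed

text \<open>The potential \<open>\<psi>\<close> has normal mean zero while \<open>xh n\<close> has
  walk mean zero; \<open>\<delta>\<close> recentres \<open>xh n\<close>, and \<open>d\<close> is
  the gap between \<open>\<psi>\<close> and the recentred potential.\<close>

definition \<delta> where "\<delta> n = (\<integral>s. xh n s \<partial>std_normal)"
definition d where "d n s = \<psi> s - xh n s + \<delta> n"

lemma delta_le: "1 \<le> n \<Longrightarrow> \<bar>\<delta> n\<bar> \<le> C.err n"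
  using C.avg_normal_error[OF xh_nonexp, of n n] game.xh_mean[OF game, of n] by (simp add: xh_def[symmetric] \<delta>_def)

lemma delta_tendsto: "\<delta> \<longlonglongrightarrow> 0"
  by (rule Lim_null_comparison[OF _ C.err_tendsto])
    (use delta_le in \<open>auto simp: eventually_sequentially\<close>)

lemma phi_integrable: "integrable \<mu> \<phi>"
  by (rule integrable_std_normal[OF _ integrable_id_std_normal]) simp

lemma nonexp_phi_integrable:
  assumes "nonexp f" shows "integrable \<mu> (\<lambda>l. f (\<phi> l))" "integrable std_normal f"
proof -
  show "integrable std_normal f"
    by (rule integrable_lipschitz_std_normal[OF nonexp_borel[OF assms] nonexpD[OF assms]])
  then show "integrable \<mu> (\<lambda>l. f (\<phi> l))" by (rule integrable_std_normal[OF nonexp_borel[OF assms]])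
qed

lemma l_phi_integrable: "integrable \<mu> (\<lambda>l. l * \<phi> l)"
proof (rule Bochner_Integration.integrable_bound[OF phi_integrable])
  show "AE l in \<mu>. norm (l * \<phi> l) \<le> norm (\<phi> l)"
    using AE_unit by eventually_elim (auto simp: abs_mult mult_left_le_one_le)
qed measurable

lemma h_integrable: "integrable \<mu> h"
  unfolding h_def[abs_def] using l_phi_integrable nonexp_phi_integrable[OF psi_nonexp] by auto

lemma H_integrable: assumes "integrable \<mu> k" shows "integrable \<mu> (\<lambda>l. H (k l))"
proof (rule Bochner_Integration.integrable_bound)
  show "integrable \<mu> (\<lambda>l. hi * \<bar>k l\<bar> + \<bar>H 0\<bar>)" using assms by auto
  have [measurable]: "k \<in> borel_measurable \<mu>" using assms by auto
  show "(\<lambda>l. H (k l)) \<in> borel_measurable \<mu>" by measurable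
  show "AE l in \<mu>. norm (H (k l)) \<le> norm (hi * \<bar>k l\<bar> + \<bar>H 0\<bar>)"
  proof (rule AE_I2)
    fix l
    have "\<bar>H (k l)\<bar> \<le> hi * \<bar>k l\<bar> + \<bar>H 0\<bar>" using H_lipschitz[of "k l" 0] by simp
    then show "norm (H (k l)) \<le> norm (hi * \<bar>k l\<bar> + \<bar>H 0\<bar>)" by simp
  qed
qed

lemma H_shift_integral:
  assumes "integrable \<mu> (\<lambda>l. H (k l))" "integrable \<mu> (\<lambda>l. H (k l + c))"
  shows "(\<integral>l. H (k l + c) \<partial>\<mu>) \<le> (\<integral>l. H (k l) \<partial>\<mu>) + hi * \<bar>c\<bar>"
proof -
  have "(\<integral>l. H (k l + c) \<partial>\<mu>) \<le> (\<integral>l. H (k l) + hi * \<bar>c\<bar> \<partial>\<mu>)"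
  proof (rule integral_mono)
    fix l show "H (k l + c) \<le> H (k l) + hi * \<bar>c\<bar>" using H_lipschitz[of "k l + c" "k l"] by simp
  qed (use assms in auto)
  also have "\<dots> = (\<integral>l. H (k l) \<partial>\<mu>) + hi * \<bar>c\<bar>" using assms prob_space by simp
  finally show ?thesis .
qed

lemma d_integrable: "1 \<le> n \<Longrightarrow> integrable \<mu> (\<lambda>l. d n (\<phi> l))"
  unfolding d_def using nonexp_phi_integrable(1)[OF psi_nonexp] nonexp_phi_integrable(1)[OF xh_nonexp]
  by (intro Bochner_Integration.integrable_add Bochner_Integration.integrable_diff) auto

lemma weighted_d_integrable: "1 \<le> n \<Longrightarrow> integrable \<mu> (\<lambda>l. H' (h l) * d n (\<phi> l))"
proof (rule Bochner_Integration.integrable_bound)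
  assume n: "1 \<le> n"
  show "integrable \<mu> (\<lambda>l. hi * \<bar>d n (\<phi> l)\<bar>)" using d_integrable[OF n] by auto
  show "(\<lambda>l. H' (h l) * d n (\<phi> l)) \<in> borel_measurable \<mu>" using d_integrable[OF n] by auto
  show "AE l in \<mu>. norm (H' (h l) * d n (\<phi> l)) \<le> norm (hi * \<bar>d n (\<phi> l)\<bar>)"
  proof (rule AE_I2)
    fix l
    have "\<bar>H' (h l)\<bar> \<le> hi" using lo(1) lo(2)[of "h l"] hi(2)[of "h l"] by simp
    then have "\<bar>H' (h l)\<bar> * \<bar>d n (\<phi> l)\<bar> \<le> hi * \<bar>d n (\<phi> l)\<bar>" by (rule mult_right_mono) simp
    then show "norm (H' (h l) * d n (\<phi> l)) \<le> norm (hi * \<bar>d n (\<phi> l)\<bar>)" using hi(1) by (simp add: abs_mult)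
  qed
qed

text \<open>The first-order condition at \<open>\<psi>\<close> in the direction \<open>d
  n\<close>, which has normal mean zero.\<close>

lemma weighted_d_zero:
  assumes n: "1 \<le> n" shows "(\<integral>l. H' (h l) * d n (\<phi> l) \<partial>\<mu>) = 0"
proof -
  interpret N: prob_space std_normal by (rule prob_std_normal)
  have m: "d n \<in> borel_measurable borel"
    unfolding d_def[abs_def] using nonexp_borel[OF xh_nonexp[OF n]] by measurable
  have "(\<integral>s. d n s \<partial>std_normal) = (\<integral>s. \<psi> s \<partial>std_normal) - (\<integral>s. xh n s \<partial>std_normal) + \<delta> n"
    unfolding d_def using nonexp_phi_integrable(2)[OF psi_nonexp] nonexp_phi_integrable(2)[OF xh_nonexp[OF n]] N.prob_space
    by simp
  then have "alpha * (\<integral>l. H' (h l) * d n (\<phi> l) \<partial>\<mu>) = 0"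
    by (simp add: integral_psi \<delta>_def integral_std_normal[OF m, symmetric])
  then show ?thesis using alpha(1) by simp
qed

lemma breg_integrable: "1 \<le> n \<Longrightarrow> integrable \<mu> (\<lambda>l. breg (h l) (d n (\<phi> l)))"
  unfolding breg_def
  by (intro Bochner_Integration.integrable_diff weighted_d_integrable H_integrable Bochner_Integration.integrable_add h_integrable d_integrable)

text \<open>The linear part of the Bregman distance integrates to zero, so its mean is the cost of
  \<open>xh n\<close> minus the cost of \<open>\<psi>\<close> in the limiting game. Minimality of
  \<open>xh n\<close> in the finite game bounds this difference by the two recentring errors, one
  for each potential tried in the other's game.\<close>

lemma breg_integral_le:
  assumes n: "1 \<le> n"
  shows "(\<integral>l. breg (h l) (d n (\<phi> l)) \<partial>\<mu>) \<le> 2 * hi * C.err n"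
proof -
  interpret G: game \<mu> H n "Q n" "X n" by (rule game[OF n])
  define \<delta>' where "\<delta>' = avg n (\<lambda>\<omega>. \<psi> (S_sum n \<omega>))"
  have \<delta>': "\<bar>\<delta>'\<bar> \<le> C.err n"
    using C.avg_normal_error[OF psi_nonexp, of n] by (simp add: integral_psi \<delta>'_def)
  have i1: "integrable \<mu> (\<lambda>l. H (h l + c))" for c
    by (rule H_integrable) (use h_integrable in auto)
  have i2: "integrable \<mu> (\<lambda>l. H (h l + d n (\<phi> l)))"
    by (intro H_integrable Bochner_Integration.integrable_add h_integrable d_integrable n)
  have "(\<integral>l. breg (h l) (d n (\<phi> l)) \<partial>\<mu>) = (\<integral>l. H (h l + d n (\<phi> l)) \<partial>\<mu>) - (\<integral>l. H (h l) \<partial>\<mu>)"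
    unfolding breg_def using weighted_d_zero[OF n] weighted_d_integrable[OF n] i2 i1[of 0] by simp
  also have "(\<integral>l. H (h l + d n (\<phi> l)) \<partial>\<mu>) \<le> (\<integral>l. H (G.hn l + \<delta> n) \<partial>\<mu>)"
  proof (rule integral_mono_AE[OF i2 G.integrable_H_hn])
    show "AE l in \<mu>. H (h l + d n (\<phi> l)) \<le> H (G.hn l + \<delta> n)"
      using AE_unit
    proof eventually_elim
      case (elim l)
      then have "l * \<phi> l - xh n (\<phi> l) \<le> G.hn l" using G.xh_ge[of l "\<phi> l"] by (simp add: xh_def)
      then show ?case by (intro H_le) (simp add: h_def d_def)
    qed
  qed
  also have "\<dots> \<le> (\<integral>l. H (G.hn l) \<partial>\<mu>) + hi * \<bar>\<delta> n\<bar>"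
    using G.integrable_H_hn[of 0] G.integrable_H_hn by (intro H_shift_integral) auto
  also have "(\<integral>l. H (G.hn l) \<partial>\<mu>) \<le> (\<integral>l. H (h l + \<delta>') \<partial>\<mu>)"
  proof (rule G.value_le[where Y = "\<lambda>\<omega>. \<psi> (S_sum n \<omega>) - \<delta>'"])
    show "avg n (\<lambda>\<omega>. \<psi> (S_sum n \<omega>) - \<delta>') = 0" by (simp add: avg_diff \<delta>'_def)
    show "l * S_sum n \<omega> - (\<psi> (S_sum n \<omega>) - \<delta>') \<le> h l + \<delta>'" if "0 < l" "l < 1" for l \<omega>
      using phi_optimal[OF that, of "S_sum n \<omega>"] by (simp add: h_def)
  qed (use i1 in auto)
  also have "\<dots> \<le> (\<integral>l. H (h l) \<partial>\<mu>) + hi * \<bar>\<delta>'\<bar>"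
    using i1[of 0] i1 by (intro H_shift_integral) auto
  finally have "(\<integral>l. breg (h l) (d n (\<phi> l)) \<partial>\<mu>) \<le> hi * \<bar>\<delta>'\<bar> + hi * \<bar>\<delta> n\<bar>" by simp
  also have "\<dots> \<le> hi * C.err n + hi * C.err n"
    using \<delta>' delta_le[OF n] hi(1) by (intro add_mono mult_left_mono) auto
  finally show ?thesis by simp
qed

text \<open>The gap is 1-Lipschitz. If it is at least \<open>2 * \<eta>\<close> at
  \<open>s\<close>, it is at least \<open>\<eta>\<close> on an interval around \<open>s\<close>,
  which \<open>\<nu>\<close> charges; this keeps the mean Bregman distance away from zero.\<close>

lemma d_tendsto: "(\<lambda>n. d n s) \<longlonglongrightarrow> 0"
proof (rule tendstoI)
  fix e :: real assume e: "0 < e"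
  define \<eta> where "\<eta> = e / 2"
  have \<eta>: "0 < \<eta>" using e by (simp add: \<eta>_def)
  define I where "I = {s - \<eta><..<s + \<eta>}"
  define R where "R = 2 * (\<bar>s\<bar> + \<eta>) + \<bar>\<psi> 0\<bar>"
  obtain b where b: "0 < b" "\<And>x y. \<bar>x\<bar> \<le> R \<Longrightarrow> \<eta> \<le> \<bar>y\<bar> \<Longrightarrow> b \<le> breg x y"
    using breg_lower[OF \<eta>, of R] by metis
  define m where "m = measure \<mu> (\<phi> -` I)"
  have Ism: "\<phi> -` I \<in> sets \<mu>" using measurable_sets[OF phi_borel, of I] by (simp add: I_def)
  have m: "0 < m"
  proof (rule ccontr)
    assume "\<not> 0 < m"
    then have "m = 0" using measure_nonneg[of \<mu> "\<phi> -` I"] by (simp add: m_def)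
    then have "\<phi> -` I \<in> null_sets \<mu>" using Ism by (simp add: m_def null_sets_def emeasure_eq_measure)
    then have "AE l in \<mu>. \<phi> l \<notin> I" by (rule AE_I') auto
    then have "I \<in> null_sets lborel"
      by (subst null_sets_std_normal[symmetric], simp add: I_def) (subst null_std_normal_iff, auto simp: I_def)
    then show False using \<eta> by (simp add: I_def null_sets_def)
  qed
  have "(\<lambda>n. 2 * hi * C.err n) \<longlonglongrightarrow> 2 * hi * 0" by (intro tendsto_mult tendsto_const C.err_tendsto)
  then have "eventually (\<lambda>n. 2 * hi * C.err n < b * m) sequentially"
    using b(1) m by (intro order_tendstoD(2)[where y = 0]) auto
  then show "eventually (\<lambda>n. dist (d n s) 0 < e) sequentially"
    using eventually_ge_at_top[of 1]
  proof eventually_elim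
    case (elim n)
    show ?case
    proof (rule ccontr)
      assume "\<not> dist (d n s) 0 < e"
      then have big: "2 * \<eta> \<le> \<bar>d n s\<bar>" by (simp add: \<eta>_def)
      have pt: "b * indicator (\<phi> -` I) l \<le> breg (h l) (d n (\<phi> l))" if l: "0 < l" "l < 1" for l
      proof (cases "\<phi> l \<in> I")
        case True
        have near: "\<bar>\<phi> l - s\<bar> < \<eta>" using True by (auto simp: I_def)
        have lip: "\<bar>d n a - d n b\<bar> \<le> b - a" if "a \<le> b" for a b
          using psi_slopes[OF that] xh_slopes[OF elim(2) that] by (simp add: d_def abs_le_iff)
        have "\<bar>d n (\<phi> l) - d n s\<bar> \<le> \<bar>\<phi> l - s\<bar>"
          using lip[of "\<phi> l" s] lip[of s "\<phi> l"] by (cases "\<phi> l \<le> s") auto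
        then have 1: "\<eta> \<le> \<bar>d n (\<phi> l)\<bar>" using near big by linarith
        have "\<bar>l * \<phi> l\<bar> \<le> \<bar>\<phi> l\<bar>" using l by (simp add: abs_mult mult_left_le_one_le)
        then have 2: "\<bar>h l\<bar> \<le> R"
        proof -
          have "\<bar>\<phi> l\<bar> \<le> \<bar>s\<bar> + \<eta>" using near by arith
          moreover have "\<bar>\<psi> (\<phi> l)\<bar> \<le> \<bar>\<phi> l\<bar> + \<bar>\<psi> 0\<bar>" using psi_lipschitz[of "\<phi> l" 0] by arith
          moreover have "\<bar>l * \<phi> l - \<psi> (\<phi> l)\<bar> \<le> \<bar>l * \<phi> l\<bar> + \<bar>\<psi> (\<phi> l)\<bar>" by (rule abs_triangle_ineq4)
          ultimately show ?thesis using \<open>\<bar>l * \<phi> l\<bar> \<le> \<bar>\<phi> l\<bar>\<close> by (simp add: h_def R_def)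
        qed
        from b(2)[OF 2 1] show ?thesis using True by simp
      next
        case False
        then show ?thesis using breg_nonneg by simp
      qed
      have "b * m = (\<integral>l. b * indicator (\<phi> -` I) l \<partial>\<mu>)"
        using Ism by (simp add: m_def)
      also have "\<dots> \<le> (\<integral>l. breg (h l) (d n (\<phi> l)) \<partial>\<mu>)"
      proof (rule integral_mono_AE)
        show "integrable \<mu> (\<lambda>l. b * indicator (\<phi> -` I) l)"
          using Ism by (intro integrable_mult_right integrable_real_indicator) (auto simp: emeasure_eq_measure)
        show "AE l in \<mu>. b * indicator (\<phi> -` I) l \<le> breg (h l) (d n (\<phi> l))"
          using AE_unit by eventually_elim (use pt in auto)
      qed (rule breg_integrable[OF elim(2)])
      also have "\<dots> \<le> 2 * hi * C.err n" by (rule breg_integral_le[OF elim(2)])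
      finally show False using elim(1) by simp
    qed
  qed
qed

lemma xh_tendsto: "(\<lambda>n. xh n s) \<longlonglongrightarrow> \<psi> s"
proof -
  have "(\<lambda>n. \<psi> s + \<delta> n - d n s) \<longlonglongrightarrow> \<psi> s + 0 - 0"
    by (intro tendsto_intros delta_tendsto d_tendsto)
  then show ?thesis by (simp add: d_def)
qed

lemma xh_tendsto_seq:
  assumes "z \<longlonglongrightarrow> s" shows "(\<lambda>n. xh n (z n)) \<longlonglongrightarrow> \<psi> s"
proof -
  have "(\<lambda>n. xh n (z n) - xh n s) \<longlonglongrightarrow> 0"
  proof (rule Lim_null_comparison)
    show "eventually (\<lambda>n. norm (xh n (z n) - xh n s) \<le> \<bar>z n - s\<bar>) sequentially"
      using eventually_ge_at_top[of 1] by eventually_elim (use nonexpD[OF xh_nonexp] in auto)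
    show "(\<lambda>n. \<bar>z n - s\<bar>) \<longlonglongrightarrow> 0" using assms by (intro tendsto_rabs_zero LIM_zero)
  qed
  from tendsto_add[OF this xh_tendsto[of s]] show ?thesis by simp
qed

definition slope where
  "slope n w = (xh n (w + 1 / sqrt (real n)) - xh n (w - 1 / sqrt (real n))) / (2 / sqrt (real n))"

lemma slope_unit: assumes n: "1 \<le> n" shows "0 \<le> slope n w" "slope n w \<le> 1"
proof -
  have r: "0 < 1 / sqrt (real n)" using n by simp
  then have "w - 1 / sqrt (real n) \<le> w + 1 / sqrt (real n)" by linarith
  from xh_slopes[OF n this] show "0 \<le> slope n w" "slope n w \<le> 1"
    using n divide_le_eq_1_pos[of "2 / sqrt (real n)"] by (simp_all add: slope_def)
qed

lemma slope_borel: assumes "1 \<le> n" shows "slope n \<in> borel_measurable borel"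
proof -
  note [measurable] = nonexp_borel[OF xh_nonexp[OF assms]]
  show ?thesis unfolding slope_def[abs_def] by measurable
qed

text \<open>For convex functions chord slopes increase with the chord, so the shrinking symmetric
  chord lies between the fixed chords of length \<open>\<eta>\<close> to the left and to the
  right. Their slopes converge, and continuity of \<open>\<gamma>\<close> makes the limits close
  to \<open>\<gamma> s\<close>.\<close>

lemma slope_tendsto:
  assumes z: "z \<longlonglongrightarrow> s" shows "(\<lambda>n. slope n (z n)) \<longlonglongrightarrow> \<gamma> s"
proof -
  let ?r = "\<lambda>n::nat. 1 / sqrt (real n)"
  have r0: "?r \<longlonglongrightarrow> 0"
    using tendsto_real_sqrt[OF lim_inverse_n] by (simp add: real_sqrt_inverse inverse_eq_divide real_sqrt_divide)
  have xh_conv: "1 \<le> n \<Longrightarrow> convex_on UNIV (xh n)" for n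
    using game.xh_convex[OF game] by (simp add: xh_def)
  show ?thesis
  proof (rule order_tendstoI)
    fix a
    assume a: "\<gamma> s < a"
    have "eventually (\<lambda>x. \<gamma> x < a) (at_right s)"
      using continuous_gam[of s] a order_tendstoD(2)[of \<gamma> "\<gamma> s" "at_right s" a] by (simp add: isCont_def filterlim_at_split)
    then obtain b where b: "s < b" "\<And>y. s < y \<Longrightarrow> y < b \<Longrightarrow> \<gamma> y < a" by (auto simp: eventually_at_right_field)
    define \<eta> where "\<eta> = (b - s) / 2"
    have \<eta>: "0 < \<eta>" "\<gamma> (s + \<eta>) < a" using b by (auto simp: \<eta>_def field_simps)
    have "(\<lambda>n. (xh n (z n + \<eta>) - xh n (z n)) / \<eta>) \<longlonglongrightarrow> (\<psi> (s + \<eta>) - \<psi> s) / \<eta>"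
      using \<eta> by (intro tendsto_intros xh_tendsto_seq z) auto
    moreover have "(\<psi> (s + \<eta>) - \<psi> s) / \<eta> < a"
      using psi_diff_gam(2)[of s "s + \<eta>"] \<eta> by (simp add: divide_less_eq) (meson le_less_trans mult_strict_right_mono)
    ultimately have "eventually (\<lambda>n. (xh n (z n + \<eta>) - xh n (z n)) / \<eta> < a) sequentially"
      by (rule order_tendstoD)
    moreover have "eventually (\<lambda>n. ?r n < \<eta>) sequentially" using order_tendstoD(2)[OF r0 \<eta>(1)] .
    ultimately show "eventually (\<lambda>n. slope n (z n) < a) sequentially"
      using eventually_ge_at_top[of 1]
    proof eventually_elim
      case (elim n)
      have "slope n (z n) = (xh n (z n + ?r n) - xh n (z n - ?r n)) / ((z n + ?r n) - (z n - ?r n))"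
        by (simp add: slope_def)
      also have "\<dots> \<le> (xh n (z n + \<eta>) - xh n (z n)) / ((z n + \<eta>) - z n)"
        using elim \<eta> by (intro convex_slopes_mono xh_conv) auto
      finally show ?case using elim(1) by simp
    qed
  next
    fix a
    assume a: "a < \<gamma> s"
    have "eventually (\<lambda>x. a < \<gamma> x) (at_left s)"
      using continuous_gam[of s] a order_tendstoD(1)[of \<gamma> "\<gamma> s" "at_left s" a] by (simp add: isCont_def filterlim_at_split)
    then obtain b where b: "b < s" "\<And>y. b < y \<Longrightarrow> y < s \<Longrightarrow> a < \<gamma> y" by (auto simp: eventually_at_left_field)
    define \<eta> where "\<eta> = (s - b) / 2"
    have \<eta>: "0 < \<eta>" "a < \<gamma> (s - \<eta>)" using b by (auto simp: \<eta>_def field_simps)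
    have "(\<lambda>n. (xh n (z n) - xh n (z n - \<eta>)) / \<eta>) \<longlonglongrightarrow> (\<psi> s - \<psi> (s - \<eta>)) / \<eta>"
      using \<eta> by (intro tendsto_intros xh_tendsto_seq z) auto
    moreover have "a < (\<psi> s - \<psi> (s - \<eta>)) / \<eta>"
      using psi_diff_gam(1)[of "s - \<eta>" s] \<eta> by (simp add: less_divide_eq) (meson less_le_trans mult_strict_right_mono)
    ultimately have "eventually (\<lambda>n. a < (xh n (z n) - xh n (z n - \<eta>)) / \<eta>) sequentially"
      by (rule order_tendstoD)
    moreover have "eventually (\<lambda>n. ?r n < \<eta>) sequentially" using order_tendstoD(2)[OF r0 \<eta>(1)] .
    ultimately show "eventually (\<lambda>n. a < slope n (z n)) sequentially"
      using eventually_ge_at_top[of 1]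
    proof eventually_elim
      case (elim n)
      have "(xh n (z n) - xh n (z n - \<eta>)) / (z n - (z n - \<eta>)) \<le> (xh n (z n + ?r n) - xh n (z n - ?r n)) / ((z n + ?r n) - (z n - ?r n))"
        using elim \<eta> by (intro convex_slopes_mono xh_conv) auto
      also have "\<dots> = slope n (z n)"
        by (simp add: slope_def)
      finally show ?case using elim(1) by simp
    qed
  qed
qed

end

section \<open>Convergence of the price processes\<close>

text \<open>Enumerating the finite set \<open>J\<close> by \<open>idx\<close> turns a test
  function on \<open>\<real>\<^sup>J\<close> into a function on sequences, where the Borel sets of
  the product topology are known to be the product \<open>\<sigma>\<close>-algebra.\<close>

lemma continuous_test_function:
  fixes \<theta> :: "(real \<Rightarrow> real) \<Rightarrow> real" and idx :: "real \<Rightarrow> nat"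
  assumes "continuous_map (product_topology (\<lambda>_. euclideanreal) J) euclideanreal \<theta>"
  shows "continuous_on UNIV (\<lambda>x :: nat \<Rightarrow> real. \<theta> (\<lambda>t\<in>J. x (idx t)))"
proof -
  have "continuous_map euclidean euclideanreal (\<lambda>x :: nat \<Rightarrow> real. x i)" for i
    using continuous_on_product_coordinates[of i] by simp
  then have "continuous_map euclidean (product_topology (\<lambda>_. euclideanreal) J) (\<lambda>x :: nat \<Rightarrow> real. \<lambda>t\<in>J. x (idx t))"
    by (auto simp: continuous_map_componentwise)
  from continuous_map_compose[OF this assms] show ?thesis by (simp add: comp_def)
qed

lemma continuous_seq_imp_borel:
  fixes \<Theta> :: "(nat \<Rightarrow> real) \<Rightarrow> real"
  assumes "continuous_on UNIV \<Theta>" shows "\<Theta> \<in> borel_measurable (\<Pi>\<^sub>M i\<in>UNIV. borel)"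
proof -
  have "\<Theta> \<in> borel_measurable borel" by (rule borel_measurable_continuous_onI[OF assms])
  moreover have "sets (\<Pi>\<^sub>M i\<in>(UNIV :: nat set). (borel :: real measure)) = sets borel" by (rule sets_PiM_equal_borel)
  ultimately show ?thesis by (simp cong: measurable_cong_sets)
qed

lemma continuous_seq_tendsto:
  fixes \<Theta> :: "(nat \<Rightarrow> real) \<Rightarrow> real"
  assumes \<Theta>: "continuous_on UNIV \<Theta>" and x: "\<And>i. (\<lambda>n. x n i) \<longlonglongrightarrow> y i"
  shows "(\<lambda>n. \<Theta> (x n)) \<longlonglongrightarrow> \<Theta> y"
proof -
  have "limitin (product_topology (\<lambda>_. euclideanreal) UNIV) x y sequentially"
    using x by (simp add: limitin_componentwise)
  then have "x \<longlonglongrightarrow> y" by (simp add: euclidean_product_topology)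
  then show ?thesis
    using \<Theta> by (metis UNIV_I continuous_on_eq_continuous_at isCont_tendsto_compose open_UNIV)
qed

lemma test_function_measurable:
  fixes \<theta> :: "(real \<Rightarrow> real) \<Rightarrow> real"
  assumes J: "finite J" and \<theta>: "continuous_map (product_topology (\<lambda>_. euclideanreal) J) euclideanreal \<theta>"
    and Z: "\<And>t. t \<in> J \<Longrightarrow> Z t \<in> borel_measurable M"
  shows "(\<lambda>\<omega>. \<theta> (\<lambda>t\<in>J. Z t \<omega>)) \<in> borel_measurable M"
proof -
  obtain n and f :: "nat \<Rightarrow> real" where f: "J = f ` {i. i < n}" "inj_on f {i. i < n}"
    using finite_imp_nat_seg_image_inj_on[OF J] by blast
  define idx where "idx = the_inv_into {i. i < n} f"
  have idx: "idx t < n" "f (idx t) = t" if "t \<in> J" for t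
    using that f the_inv_into_into[OF f(2), of t] f_the_inv_into_f[OF f(2), of t] by (auto simp: idx_def)
  have "(\<lambda>\<omega>. \<theta> (\<lambda>t\<in>J. Z t \<omega>)) = (\<lambda>\<omega>. \<theta> (\<lambda>t\<in>J. (\<lambda>i. if i < n then Z (f i) \<omega> else 0) (idx t)))"
    by (intro ext arg_cong[where f = \<theta>] restrict_ext) (use idx in auto)
  also have "\<dots> \<in> borel_measurable M"
  proof (rule measurable_compose[OF _ continuous_seq_imp_borel[OF continuous_test_function[OF \<theta>]]], rule measurable_PiM_single')
    fix i
    show "(\<lambda>\<omega>. if i < n then Z (f i) \<omega> else 0) \<in> borel_measurable M"
      using Z[of "f i"] f(1) by (cases "i < n") auto
  qed (auto simp: space_PiM)
  finally show ?thesis .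
qed

lemma sum_blocks:
  fixes f :: "nat \<Rightarrow> real"
  assumes c: "mono c"
  shows "(\<Sum>l\<in>{c 0..<c i}. f l) = (\<Sum>j<i. \<Sum>l\<in>{c j..<c (Suc j)}. f l)"
proof (induction i)
  case (Suc i)
  have "(\<Sum>l\<in>{c 0..<c (Suc i)}. f l) = (\<Sum>l\<in>{c 0..<c i}. f l) + (\<Sum>l\<in>{c i..<c (Suc i)}. f l)"
    by (rule sum.atLeastLessThan_concat[symmetric]) (use c in \<open>auto intro: monoD\<close>)
  also have "\<dots> = (\<Sum>j<Suc i. \<Sum>l\<in>{c j..<c (Suc j)}. f l)"
    by (simp only: Suc sum.lessThan_Suc)
  finally show ?case .
qed simp

text \<open>The index of the price that \<open>price_path\<close> reads at time
  \<open>t\<close>.\<close>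

definition period :: "nat \<Rightarrow> real \<Rightarrow> nat" where
  "period n t = max 1 (nat \<lfloor>real n * t\<rfloor>)"

lemma period_bounds:
  assumes "1 \<le> n" "t \<le> 1" shows "1 \<le> period n t" "period n t \<le> n"
proof -
  have "real n * t \<le> real n" using assms by (simp add: mult_left_le)
  then have "nat \<lfloor>real n * t\<rfloor> \<le> n" by linarith
  then show "1 \<le> period n t" "period n t \<le> n" using assms by (auto simp: period_def)
qed

lemma period_1: "1 \<le> n \<Longrightarrow> period n 1 = n"
  by (simp add: period_def)

lemma period_mono: "s \<le> t \<Longrightarrow> period n s \<le> period n t"
  unfolding period_def by (intro max.mono nat_mono floor_mono mult_left_mono) auto

lemma period_tendsto: assumes "0 < t" shows "(\<lambda>n. real (period n t) / real n) \<longlonglongrightarrow> t"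
proof (rule real_tendsto_sandwich)
  obtain N :: nat where N: "1 / t < real N" using reals_Archimedean2 by blast
  have ev: "eventually (\<lambda>n. real n * t - 1 \<le> real (period n t) \<and> real (period n t) \<le> real n * t \<and> 0 < n) sequentially"
    unfolding eventually_sequentially
  proof (intro exI allI impI)
    fix n assume n: "max 1 N \<le> n"
    have "1 / t < real n" using N n by simp
    then have 1: "1 \<le> real n * t" using assms by (simp add: field_simps)
    then have fl: "1 \<le> \<lfloor>real n * t\<rfloor>" by linarith
    then have "max 1 (nat \<lfloor>real n * t\<rfloor>) = nat \<lfloor>real n * t\<rfloor>" by linarith
    then have "real (period n t) = of_int \<lfloor>real n * t\<rfloor>" using fl by (simp only: period_def)
    then show "real n * t - 1 \<le> real (period n t) \<and> real (period n t) \<le> real n * t \<and> 0 < n" using n by (auto; linarith)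
  qed
  show "eventually (\<lambda>n. t - 1 / real n \<le> real (period n t) / real n) sequentially"
    using ev
  proof eventually_elim
    case (elim n)
    then have "(real n * t - 1) / real n \<le> real (period n t) / real n" by (intro divide_right_mono) auto
    then show ?case using elim by (simp add: diff_divide_distrib)
  qed
  show "eventually (\<lambda>n. real (period n t) / real n \<le> t) sequentially"
    using ev by eventually_elim (simp add: divide_le_eq mult.commute)
  show "(\<lambda>n. t - 1 / real n) \<longlonglongrightarrow> t"
    using tendsto_diff[OF tendsto_const[of t] lim_inverse_n] by (simp add: inverse_eq_divide)
qed simp

lemma frac_tendsto_at_top:
  fixes m :: "nat \<Rightarrow> nat"
  assumes "(\<lambda>n. real (m n) / real n) \<longlonglongrightarrow> c" "0 < c"
  shows "filterlim m at_top sequentially"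
proof -
  have "filterlim (\<lambda>n. real (m n) / real n * real n) at_top sequentially"
    by (rule filterlim_tendsto_pos_mult_at_top[OF assms filterlim_real_sequentially])
  moreover have "eventually (\<lambda>n. real (m n) / real n * real n = real (m n)) sequentially"
    using eventually_ge_at_top[of 1] by eventually_elim simp
  ultimately have "filterlim (\<lambda>n. real (m n)) at_top sequentially"
    using filterlim_cong[OF refl refl, of "\<lambda>n. real (m n) / real n * real n" "\<lambda>n. real (m n)" sequentially at_top] by blast
  then show ?thesis by (simp only: filterlim_sequentially_iff_filterlim_real)
qed

context walk_coupling
begin

text \<open>The number of tosses in a block either tends to infinity or, after the last toss at
  time \<open>1\<close>, is constantly zero.\<close>

lemma scaled_W_tendsto:
  assumes m: "(\<lambda>n. real (m n) / real n) \<longlonglongrightarrow> c" and "0 < c \<or> (\<forall>n\<ge>1. m n = 0) \<and> c = 0" and x: "x \<in> space \<Omega>"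
  shows "(\<lambda>n. sqrt (real (m n) / real n) * W (m n) x) \<longlonglongrightarrow> sqrt c * Wlim x"
  using assms(2)
proof
  assume "0 < c"
  then have "filterlim m at_top sequentially" by (rule frac_tendsto_at_top[OF m])
  then have "(\<lambda>n. W (m n) x) \<longlonglongrightarrow> Wlim x" by (rule filterlim_compose[OF W_conv[OF x]])
  then show ?thesis by (intro tendsto_mult tendsto_real_sqrt m)
next
  assume c: "(\<forall>n\<ge>1. m n = 0) \<and> c = 0"
  show ?thesis
    by (rule tendsto_eventually) (use c in \<open>auto simp: eventually_sequentially intro!: exI[of _ 1]\<close>)
qed

end

context game_sequence
begin

lemma game_X: "1 \<le> n \<Longrightarrow> \<omega> \<in> states n \<Longrightarrow> X n \<omega> = xh n (S_sum n \<omega>)"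
  using game.xh_S[OF game] by (simp add: xh_def)

text \<open>The price when the earlier tosses sum to \<open>x\<close> after scaling and
  \<open>b\<close> tosses follow the priced one.\<close>

definition kernel where "kernel n b x = avg b (\<lambda>\<beta>. slope n (x + sum_list \<beta> / sqrt (real n)))"

text \<open>The two values of the priced toss move \<open>S\<close> by one mesh width up and down
  around the sum of all other tosses, and \<open>X\<close> is a function of
  \<open>S\<close>.\<close>

lemma price_eq_kernel:
  assumes X: "X n = payoff_of_prices n p" and n: "n = Suc (a + b)" and h: "hs \<in> states a"
  shows "p (Suc a) hs = kernel n b (sum_list hs / sqrt (real n))"
proof -
  have n1: "1 \<le> n" using n by simp
  have val: "payoff_of_prices n p (hs @ u # \<beta>) = xh n (sum_list hs / sqrt (real n) + sum_list \<beta> / sqrt (real n) + u / sqrt (real n))"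
    if "\<beta> \<in> states b" "u \<in> {-1, 1}" for \<beta> u
  proof -
    have "hs @ u # \<beta> \<in> states n" using that h n by (auto simp: states_def)
    then show ?thesis
      unfolding X[symmetric] using game_X[OF n1] by (simp add: S_sum_eq add_divide_distrib add.commute add.left_commute)
  qed
  have "p (Suc a) hs = sqrt (real n) / 2 *
      (avg b (\<lambda>\<beta>. payoff_of_prices n p (hs @ 1 # \<beta>)) - avg b (\<lambda>\<beta>. payoff_of_prices n p (hs @ (-1) # \<beta>)))"
    by (rule price_eq_difference[OF h n])
  also have "\<dots> = avg b (\<lambda>\<beta>. sqrt (real n) / 2 * (payoff_of_prices n p (hs @ 1 # \<beta>) - payoff_of_prices n p (hs @ (-1) # \<beta>)))"
    by (simp only: avg_cmult avg_diff)
  also have "\<dots> = kernel n b (sum_list hs / sqrt (real n))"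
    unfolding kernel_def by (intro avg_cong) (simp add: val slope_def)
  finally show ?thesis .
qed

lemma kernel_eq_integral:
  assumes "1 \<le> n"
  shows "kernel n b x = (\<integral>y. slope n (x + sqrt (real b / real n) * W b y) \<partial>\<Omega>)"
proof -
  note [measurable] = slope_borel[OF assms]
  show ?thesis unfolding kernel_def by (rule C.avg_suffix[of "\<lambda>z. slope n (x + z)"]) measurable
qed

lemma kernel_borel: assumes "1 \<le> n" shows "kernel n b \<in> borel_measurable borel"
proof -
  note [measurable] = slope_borel[OF assms]
  show ?thesis unfolding kernel_def[abs_def] avg_def by measurable
qed

lemma bm_kernel: "brownian_motion M B \<Longrightarrow> bm_kernel M B \<gamma>"
  by unfold_locales (auto simp: gam_mono gam_unit)

abbreviation "G \<equiv> gauss_mean \<gamma>"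

lemma kernel_tendsto:
  assumes y: "y \<longlonglongrightarrow> x" and t: "0 < t" "t \<le> 1"
  shows "(\<lambda>n. kernel n (n - period n t) (y n)) \<longlonglongrightarrow> G t x"
proof -
  let ?b = "\<lambda>n. n - period n t"
  have b: "(\<lambda>n. real (?b n) / real n) \<longlonglongrightarrow> 1 - t"
  proof (rule Lim_transform_eventually)
    show "(\<lambda>n. 1 - real (period n t) / real n) \<longlonglongrightarrow> 1 - t" by (intro tendsto_intros period_tendsto t)
    show "eventually (\<lambda>n. 1 - real (period n t) / real n = real (?b n) / real n) sequentially"
      using eventually_ge_at_top[of 1] by eventually_elim (use period_bounds t in \<open>simp add: of_nat_diff diff_divide_distrib\<close>)
  qed
  have c: "0 < 1 - t \<or> (\<forall>n\<ge>1. ?b n = 0) \<and> 1 - t = 0"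
    using t by (cases "t = 1") (auto simp: period_1)
  let ?k = "\<lambda>n. \<integral>z. slope (max 1 n) (y n + sqrt (real (?b n) / real n) * W (?b n) z) \<partial>\<Omega>"
  have "?k \<longlonglongrightarrow> (\<integral>z. \<gamma> (x + sqrt (1 - t) * Wlim z) \<partial>\<Omega>)"
  proof (rule integral_dominated_convergence[where w = "\<lambda>_. 1"])
    show "(\<lambda>z. \<gamma> (x + sqrt (1 - t) * Wlim z)) \<in> borel_measurable \<Omega>" by measurable
    show "(\<lambda>z. slope (max 1 n) (y n + sqrt (real (?b n) / real n) * W (?b n) z)) \<in> borel_measurable \<Omega>" for n
    proof -
      note [measurable] = slope_borel[of "max 1 n"]
      show ?thesis by measurable
    qed
    show "AE z in \<Omega>. (\<lambda>n. slope (max 1 n) (y n + sqrt (real (?b n) / real n) * W (?b n) z)) \<longlonglongrightarrow> \<gamma> (x + sqrt (1 - t) * Wlim z)"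
    proof (rule AE_I2)
      fix z assume z: "z \<in> space \<Omega>"
      have "(\<lambda>n. y n + sqrt (real (?b n) / real n) * W (?b n) z) \<longlonglongrightarrow> x + sqrt (1 - t) * Wlim z"
        by (intro tendsto_add y C.scaled_W_tendsto[OF b c z])
      from slope_tendsto[OF this]
      show "(\<lambda>n. slope (max 1 n) (y n + sqrt (real (?b n) / real n) * W (?b n) z)) \<longlonglongrightarrow> \<gamma> (x + sqrt (1 - t) * Wlim z)"
        by (rule Lim_transform_eventually) (auto simp: eventually_sequentially max_def intro!: exI[of _ 1])
    qed
    show "AE z in \<Omega>. norm (slope (max 1 n) (y n + sqrt (real (?b n) / real n) * W (?b n) z)) \<le> 1" for n
      using slope_unit[of "max 1 n"] by (intro AE_I2) simp
  qed simp
  moreover have "(\<integral>z. \<gamma> (x + sqrt (1 - t) * Wlim z) \<partial>\<Omega>) = G t x"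
    unfolding gauss_mean_def by (rule C.integral_Wlim[of "\<lambda>z. \<gamma> (x + sqrt (1 - t) * z)"]) measurable
  ultimately have "?k \<longlonglongrightarrow> G t x" by simp
  then show ?thesis
    by (rule Lim_transform_eventually)
      (auto simp: eventually_sequentially kernel_eq_integral max_def intro!: exI[of _ 1])
qed

text \<open>Prices at finitely many times depend continuously on independent increments, those of
  the walk on one side and those of \<open>B\<close> on the other. Both are realised on a power of
  the coupling space, where convergence is pointwise.\<close>

theorem fdd_convergence:
  assumes p: "\<And>n. 1 \<le> n \<Longrightarrow> X n = payoff_of_prices n (p n)" and bm: "brownian_motion M B"
  shows "converges_fdd {0<..1} (\<lambda>n. uniform_count_measure (states n)) (\<lambda>n. price_path n (p n)) M (\<lambda>t \<omega>. G t (B t \<omega>))"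
  unfolding converges_fdd_def
proof (intro allI impI)
  fix J :: "real set" and \<theta> :: "(real \<Rightarrow> real) \<Rightarrow> real"
  assume J: "finite J" "J \<subseteq> {0<..1}" and \<theta>: "continuous_map (product_topology (\<lambda>_. euclideanreal) J) euclideanreal \<theta>"
    and bdd: "bounded (\<theta> ` (J \<rightarrow>\<^sub>E UNIV))"
  interpret K: bm_kernel M B \<gamma> by (rule bm_kernel[OF bm])
  define ts where "ts = sorted_list_of_set J"
  define k where "k = length ts"
  let ?PO = "\<Pi>\<^sub>M i\<in>{..<k}. \<Omega>" and ?PB = "\<Pi>\<^sub>M i\<in>{..<k}. (borel :: real measure)"
  have ts: "sorted ts" "distinct ts" "set ts = J" using J by (auto simp: ts_def)
  define idx where "idx t = (SOME i. i < k \<and> ts ! i = t)" for t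
  have idx: "idx t < k \<and> ts ! idx t = t" if "t \<in> J" for t
  proof -
    have "\<exists>i. i < k \<and> ts ! i = t" using that ts(3) by (metis in_set_conv_nth k_def)
    then show ?thesis unfolding idx_def by (rule someI_ex)
  qed
  have tsJ: "0 < ts ! i" "ts ! i \<le> 1" if "i < k" for i
    using that J(2) ts(3) nth_mem[of i ts] by (auto simp: k_def)
  have ts_less: "ts ! i < ts ! j" if "i < j" "j < k" for i j
    using that ts sorted_wrt_nth_less[of "(<)" ts i j] by (auto simp: strict_sorted_iff k_def)
  define \<tau> where "\<tau> i = (if i = 0 \<or> k = 0 then 0 else ts ! (min i k - 1))" for i
  have \<tau>_0: "\<tau> 0 = 0" and \<tau>_Suc: "i < k \<Longrightarrow> \<tau> (Suc i) = ts ! i" for i by (auto simp: \<tau>_def min_def)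
  have \<tau>_nonneg: "0 \<le> \<tau> i" for i
  proof (cases "i = 0 \<or> k = 0")
    case False
    then have "min i k - 1 < k" by linarith
    then show ?thesis using tsJ(1) False by (simp add: \<tau>_def less_imp_le)
  qed (auto simp: \<tau>_def)
  have \<tau>_less: "\<tau> i < \<tau> (Suc i)" if "i < k" for i
    using that tsJ[of i] ts_less[of "i - 1" i] by (cases i) (auto simp: \<tau>_def min_def)
  have \<tau>_mono: "mono \<tau>"
  proof (rule mono_iff_le_Suc[THEN iffD2], intro allI)
    fix i show "\<tau> i \<le> \<tau> (Suc i)" using \<tau>_less[of i] by (cases "i < k") (auto simp: \<tau>_def min_def)
  qed
  \<comment> \<open>The price of period \<open>q\<close> depends on the first \<open>q - 1\<close> tosses.\<close>
  define c where "c n i = (if i = 0 \<or> k = 0 then 0 else period n (ts ! (min i k - 1)) - 1)" for n i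
  have c_Suc: "i < k \<Longrightarrow> c n (Suc i) = period n (ts ! i) - 1" for n i by (auto simp: c_def min_def)
  have c_0: "c n 0 = 0" for n by (simp add: c_def)
  have c_mono: "mono (c n)" for n
  proof (rule monoI)
    fix i j :: nat assume ij: "i \<le> j"
    have "ts ! (min i k - 1) \<le> ts ! (min j k - 1)" if "i \<noteq> 0" "k \<noteq> 0"
    proof (rule sorted_nth_mono[OF ts(1)])
      show "min i k - 1 \<le> min j k - 1" using ij by linarith
      have "min j k - 1 < k" using that ij by linarith
      then show "min j k - 1 < length ts" by (simp add: k_def)
    qed
    then show "c n i \<le> c n j" using ij period_mono by (auto simp: c_def intro!: diff_le_mono)
  qed
  have c_le: "c n k \<le> n" if "1 \<le> n" for n
    using period_bounds[OF that, of "ts ! (k - 1)"] tsJ[of "k - 1"] by (auto simp: c_def)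
  define m where "m n i = c n (Suc i) - c n i" for n i
  have c_lim: "(\<lambda>n. real (c n i) / real n) \<longlonglongrightarrow> \<tau> i" if "i \<le> k" for i
  proof (cases i)
    case 0
    then show ?thesis by (simp add: c_def \<tau>_0)
  next
    case (Suc j)
    then have j: "j < k" using that by simp
    have "(\<lambda>n. real (period n (ts ! j)) / real n - 1 / real n) \<longlonglongrightarrow> ts ! j - 0"
      using lim_inverse_n by (intro tendsto_diff period_tendsto tsJ j) (simp add: inverse_eq_divide)
    moreover have "real (period n (ts ! j)) / real n - 1 / real n = real (c n i) / real n" for n
      using j Suc by (simp add: c_Suc period_def of_nat_diff diff_divide_distrib)
    ultimately show ?thesis using Suc \<tau>_Suc[OF j] by simp
  qed
  have m_lim: "(\<lambda>n. real (m n i) / real n) \<longlonglongrightarrow> \<tau> (Suc i) - \<tau> i" if "i < k" for i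
  proof -
    have "real (m n i) / real n = real (c n (Suc i)) / real n - real (c n i) / real n" for n
      using monoD[OF c_mono, of i "Suc i" n] by (simp add: m_def of_nat_diff diff_divide_distrib)
    then show ?thesis using that by (auto intro!: tendsto_diff c_lim)
  qed
  define \<Theta> where "\<Theta> x = \<theta> (\<lambda>t\<in>J. x (idx t))" for x :: "nat \<Rightarrow> real"
  have \<Theta>_cont: "continuous_on UNIV \<Theta>"
    unfolding \<Theta>_def[abs_def] by (rule continuous_test_function[OF \<theta>])
  note [measurable] = continuous_seq_imp_borel[OF \<Theta>_cont]
  obtain b where b: "\<And>x. \<bar>\<Theta> x\<bar> \<le> b"
  proof -
    obtain b where "\<And>y. y \<in> \<theta> ` (J \<rightarrow>\<^sub>E UNIV) \<Longrightarrow> norm y \<le> b" using bdd by (auto simp: bounded_iff)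
    then have "\<bar>\<Theta> x\<bar> \<le> b" for x by (auto simp: \<Theta>_def)
    then show ?thesis using that by blast
  qed
  \<comment> \<open>The values \<open>P i\<close> at the partial sums, filled up with zeros to a full sequence.\<close>
  define path where "path P v i = (if i < k then P i (\<Sum>j<Suc i. v j) else 0)" for P :: "nat \<Rightarrow> real \<Rightarrow> real" and v and i :: nat
  have path_meas: "(\<lambda>v. \<Theta> (path P v)) \<in> borel_measurable ?PB"
    if P: "\<And>i. i < k \<Longrightarrow> P i \<in> borel_measurable borel" for P
  proof (rule measurable_compose[OF _ continuous_seq_imp_borel[OF \<Theta>_cont]])
    show "(\<lambda>v. path P v) \<in> measurable ?PB (\<Pi>\<^sub>M i\<in>UNIV. borel)"
    proof (rule measurable_PiM_single')
      fix i
      show "(\<lambda>v. path P v i) \<in> borel_measurable ?PB"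
      proof (cases "i < k")
        case True
        have "(\<lambda>v. \<Sum>j<Suc i. v j) \<in> borel_measurable ?PB"
          using True by (intro borel_measurable_sum measurable_component_singleton) auto
        from measurable_compose[OF this P[OF True]] show ?thesis using True by (simp add: path_def)
      qed (simp add: path_def)
    qed (auto simp: space_PiM)
  qed
  define Pn where "Pn n i = kernel n (n - period n (ts ! i))" for n i
  define PG where "PG i = G (ts ! i)" for i
  have Pn_meas: "1 \<le> n \<Longrightarrow> Pn n i \<in> borel_measurable borel" for n i
    unfolding Pn_def by (rule kernel_borel)
  have PG_meas: "PG i \<in> borel_measurable borel" for i
    using K.G_borel unfolding PG_def .
  have disc: "(\<integral>\<omega>. \<theta> (\<lambda>t\<in>J. price_path n (p n) t \<omega>) \<partial>uniform_count_measure (states n)) =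
      (\<integral>x. \<Theta> (path (Pn n) (\<lambda>j\<in>{..<k}. sqrt (real (m n j) / real n) * W (m n j) (x j))) \<partial>?PO)"
    if n: "1 \<le> n" for n
  proof -
    have "(\<integral>\<omega>. \<theta> (\<lambda>t\<in>J. price_path n (p n) t \<omega>) \<partial>uniform_count_measure (states n))
      = avg n (\<lambda>\<omega>. \<theta> (\<lambda>t\<in>J. price_path n (p n) t \<omega>))" by (rule integral_uniform_states)
    also have "\<dots> = avg n (\<lambda>\<omega>. \<Theta> (path (Pn n) (\<lambda>j\<in>{..<k}. (\<Sum>i\<in>{c n j..<c n (Suc j)}. \<omega> ! i) / sqrt (real n))))"
    proof (rule avg_cong)
      fix \<omega> assume \<omega>: "\<omega> \<in> states n"
      show "\<theta> (\<lambda>t\<in>J. price_path n (p n) t \<omega>) = \<Theta> (path (Pn n) (\<lambda>j\<in>{..<k}. (\<Sum>i\<in>{c n j..<c n (Suc j)}. \<omega> ! i) / sqrt (real n)))"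
        unfolding \<Theta>_def
      proof (intro arg_cong[where f = \<theta>] restrict_ext)
        fix t assume t: "t \<in> J"
        define i where "i = idx t"
        have i: "i < k" "ts ! i = t" using idx[OF t] by (auto simp: i_def)
        have t1: "t \<le> 1" using t J by auto
        define q where "q = period n t"
        have q: "1 \<le> q" "q \<le> n" using period_bounds[OF n t1] by (auto simp: q_def)
        have ci: "c n (Suc i) = q - 1" using c_Suc[OF i(1), of n] i by (simp add: q_def)
        have pre: "take (q - 1) \<omega> \<in> states (q - 1)"
          using \<omega> q set_take_subset[of "q - 1" \<omega>] by (auto simp: states_def)
        have "price_path n (p n) t \<omega> = p n (Suc (q - 1)) (take (q - 1) \<omega>)"
          using q by (simp add: price_path_def q_def period_def Let_def)
        also have "\<dots> = kernel n (n - q) (sum_list (take (q - 1) \<omega>) / sqrt (real n))"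
          by (rule price_eq_kernel[OF p[OF n] _ pre]) (use q in simp)
        also have "sum_list (take (q - 1) \<omega>) / sqrt (real n) = (\<Sum>j<Suc i. (\<lambda>j\<in>{..<k}. (\<Sum>i\<in>{c n j..<c n (Suc j)}. \<omega> ! i) / sqrt (real n)) j)"
        proof -
          have "sum_list (take (q - 1) \<omega>) = (\<Sum>l<q - 1. \<omega> ! l)"
            using length_states[OF \<omega>] q by (simp add: sum_list_sum_nth atLeast0LessThan min_def)
          also have "\<dots> = (\<Sum>l\<in>{c n 0..<c n (Suc i)}. \<omega> ! l)"
            by (simp only: ci c_0 atLeast0LessThan)
          also have "\<dots> = (\<Sum>j<Suc i. \<Sum>l\<in>{c n j..<c n (Suc j)}. \<omega> ! l)"
            by (rule sum_blocks[OF c_mono])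
          finally have "sum_list (take (q - 1) \<omega>) = (\<Sum>j<Suc i. \<Sum>l\<in>{c n j..<c n (Suc j)}. \<omega> ! l)" .
          then show ?thesis using i by (simp add: sum_divide_distrib del: sum.lessThan_Suc)
        qed
        finally show "price_path n (p n) t \<omega> = path (Pn n) (\<lambda>j\<in>{..<k}. (\<Sum>i\<in>{c n j..<c n (Suc j)}. \<omega> ! i) / sqrt (real n)) (idx t)"
          using i unfolding i_def[symmetric] by (simp add: path_def Pn_def q_def)
      qed
    qed
    also have "\<dots> = (\<integral>x. \<Theta> (path (Pn n) (\<lambda>j\<in>{..<k}. sqrt (real (m n j) / real n) * W (m n j) (x j))) \<partial>?PO)"
      unfolding m_def by (rule C.avg_blocks[OF c_mono c_le[OF n] path_meas]) (rule Pn_meas[OF n])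
    finally show ?thesis .
  qed
  interpret PO: prob_space ?PO by (rule prob_space_PiM) (rule C.prob_space_axioms)
  define V where "V x = (\<lambda>j\<in>{..<k}. sqrt (\<tau> (Suc j) - \<tau> j) * Wlim (x j))" for x :: "nat \<Rightarrow> real"
  have lim: "(\<integral>\<omega>. \<theta> (\<lambda>t\<in>J. G t (B t \<omega>)) \<partial>M) = (\<integral>x. \<Theta> (path PG (V x)) \<partial>?PO)"
  proof -
    have "(\<integral>\<omega>. \<theta> (\<lambda>t\<in>J. G t (B t \<omega>)) \<partial>M) = (\<integral>\<omega>. \<Theta> (path PG (\<lambda>j\<in>{..<k}. B (\<tau> (Suc j)) \<omega> - B (\<tau> j) \<omega>)) \<partial>M)"
    proof (rule integral_cong_AE)
      have eq: "\<theta> (\<lambda>t\<in>J. G t (B t \<omega>)) = \<Theta> (\<lambda>i. if i < k then PG i (B (ts ! i) \<omega>) else 0)" for \<omega>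
        unfolding \<Theta>_def by (intro arg_cong[where f = \<theta>] restrict_ext) (use idx in \<open>auto simp: PG_def\<close>)
      show "(\<lambda>\<omega>. \<theta> (\<lambda>t\<in>J. G t (B t \<omega>))) \<in> borel_measurable M"
      proof (rule test_function_measurable[OF J(1) \<theta>])
        fix t assume "t \<in> J"
        then have "B t \<in> borel_measurable M" using J(2) by (intro K.B_meas) auto
        from measurable_compose[OF this K.G_borel] show "(\<lambda>\<omega>. G t (B t \<omega>)) \<in> borel_measurable M" .
      qed
      have "(\<lambda>\<omega>. \<lambda>j\<in>{..<k}. B (\<tau> (Suc j)) \<omega> - B (\<tau> j) \<omega>) \<in> measurable M ?PB"
        by (intro measurable_restrict borel_measurable_diff K.B_meas \<tau>_nonneg)
      from measurable_compose[OF this path_meas[of PG]]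
      show "(\<lambda>\<omega>. \<Theta> (path PG (\<lambda>j\<in>{..<k}. B (\<tau> (Suc j)) \<omega> - B (\<tau> j) \<omega>))) \<in> borel_measurable M"
        using PG_meas by simp
      show "AE \<omega> in M. \<theta> (\<lambda>t\<in>J. G t (B t \<omega>)) = \<Theta> (path PG (\<lambda>j\<in>{..<k}. B (\<tau> (Suc j)) \<omega> - B (\<tau> j) \<omega>))"
        using K.B_0
      proof eventually_elim
        case (elim \<omega>)
        have "(\<Sum>j<Suc i. (\<lambda>j\<in>{..<k}. B (\<tau> (Suc j)) \<omega> - B (\<tau> j) \<omega>) j) = B (ts ! i) \<omega>" if i: "i < k" for i
        proof -
          have "(\<Sum>j<Suc i. (\<lambda>j\<in>{..<k}. B (\<tau> (Suc j)) \<omega> - B (\<tau> j) \<omega>) j) = (\<Sum>j<Suc i. B (\<tau> (Suc j)) \<omega> - B (\<tau> j) \<omega>)"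
            using i by (intro sum.cong) auto
          also have "\<dots> = B (\<tau> (Suc i)) \<omega> - B (\<tau> 0) \<omega>" by (rule sum_lessThan_telescope)
          finally show ?thesis using i elim by (simp add: \<tau>_0 \<tau>_Suc)
        qed
        then have "path PG (\<lambda>j\<in>{..<k}. B (\<tau> (Suc j)) \<omega> - B (\<tau> j) \<omega>) = (\<lambda>i. if i < k then PG i (B (ts ! i) \<omega>) else 0)"
          unfolding path_def by (auto simp del: sum.lessThan_Suc)
        then show ?case by (simp only: eq)
      qed
    qed
    also have "\<dots> = (\<integral>x. \<Theta> (path PG (\<lambda>j\<in>{..<k}. sqrt (\<tau> (Suc j) - \<tau> j) * Wlim (x j))) \<partial>?PO)"
    proof (rule integral_indep_vars_cong[OF K.prob_space_axioms PO.prob_space_axioms _ _ _ path_meas])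
      show "K.indep_vars (\<lambda>_. borel) (\<lambda>j \<omega>. B (\<tau> (Suc j)) \<omega> - B (\<tau> j) \<omega>) {..<k}"
        using bm \<tau>_mono \<tau>_nonneg unfolding brownian_motion_def by blast
      show "PO.indep_vars (\<lambda>_. borel) (\<lambda>j x. sqrt (\<tau> (Suc j) - \<tau> j) * Wlim (x j)) {..<k}"
        by (rule PO.indep_vars_compose2[OF indep_vars_PiM_coords]) (auto intro: C.prob_space_axioms)
      fix j assume j: "j \<in> {..<k}"
      have "distr ?PO borel (\<lambda>x. sqrt (\<tau> (Suc j) - \<tau> j) * Wlim (x j))
        = distr (distr (distr ?PO \<Omega> (\<lambda>x. x j)) borel Wlim) borel (\<lambda>z. sqrt (\<tau> (Suc j) - \<tau> j) * z)"
        using j by (simp add: distr_distr comp_def)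
      also have "distr ?PO \<Omega> (\<lambda>x. x j) = \<Omega>"
        using j by (intro distr_PiM_component C.prob_space_axioms)
      finally show "distr M borel (\<lambda>\<omega>. B (\<tau> (Suc j)) \<omega> - B (\<tau> j) \<omega>) =
          distr ?PO borel (\<lambda>x. sqrt (\<tau> (Suc j) - \<tau> j) * Wlim (x j))"
        using K.increment_law[OF \<tau>_nonneg \<tau>_less] j by (simp add: C.distr_Wlim)
    qed (rule PG_meas)
    finally show ?thesis by (simp add: V_def)
  qed
  define Vn where "Vn n x = (\<lambda>j\<in>{..<k}. sqrt (real (m n j) / real n) * W (m n j) (x j))" for n and x :: "nat \<Rightarrow> real"
  \<comment> \<open>The shift to \<open>Suc n\<close> skips the empty game \<open>n = 0\<close>, about which nothing is assumed.\<close>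
  have "(\<lambda>n. \<integral>x. \<Theta> (path (Pn (Suc n)) (Vn (Suc n) x)) \<partial>?PO) \<longlonglongrightarrow> (\<integral>x. \<Theta> (path PG (V x)) \<partial>?PO)"
  proof (rule integral_dominated_convergence[where w = "\<lambda>_. b"])
    have coord: "j < k \<Longrightarrow> (\<lambda>x. x j) \<in> measurable ?PO \<Omega>" for j
      by (rule measurable_component_singleton) simp
    have "V \<in> measurable ?PO ?PB"
      unfolding V_def[abs_def]
      by (intro measurable_restrict borel_measurable_times borel_measurable_const measurable_compose[OF coord C.Wlim_meas]) auto
    from measurable_compose[OF this path_meas[of PG]]
    show "(\<lambda>x. \<Theta> (path PG (V x))) \<in> borel_measurable ?PO" using PG_meas by simp
    fix n
    have "Vn (Suc n) \<in> measurable ?PO ?PB"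
      unfolding Vn_def[abs_def]
      by (intro measurable_restrict borel_measurable_times borel_measurable_const measurable_compose[OF coord C.W_meas]) auto
    from measurable_compose[OF this path_meas[of "Pn (Suc n)"]]
    show "(\<lambda>x. \<Theta> (path (Pn (Suc n)) (Vn (Suc n) x))) \<in> borel_measurable ?PO" using Pn_meas by simp
    show "AE x in ?PO. norm (\<Theta> (path (Pn (Suc n)) (Vn (Suc n) x))) \<le> b" using b by simp
  next
    show "AE x in ?PO. (\<lambda>n. \<Theta> (path (Pn (Suc n)) (Vn (Suc n) x))) \<longlonglongrightarrow> \<Theta> (path PG (V x))"
    proof (rule AE_I2)
      fix x assume x: "x \<in> space ?PO"
      have Vlim: "(\<lambda>n. Vn n x j) \<longlonglongrightarrow> V x j" if j: "j < k" for j
      proof -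
        have "x j \<in> space \<Omega>" using x j by (auto simp: space_PiM)
        from C.scaled_W_tendsto[OF m_lim[OF j] _ this] \<tau>_less[OF j]
        show ?thesis using j by (simp add: Vn_def V_def)
      qed
      have "(\<lambda>n. \<Theta> (path (Pn n) (Vn n x))) \<longlonglongrightarrow> \<Theta> (path PG (V x))"
      proof (rule continuous_seq_tendsto[OF \<Theta>_cont])
        fix i
        show "(\<lambda>n. path (Pn n) (Vn n x) i) \<longlonglongrightarrow> path PG (V x) i"
        proof (cases "i < k")
          case True
          have "(\<lambda>n. \<Sum>j<Suc i. Vn n x j) \<longlonglongrightarrow> (\<Sum>j<Suc i. V x j)"
            using True by (intro tendsto_sum Vlim) auto
          from kernel_tendsto[OF this tsJ[OF True]] show ?thesis
            using True by (simp add: path_def Pn_def PG_def del: sum.lessThan_Suc)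
        qed (simp add: path_def)
      qed
      then show "(\<lambda>n. \<Theta> (path (Pn (Suc n)) (Vn (Suc n) x))) \<longlonglongrightarrow> \<Theta> (path PG (V x))"
        by (rule LIMSEQ_Suc)
    qed
  qed simp
  then have "(\<lambda>n. \<integral>\<omega>. \<theta> (\<lambda>t\<in>J. price_path (Suc n) (p (Suc n)) t \<omega>) \<partial>uniform_count_measure (states (Suc n))) \<longlonglongrightarrow> (\<integral>\<omega>. \<theta> (\<lambda>t\<in>J. G t (B t \<omega>)) \<partial>M)"
    by (simp add: disc lim Vn_def)
  then show "(\<lambda>n. \<integral>\<omega>. \<theta> (\<lambda>t\<in>J. price_path n (p n) t \<omega>) \<partial>uniform_count_measure (states n)) \<longlonglongrightarrow> (\<integral>\<omega>. \<theta> (\<lambda>t\<in>J. G t (B t \<omega>)) \<partial>M)"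
    by (rule LIMSEQ_imp_Suc)
qed

end

theorem theorem35:
  fixes \<mu> \<nu> :: "real measure" and H :: "real \<Rightarrow> real"
    and Q :: "nat \<Rightarrow> (real list \<times> real) measure"
    and X :: "nat \<Rightarrow> real list \<Rightarrow> real"
    and p :: "nat \<Rightarrow> nat \<Rightarrow> real list \<Rightarrow> real"
    and M :: "'w measure" and B :: "real \<Rightarrow> 'w \<Rightarrow> real"
  assumes "admissible_prior \<mu>"
    and "admissible_risk H"
    and "\<And>n. n \<ge> 1 \<Longrightarrow> nash_equilibrium n \<mu> H (Q n) (X n)"
    and "\<And>n. n \<ge> 1 \<Longrightarrow> X n = payoff_of_prices n (p n)"
    and "real_distribution \<nu>"
    and "T_op \<mu> H std_normal \<nu> = std_normal"
    and "brownian_motion M B"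
  shows "converges_fdd {0<..1} (\<lambda>n. uniform_count_measure (states n)) (\<lambda>n. price_path n (p n))
           M (limit_process \<mu> \<nu> M B)
         \<and> cmmv M (limit_process \<mu> \<nu> M B)"
proof
  obtain \<Omega> W Wlim where "walk_coupling \<Omega> W Wlim" using walk_coupling_exists by blast
  then interpret game_sequence \<mu> \<nu> H \<Omega> W Wlim Q X
    using assms(1-3,5,6)
    by (intro game_sequence.intro limit_eq.intro prior_pair.intro prior.intro risk.intro limit_eq_axioms.intro
        game_sequence_axioms.intro)
  interpret K: bm_kernel M B \<gamma> by (rule bm_kernel) fact
  have Z: "limit_process \<mu> \<nu> M B = (\<lambda>t. cond_exp_on M (B t) (\<lambda>\<omega>. \<gamma> (B 1 \<omega>)))"
    by (simp add: limit_process_def[abs_def] deriv_psi)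
  show "cmmv M (limit_process \<mu> \<nu> M B)"
    unfolding Z by (rule K.cmmv_cond_exp)
  have conv: "converges_fdd {0<..1} (\<lambda>n. uniform_count_measure (states n)) (\<lambda>n. price_path n (p n)) M (\<lambda>t \<omega>. G t (B t \<omega>))"
    using assms(4,7) by (rule fdd_convergence)
  show "converges_fdd {0<..1} (\<lambda>n. uniform_count_measure (states n)) (\<lambda>n. price_path n (p n)) M (limit_process \<mu> \<nu> M B)"
    unfolding converges_fdd_def
  proof (intro allI impI)
    fix J :: "real set" and \<theta> :: "(real \<Rightarrow> real) \<Rightarrow> real"
    assume J: "finite J" "J \<subseteq> {0<..1}" and \<theta>: "continuous_map (product_topology (\<lambda>_. euclideanreal) J) euclideanreal \<theta>"
      "bounded (\<theta> ` (J \<rightarrow>\<^sub>E UNIV))"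
    have "(\<integral>\<omega>. \<theta> (\<lambda>t\<in>J. limit_process \<mu> \<nu> M B t \<omega>) \<partial>M) = (\<integral>\<omega>. \<theta> (\<lambda>t\<in>J. G t (B t \<omega>)) \<partial>M)"
    proof (rule integral_cong_AE)
      show "(\<lambda>\<omega>. \<theta> (\<lambda>t\<in>J. limit_process \<mu> \<nu> M B t \<omega>)) \<in> borel_measurable M"
        by (rule test_function_measurable[OF J(1) \<theta>(1)]) (simp add: limit_process_def[abs_def] cond_exp_on_def)
      show "(\<lambda>\<omega>. \<theta> (\<lambda>t\<in>J. G t (B t \<omega>))) \<in> borel_measurable M"
      proof (rule test_function_measurable[OF J(1) \<theta>(1)])
        fix t assume "t \<in> J"
        then have "B t \<in> borel_measurable M" using J(2) by (intro K.B_meas) auto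
        from measurable_compose[OF this K.G_borel] show "(\<lambda>\<omega>. G t (B t \<omega>)) \<in> borel_measurable M" .
      qed
      have "AE \<omega> in M. \<forall>t\<in>J. limit_process \<mu> \<nu> M B t \<omega> = G t (B t \<omega>)"
      proof (rule AE_finite_allI[OF J(1)])
        fix t assume "t \<in> J"
        then show "AE \<omega> in M. limit_process \<mu> \<nu> M B t \<omega> = G t (B t \<omega>)"
          unfolding Z using J(2) by (intro K.cond_exp_given_B) auto
      qed
      then show "AE \<omega> in M. \<theta> (\<lambda>t\<in>J. limit_process \<mu> \<nu> M B t \<omega>) = \<theta> (\<lambda>t\<in>J. G t (B t \<omega>))"
        by eventually_elim (auto intro!: arg_cong[where f = \<theta>] restrict_ext)
    qed
    then show "(\<lambda>n. \<integral>\<omega>. \<theta> (\<lambda>t\<in>J. price_path n (p n) t \<omega>) \<partial>uniform_count_measure (states n)) \<longlonglongrightarrow>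
        (\<integral>\<omega>. \<theta> (\<lambda>t\<in>J. limit_process \<mu> \<nu> M B t \<omega>) \<partial>M)"
      using conv J \<theta> unfolding converges_fdd_def by simp
  qed
qed

end
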